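(* Let $A,B,C$ be algebras and $R_1:B\otimes A\to A\otimes B$, $R_2:C\otimes B\to B\otimes C$, $R_3:C\otimes A\to A\otimes C$ be unital twisting maps satisfying the hexagon equation $$(A\otimes R_2)\circ(R_3\otimes B)\circ(C\otimes R_1)=(R_1\otimes C)\circ(B\otimes R_3)\circ(R_2\otimes A).$$ Let $M$ be a left $A$-module, $N$ a left $B$-module, $P$ a left $C$-module, and let $\tau_{M,B}:B\otimes M\to M\otimes B$, $\tau_{M,C}:C\otimes M\to M\otimes C$, $\tau_{N,C}:C\otimes N\to N\otimes C$ be module twisting maps (relative to $R_1$, $R_3$, $R_2$ respectively). Suppose that the module hexagon condition holds: $$(M\otimes R_2)\circ(\tau_{M,C}\otimes B)\circ(C\otimes\tau_{M,B})=(\tau_{M,B}\otimes C)\circ(B\otimes\tau_{M,C})\circ(R_2\otimes M).$$ Then: (1) The map $\sigma_C:C\otimes(M\otimes N)\to(M\otimes N)\otimes C$, $\sigma_C:=(M\otimes\tau_{N,C})\circ(\tau_{M,C}\otimes N)$, is a module twisting map relative to $T_1:=(A\otimes R_2)\circ(R_3\otimes B)$, where $M\otimes N$ is the $A\otimes_{R_1}B$-module determined by $\tau_{M,B}$ (thus giving a left $(A\otimes_{R_1}B)\otimes_{T_1}C$-module structure on $(M\otimes N)\otimes P$). (2) The map $\sigma_{B\otimes C}:(B\otimes C)\otimes M\to M\otimes(B\otimes C)$, $\sigma_{B\otimes C}:=(\tau_{M,B}\otimes C)\circ(B\otimes\tau_{M,C})$, is a module twisting map relative to $T_2:=(R_1\otimes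 C)\circ(B\otimes R_3)$ (giving a left $A\otimes_{T_2}(B\otimes_{R_2}C)$-module structure on $M\otimes(N\otimes P)$, where $N\otimes P$ is the $B\otimes_{R_2}C$-module determined by $\tau_{N,C}$). Moreover, the module structures induced on $M\otimes N\otimes P$ by $\sigma_C$ and by $\sigma_{B\otimes C}$ are equal.
   Context: Fix a field or commutative ring $k$; $\otimes=\otimes_k$; algebras are associative unital $k$-algebras, $\mu_A$ is the product of $A$ and $\lambda_M$ the action of an algebra on a left module $M$. An object also denotes its identity map. A twisting map for algebras $A,B$ is a $k$-linear map $R:B\otimes A\to A\otimes B$ with $$R\circ(B\otimes\mu_A)=(\mu_A\otimes B)\circ(A\otimes R)\circ(R\otimes A),\qquad R\circ(\mu_B\otimes A)=(A\otimes\mu_B)\circ(R\otimes B)\circ(B\otimes R).$$ $A\otimes_R B$ denotes $A\otimes B$ with the associative product $\mu_R:=(\mu_A\otimes\mu_B)\circ(A\otimes R\otimes B)$. $R$ is unital if $R(1\otimes a)=a\otimes1$, $R(b\otimes1)=1\otimes b$. Under the hexagon equation, $T_1:C\otimes(A\otimes_{R_1}B)\to(A\otimes_{R_1}B)\otimes C$ and $T_2:(B\otimes_{R_2}C)\otimes A\to A\otimes(B\otimes_{R_2}C)$ are twisting maps and $(A\otimes_{R_1}B)\otimes_{T_1}C=A\otimes_{T_2}(B\otimes_{R_2}C)$ as algebras. Given a twisting map $R:B\otimes A\to A\otimes B$ and a left $A$-module $M$, a (left) module twisting map relative to $R$ is a linear map $\tau_{M,B}:B\otimes M\to M\otimes B$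 such that $$\tau_{M,B}\circ(\mu_B\otimes M)=(M\otimes\mu_B)\circ(\tau_{M,B}\otimes B)\circ(B\otimes\tau_{M,B}),$$ $$\tau_{M,B}\circ(B\otimes\lambda_M)=(\lambda_M\otimes B)\circ(A\otimes\tau_{M,B})\circ(R\otimes M).$$ If $N$ is a left $B$-module, it determines on $M\otimes N$ the left $A\otimes_R B$-action $(\lambda_M\otimes\lambda_N)\circ(A\otimes\tau_{M,B}\otimes N)$. Since no unit condition is imposed on module twisting maps, "module" for these induced structures means an associative action. *)

theory Defs
  imports "HOL-Algebra.Module" "HOL-Algebra.Free_Abelian_Groups"
begin

section \<open>Linear maps and algebras\<close>

definition linear_map ::
    "('k, 'r) ring_scheme \<Rightarrow> ('k, 'm, 'x) module_scheme \<Rightarrow> ('k, 'n, 'y) module_scheme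
      \<Rightarrow> ('m \<Rightarrow> 'n) \<Rightarrow> bool"
  where "linear_map k M N f \<longleftrightarrow>
    f \<in> carrier M \<rightarrow> carrier N \<and>
    (\<forall>x\<in>carrier M. \<forall>y\<in>carrier M. f (x \<oplus>\<^bsub>M\<^esub> y) = f x \<oplus>\<^bsub>N\<^esub> f y) \<and>
    (\<forall>a\<in>carrier k. \<forall>x\<in>carrier M. f (a \<odot>\<^bsub>M\<^esub> x) = a \<odot>\<^bsub>N\<^esub> f x)"

text \<open>The locale \<open>algebra\<close> of the library is restricted to commutative algebras.\<close>

locale assoc_algebra = module k A + A: ring A
  for k :: "('k, 'r) ring_scheme" and A :: "('k, 'a, 'x) module_scheme" +
  assumes smult_mult_left:
      "\<lbrakk>c \<in> carrier k; x \<in> carrier A; y \<in> carrier A\<rbrakk>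
        \<Longrightarrow> (c \<odot>\<^bsub>A\<^esub> x) \<otimes>\<^bsub>A\<^esub> y = c \<odot>\<^bsub>A\<^esub> (x \<otimes>\<^bsub>A\<^esub> y)"
    and smult_mult_right:
      "\<lbrakk>c \<in> carrier k; x \<in> carrier A; y \<in> carrier A\<rbrakk>
        \<Longrightarrow> x \<otimes>\<^bsub>A\<^esub> (c \<odot>\<^bsub>A\<^esub> y) = c \<odot>\<^bsub>A\<^esub> (x \<otimes>\<^bsub>A\<^esub> y)"


section \<open>Tensor products over a commutative ring\<close>

text \<open>
  The tensor product of \<open>M\<close> and \<open>N\<close> is the free abelian group on
  \<open>carrier M \<times> carrier N\<close> modulo the biadditivity and \<open>k\<close>-balancedness relations; its elements
  are cosets. The multiplicative part of the record carries no information.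
\<close>

type_synonym ('m, 'n) tensor = "('m \<times> 'n \<Rightarrow>\<^sub>0 int) set"

definition tensor_relations ::
    "('k, 'r) ring_scheme \<Rightarrow> ('k, 'm, 'x) module_scheme \<Rightarrow> ('k, 'n, 'y) module_scheme
      \<Rightarrow> ('m, 'n) tensor"
  where "tensor_relations k M N =
    {frag_of (x \<oplus>\<^bsub>M\<^esub> x', y) - frag_of (x, y) - frag_of (x', y) | x x' y.
        x \<in> carrier M \<and> x' \<in> carrier M \<and> y \<in> carrier N} \<union>
    {frag_of (x, y \<oplus>\<^bsub>N\<^esub> y') - frag_of (x, y) - frag_of (x, y') | x y y'.
        x \<in> carrier M \<and> y \<in> carrier N \<and> y' \<in> carrier N} \<union>
    {frag_of (c \<odot>\<^bsub>M\<^esub> x, y) - frag_of (x, c \<odot>\<^bsub>N\<^esub> y) | c x y.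
        c \<in> carrier k \<and> x \<in> carrier M \<and> y \<in> carrier N}"

definition pure_tensor ::
    "('k, 'r) ring_scheme \<Rightarrow> ('k, 'm, 'x) module_scheme \<Rightarrow> ('k, 'n, 'y) module_scheme
      \<Rightarrow> 'm \<Rightarrow> 'n \<Rightarrow> ('m, 'n) tensor"
  where "pure_tensor k M N x y =
    (let F = free_Abelian_group (carrier M \<times> carrier N)
     in generate F (tensor_relations k M N) #>\<^bsub>F\<^esub> frag_of (x, y))"

definition tensor ::
    "('k, 'r) ring_scheme \<Rightarrow> ('k, 'm, 'x) module_scheme \<Rightarrow> ('k, 'n, 'y) module_scheme
      \<Rightarrow> ('k, ('m, 'n) tensor) module"  (\<open>(_ \<boxtimes>\<index> _)\<close> [76, 75] 75)
  where "M \<boxtimes>\<^bsub>k\<^esub> N =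
    (let F = free_Abelian_group (carrier M \<times> carrier N);
         H = generate F (tensor_relations k M N)
     in \<lparr>carrier = carrier (F Mod H), monoid.mult = undefined, monoid.one = undefined,
         ring.zero = \<one>\<^bsub>F Mod H\<^esub>, add = monoid.mult (F Mod H),
         smult = (\<lambda>c X. \<Union>u\<in>X. H #>\<^bsub>F\<^esub> frag_extend (\<lambda>(x, y). frag_of (c \<odot>\<^bsub>M\<^esub> x, y)) u)\<rparr>)"

text \<open>
  The linear map on a tensor product induced by a bilinear map \<open>\<phi>\<close> into \<open>P\<close>: on the class of
  \<open>\<Sum> n\<^sub>i (x\<^sub>i, y\<^sub>i)\<close> its value is \<open>\<Sum> n\<^sub>i \<phi> x\<^sub>i y\<^sub>i\<close>. For bilinear \<open>\<phi>\<close> this does not depend on the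
  representative, so that the image of the coset below is a singleton.
\<close>

definition tensor_lift ::
    "('k, 'p, 'z) module_scheme \<Rightarrow> ('m \<Rightarrow> 'n \<Rightarrow> 'p) \<Rightarrow> ('m, 'n) tensor \<Rightarrow> 'p"
  where "tensor_lift P \<phi> X = the_elem
    ((\<lambda>u. \<Oplus>\<^bsub>P\<^esub>z\<in>Poly_Mapping.keys u. [Poly_Mapping.lookup u z] \<cdot>\<^bsub>P\<^esub> \<phi> (fst z) (snd z)) ` X)"

text \<open>\<open>tensor_map k M N f g\<close> is \<open>f \<otimes> g\<close>; the modules \<open>M\<close> and \<open>N\<close> are the codomains of \<open>f\<close>, \<open>g\<close>.\<close>

definition tensor_map ::
    "('k, 'r) ring_scheme \<Rightarrow> ('k, 'm, 'x) module_scheme \<Rightarrow> ('k, 'n, 'y) module_scheme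
      \<Rightarrow> ('u \<Rightarrow> 'm) \<Rightarrow> ('v \<Rightarrow> 'n) \<Rightarrow> ('u, 'v) tensor \<Rightarrow> ('m, 'n) tensor"
  where "tensor_map k M N f g =
    tensor_lift (M \<boxtimes>\<^bsub>k\<^esub> N) (\<lambda>x y. pure_tensor k M N (f x) (g y))"

text \<open>The associativity isomorphism \<open>(X \<otimes> Y) \<otimes> Z \<rightarrow> X \<otimes> (Y \<otimes> Z)\<close> and its inverse.\<close>

definition assoc ::
    "('k, 'r) ring_scheme \<Rightarrow> ('k, 'u, 'x) module_scheme \<Rightarrow> ('k, 'v, 'y) module_scheme
      \<Rightarrow> ('k, 'w, 'z) module_scheme \<Rightarrow> (('u, 'v) tensor, 'w) tensor \<Rightarrow> ('u, ('v, 'w) tensor) tensor"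
  where "assoc k X Y Z =
    tensor_lift (X \<boxtimes>\<^bsub>k\<^esub> (Y \<boxtimes>\<^bsub>k\<^esub> Z)) (\<lambda>t z.
      tensor_lift (X \<boxtimes>\<^bsub>k\<^esub> (Y \<boxtimes>\<^bsub>k\<^esub> Z)) (\<lambda>x y.
        pure_tensor k X (Y \<boxtimes>\<^bsub>k\<^esub> Z) x (pure_tensor k Y Z y z)) t)"

definition assoc_inv ::
    "('k, 'r) ring_scheme \<Rightarrow> ('k, 'u, 'x) module_scheme \<Rightarrow> ('k, 'v, 'y) module_scheme
      \<Rightarrow> ('k, 'w, 'z) module_scheme \<Rightarrow> ('u, ('v, 'w) tensor) tensor \<Rightarrow> (('u, 'v) tensor, 'w) tensor"
  where "assoc_inv k X Y Z =
    tensor_lift ((X \<boxtimes>\<^bsub>k\<^esub> Y) \<boxtimes>\<^bsub>k\<^esub> Z) (\<lambda>x t.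
      tensor_lift ((X \<boxtimes>\<^bsub>k\<^esub> Y) \<boxtimes>\<^bsub>k\<^esub> Z) (\<lambda>y z.
        pure_tensor k (X \<boxtimes>\<^bsub>k\<^esub> Y) Z (pure_tensor k X Y x y) z) t)"


section \<open>Composites of exchange maps\<close>

text \<open>
  For \<open>f : Z \<otimes> X \<rightarrow> X \<otimes> Z\<close> and \<open>g : Z \<otimes> Y \<rightarrow> Y \<otimes> Z\<close>, the map
  \<open>(X \<otimes> g) \<circ> (f \<otimes> Y) : Z \<otimes> (X \<otimes> Y) \<rightarrow> (X \<otimes> Y) \<otimes> Z\<close>.
\<close>

definition cross_right ::
    "('k, 'r) ring_scheme \<Rightarrow> ('k, 'u, 'x) module_scheme \<Rightarrow> ('k, 'v, 'y) module_scheme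
      \<Rightarrow> ('k, 'w, 'z) module_scheme
      \<Rightarrow> (('w, 'u) tensor \<Rightarrow> ('u, 'w) tensor) \<Rightarrow> (('w, 'v) tensor \<Rightarrow> ('v, 'w) tensor)
      \<Rightarrow> ('w, ('u, 'v) tensor) tensor \<Rightarrow> (('u, 'v) tensor, 'w) tensor"
  where "cross_right k X Y Z f g =
    assoc_inv k X Y Z \<circ> tensor_map k X (Y \<boxtimes>\<^bsub>k\<^esub> Z) id g \<circ> assoc k X Z Y \<circ>
    tensor_map k (X \<boxtimes>\<^bsub>k\<^esub> Z) Y f id \<circ> assoc_inv k Z X Y"

text \<open>
  For \<open>f : Y \<otimes> X \<rightarrow> X \<otimes> Y\<close> and \<open>g : Z \<otimes> X \<rightarrow> X \<otimes> Z\<close>, the map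
  \<open>(f \<otimes> Z) \<circ> (Y \<otimes> g) : (Y \<otimes> Z) \<otimes> X \<rightarrow> X \<otimes> (Y \<otimes> Z)\<close>.
\<close>

definition cross_left ::
    "('k, 'r) ring_scheme \<Rightarrow> ('k, 'u, 'x) module_scheme \<Rightarrow> ('k, 'v, 'y) module_scheme
      \<Rightarrow> ('k, 'w, 'z) module_scheme
      \<Rightarrow> (('v, 'u) tensor \<Rightarrow> ('u, 'v) tensor) \<Rightarrow> (('w, 'u) tensor \<Rightarrow> ('u, 'w) tensor)
      \<Rightarrow> (('v, 'w) tensor, 'u) tensor \<Rightarrow> ('u, ('v, 'w) tensor) tensor"
  where "cross_left k X Y Z f g =
    assoc k X Y Z \<circ> tensor_map k (X \<boxtimes>\<^bsub>k\<^esub> Y) Z f id \<circ> assoc_inv k Y X Z \<circ>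
    tensor_map k Y (X \<boxtimes>\<^bsub>k\<^esub> Z) id g \<circ> assoc k Y Z X"

text \<open>
  For \<open>f : Y \<otimes> V \<rightarrow> V \<otimes> Y\<close>, the map
  \<open>X \<otimes> f \<otimes> W : (X \<otimes> Y) \<otimes> (V \<otimes> W) \<rightarrow> (X \<otimes> V) \<otimes> (Y \<otimes> W)\<close>.
\<close>

definition cross_middle ::
    "('k, 'r) ring_scheme \<Rightarrow> ('k, 'u, 'x) module_scheme \<Rightarrow> ('k, 'v, 'y) module_scheme
      \<Rightarrow> ('k, 'w, 'z) module_scheme \<Rightarrow> ('k, 't, 's) module_scheme
      \<Rightarrow> (('v, 'w) tensor \<Rightarrow> ('w, 'v) tensor)
      \<Rightarrow> (('u, 'v) tensor, ('w, 't) tensor) tensor \<Rightarrow> (('u, 'w) tensor, ('v, 't) tensor) tensor"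
  where "cross_middle k X Y V W f =
    assoc_inv k X V (Y \<boxtimes>\<^bsub>k\<^esub> W) \<circ>
    tensor_map k X (V \<boxtimes>\<^bsub>k\<^esub> (Y \<boxtimes>\<^bsub>k\<^esub> W)) id
      (assoc k V Y W \<circ> tensor_map k (V \<boxtimes>\<^bsub>k\<^esub> Y) W f id \<circ> assoc_inv k Y V W) \<circ>
    assoc k X Y (V \<boxtimes>\<^bsub>k\<^esub> W)"

text \<open>
  For \<open>f : Y \<otimes> X \<rightarrow> X \<otimes> Y\<close>, \<open>g : Z \<otimes> Y \<rightarrow> Y \<otimes> Z\<close> and \<open>h : Z \<otimes> X \<rightarrow> X \<otimes> Z\<close>, the equation
  \<open>(X \<otimes> g) \<circ> (h \<otimes> Y) \<circ> (Z \<otimes> f) = (f \<otimes> Z) \<circ> (Y \<otimes> h) \<circ> (g \<otimes> X)\<close> of maps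
  \<open>Z \<otimes> (Y \<otimes> X) \<rightarrow> X \<otimes> (Y \<otimes> Z)\<close>.
\<close>

definition hexagon ::
    "('k, 'r) ring_scheme \<Rightarrow> ('k, 'u, 'x) module_scheme \<Rightarrow> ('k, 'v, 'y) module_scheme
      \<Rightarrow> ('k, 'w, 'z) module_scheme
      \<Rightarrow> (('v, 'u) tensor \<Rightarrow> ('u, 'v) tensor) \<Rightarrow> (('w, 'v) tensor \<Rightarrow> ('v, 'w) tensor)
      \<Rightarrow> (('w, 'u) tensor \<Rightarrow> ('u, 'w) tensor) \<Rightarrow> bool"
  where "hexagon k X Y Z f g h \<longleftrightarrow> (\<forall>t\<in>carrier (Z \<boxtimes>\<^bsub>k\<^esub> (Y \<boxtimes>\<^bsub>k\<^esub> X)).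
    (assoc k X Y Z \<circ> cross_right k X Y Z h g \<circ> tensor_map k Z (X \<boxtimes>\<^bsub>k\<^esub> Y) id f) t =
    (cross_left k X Y Z f h \<circ> tensor_map k (Y \<boxtimes>\<^bsub>k\<^esub> Z) X g id \<circ> assoc_inv k Z Y X) t)"


section \<open>Twisting maps and twisted tensor products\<close>

text \<open>The product of an algebra as a linear map \<open>A \<otimes> A \<rightarrow> A\<close>.\<close>

definition product_map :: "('k, 'a, 'x) module_scheme \<Rightarrow> ('a, 'a) tensor \<Rightarrow> 'a"
  where "product_map A = tensor_lift A (\<lambda>x y. x \<otimes>\<^bsub>A\<^esub> y)"

locale twisting_map = A: assoc_algebra k A + B: assoc_algebra k B
  for k :: "('k, 'r) ring_scheme" and A :: "('k, 'a, 'x) module_scheme"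
    and B :: "('k, 'b, 'y) module_scheme" and R :: "('b, 'a) tensor \<Rightarrow> ('a, 'b) tensor" +
  assumes linear: "linear_map k (B \<boxtimes>\<^bsub>k\<^esub> A) (A \<boxtimes>\<^bsub>k\<^esub> B) R"
    and twist_product_left: "\<And>t. t \<in> carrier (B \<boxtimes>\<^bsub>k\<^esub> (A \<boxtimes>\<^bsub>k\<^esub> A)) \<Longrightarrow>
      (R \<circ> tensor_map k B A id (product_map A)) t =
      (tensor_map k A B (product_map A) id \<circ> cross_right k A A B R R) t"
    and twist_product_right: "\<And>t. t \<in> carrier ((B \<boxtimes>\<^bsub>k\<^esub> B) \<boxtimes>\<^bsub>k\<^esub> A) \<Longrightarrow>
      (R \<circ> tensor_map k B A (product_map B) id) t =
      (tensor_map k A B id (product_map B) \<circ> cross_left k A B B R R) t"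

locale unital_twisting_map = twisting_map +
  assumes twist_one_left: "a \<in> carrier A \<Longrightarrow>
      R (pure_tensor k B A \<one>\<^bsub>B\<^esub> a) = pure_tensor k A B a \<one>\<^bsub>B\<^esub>"
    and twist_one_right: "b \<in> carrier B \<Longrightarrow>
      R (pure_tensor k B A b \<one>\<^bsub>A\<^esub>) = pure_tensor k A B \<one>\<^bsub>A\<^esub> b"

definition twisted_tensor ::
    "('k, 'r) ring_scheme \<Rightarrow> ('k, 'a, 'x) module_scheme \<Rightarrow> ('k, 'b, 'y) module_scheme
      \<Rightarrow> (('b, 'a) tensor \<Rightarrow> ('a, 'b) tensor) \<Rightarrow> ('k, ('a, 'b) tensor) module"
  where "twisted_tensor k A B R = (A \<boxtimes>\<^bsub>k\<^esub> B)
    \<lparr>monoid.mult := (\<lambda>s t. (tensor_map k A B (product_map A) (product_map B) \<circ> cross_middle k A B A B R)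
        (pure_tensor k (A \<boxtimes>\<^bsub>k\<^esub> B) (A \<boxtimes>\<^bsub>k\<^esub> B) s t)),
     monoid.one := pure_tensor k A B \<one>\<^bsub>A\<^esub> \<one>\<^bsub>B\<^esub>\<rparr>"


section \<open>Modules over algebras and module twisting maps\<close>

text \<open>
  An action is a linear map \<open>\<lambda>\<^sub>M : A \<otimes> M \<rightarrow> M\<close>. The locale \<open>left_action\<close> asks for associativity
  only, the locale \<open>left_module\<close> also for unitality.
\<close>

locale left_action = A: assoc_algebra k A + M: module k M
  for k :: "('k, 'r) ring_scheme" and A :: "('k, 'a, 'x) module_scheme"
    and M :: "('k, 'm, 'y) module_scheme" and act :: "('a, 'm) tensor \<Rightarrow> 'm" +
  assumes action_linear: "linear_map k (A \<boxtimes>\<^bsub>k\<^esub> M) M act"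
    and action_assoc: "\<lbrakk>a \<in> carrier A; a' \<in> carrier A; x \<in> carrier M\<rbrakk> \<Longrightarrow>
      act (pure_tensor k A M (a \<otimes>\<^bsub>A\<^esub> a') x) =
      act (pure_tensor k A M a (act (pure_tensor k A M a' x)))"

locale left_module = left_action +
  assumes action_one: "x \<in> carrier M \<Longrightarrow> act (pure_tensor k A M \<one>\<^bsub>A\<^esub> x) = x"

locale module_twisting_map =
  twisting_map k A B R + left_action k A M act
  for k :: "('k, 'r) ring_scheme" and A :: "('k, 'a, 'x) module_scheme"
    and B :: "('k, 'b, 'y) module_scheme" and R :: "('b, 'a) tensor \<Rightarrow> ('a, 'b) tensor"
    and M :: "('k, 'm, 'z) module_scheme" and act :: "('a, 'm) tensor \<Rightarrow> 'm"
    and \<tau> :: "('b, 'm) tensor \<Rightarrow> ('m, 'b) tensor" +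
  assumes module_twist_linear: "linear_map k (B \<boxtimes>\<^bsub>k\<^esub> M) (M \<boxtimes>\<^bsub>k\<^esub> B) \<tau>"
    and module_twist_product: "\<And>t. t \<in> carrier ((B \<boxtimes>\<^bsub>k\<^esub> B) \<boxtimes>\<^bsub>k\<^esub> M) \<Longrightarrow>
      (\<tau> \<circ> tensor_map k B M (product_map B) id) t =
      (tensor_map k M B id (product_map B) \<circ> cross_left k M B B \<tau> \<tau>) t"
    and module_twist_action: "\<And>t. t \<in> carrier (B \<boxtimes>\<^bsub>k\<^esub> (A \<boxtimes>\<^bsub>k\<^esub> M)) \<Longrightarrow>
      (\<tau> \<circ> tensor_map k B M id act) t =
      (tensor_map k M B act id \<circ> cross_right k A M B R \<tau>) t"

text \<open>The map \<open>(\<lambda>\<^sub>M \<otimes> \<lambda>\<^sub>N) \<circ> (A \<otimes> \<tau> \<otimes> N) : (A \<otimes> B) \<otimes> (M \<otimes> N) \<rightarrow> M \<otimes> N\<close>.\<close>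

definition induced_action ::
    "('k, 'r) ring_scheme \<Rightarrow> ('k, 'a, 'x) module_scheme \<Rightarrow> ('k, 'b, 'y) module_scheme
      \<Rightarrow> ('k, 'm, 'z) module_scheme \<Rightarrow> ('k, 'n, 'w) module_scheme
      \<Rightarrow> (('b, 'm) tensor \<Rightarrow> ('m, 'b) tensor)
      \<Rightarrow> (('a, 'm) tensor \<Rightarrow> 'm) \<Rightarrow> (('b, 'n) tensor \<Rightarrow> 'n)
      \<Rightarrow> (('a, 'b) tensor, ('m, 'n) tensor) tensor \<Rightarrow> ('m, 'n) tensor"
  where "induced_action k A B M N \<tau> actM actN =
    tensor_map k M N actM actN \<circ> cross_middle k A B M N \<tau>"

end

theory Submission
  imports Defs
begin

text \<open>
  In Sweedler notation \<open>\<tau> (b \<otimes> m) = \<Sum> m\<^sub>\<tau> \<otimes> b\<^sub>\<tau>\<close> every identity needed is a rewriting of iterated sums: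
  the compatibility of a twisting map with products and actions, the hexagon equation, and the
  interchange of two independent sums suffice. A sum \<open>\<Sum> \<phi> x\<^sub>i y\<^sub>i\<close> over a representation
  \<open>t = \<Sum> x\<^sub>i \<otimes> y\<^sub>i\<close> is \<open>tensor_lift P \<phi> t\<close>, which is independent of the representation for bilinear
  \<open>\<phi>\<close>, so Sweedler calculations become calculations with nested \<open>tensor_lift\<close>s. A twisting map
  \<open>R : B \<otimes> A \<rightarrow> A \<otimes> B\<close> is itself a module twisting map for the regular module \<open>M = A\<close>, and the
  product of \<open>A \<otimes>\<^sub>R B\<close> is the induced action on \<open>A \<otimes> B\<close>; hence associativity of \<open>A \<otimes>\<^sub>R B\<close> and the
  twisting conditions for \<open>T\<^sub>1\<close> and \<open>T\<^sub>2\<close> are the cases \<open>M = A\<close>, \<open>N = B\<close> of the statements on modules.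
\<close>


section \<open>The tensor product as a module\<close>

text \<open>Tensors are cosets, so rebracketing is never an equality:
  \<open>(X \<boxtimes> Y) \<boxtimes> Z\<close> and \<open>X \<boxtimes> (Y \<boxtimes> Z)\<close>
  even have different types, and every exchange composite carries \<open>assoc\<close> and
  \<open>assoc_inv\<close>. These are eliminated once, by evaluating each composite on pure tensors;
  since linear maps are determined there, only nested sums remain. The equality of the two
  structures on \<open>M \<otimes> N \<otimes> P\<close> is therefore an equality along the
  associativity isomorphisms.

  Four conditions are to be checked. Two of them, \<open>\<sigma>\<^sub>C\<close> against the
  product of \<open>C\<close> and \<open>\<sigma>\<^sub>B\<^sub>C\<close> against the action of
  \<open>A\<close>, involve factors that pass others one after another, and an interchange of
  independent sums settles them. In the other two, a pair of factors is exchanged either before or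
  after a third one passes; the hexagon identifies these two orders. The unit conditions on the
  twisting maps make the twisted products unital algebras, so that they can serve as the acting
  algebras at the next level.\<close>

lemma (in abelian_group) frag_sum_superset:
  fixes u :: "'c \<Rightarrow>\<^sub>0 int"
  assumes "f \<in> S \<rightarrow> carrier G" "finite T" "Poly_Mapping.keys u \<subseteq> T" "T \<subseteq> S"
  shows "(\<Oplus>z\<in>Poly_Mapping.keys u. [Poly_Mapping.lookup u z] \<cdot> f z)
    = (\<Oplus>z\<in>T. [Poly_Mapping.lookup u z] \<cdot> f z)"
proof (rule add.finprod_mono_neutral_cong_left)
  show "[Poly_Mapping.lookup u i] \<cdot> f i = \<zero>" if "i \<in> T - Poly_Mapping.keys u" for i
    using that by (simp add: in_keys_iff add_pow_def)
qed (use assms in \<open>auto intro!: add.int_pow_closed\<close>)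

text \<open>The universal property of the free abelian group, for the very sum that occurs in
  \<open>tensor_lift\<close>.\<close>

lemma (in abelian_group) frag_sum_hom:
  assumes f: "f \<in> S \<rightarrow> carrier G"
  shows "(\<lambda>u. \<Oplus>z\<in>Poly_Mapping.keys u. [Poly_Mapping.lookup u z] \<cdot> f z)
    \<in> hom (free_Abelian_group S) (add_monoid G)"
proof (rule homI, goal_cases)
  case (1 u)
  then show ?case using f by (auto intro!: add.finprod_closed add.int_pow_closed)
next
  case (2 u v)
  \<comment> \<open>Cancellation can make the support of \<open>u + v\<close> smaller than the union
    of the supports. All three sums are therefore compared over this union, where the additional
    terms have coefficient zero.\<close>
  let ?T = "Poly_Mapping.keys u \<union> Poly_Mapping.keys v"
  have T: "finite ?T" "?T \<subseteq> S" and uv: "Poly_Mapping.keys (u + v) \<subseteq> ?T"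
    using 2 keys_add[of u v] by auto
  have "(\<Oplus>z\<in>?T. [Poly_Mapping.lookup (u + v) z] \<cdot> f z)
    = (\<Oplus>z\<in>?T. [Poly_Mapping.lookup u z] \<cdot> f z \<oplus> [Poly_Mapping.lookup v z] \<cdot> f z)"
  proof (rule add.finprod_cong')
    show "[Poly_Mapping.lookup (u + v) i] \<cdot> f i
        = [Poly_Mapping.lookup u i] \<cdot> f i \<oplus> [Poly_Mapping.lookup v i] \<cdot> f i" if "i \<in> ?T" for i
    proof -
      have "f i \<in> carrier G" using that T(2) f by blast
      then show ?thesis by (simp add: Poly_Mapping.lookup_add add.int_pow_mult)
    qed
  qed (use f T(2) in \<open>auto intro!: add.int_pow_closed\<close>)
  also have "\<dots> = (\<Oplus>z\<in>?T. [Poly_Mapping.lookup u z] \<cdot> f z) \<oplus> (\<Oplus>z\<in>?T. [Poly_Mapping.lookup v z] \<cdot> f z)"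
    using f T(2) by (intro add.finprod_multf) (auto intro!: add.int_pow_closed)
  finally show ?case
    using frag_sum_superset[OF f T(1) _ T(2), of u] frag_sum_superset[OF f T(1) _ T(2), of v]
      frag_sum_superset[OF f T(1) uv T(2)] by simp
qed

lemma (in abelian_group) frag_sum_of:
  "f z \<in> carrier G \<Longrightarrow>
    (\<Oplus>x\<in>Poly_Mapping.keys (frag_of z). [Poly_Mapping.lookup (frag_of z) x] \<cdot> f x) = f z"
  by (simp add: add.int_pow_1)

section \<open>Relations, scalars and cosets in the free abelian group on pairs\<close>

locale module_pair = M: module k M + N: module k N
  for k :: "('k, 'r) ring_scheme" (structure) and M :: "('k, 'm, 'x) module_scheme"
    and N :: "('k, 'n, 'y) module_scheme"
begin

abbreviation "F \<equiv> free_Abelian_group (carrier M \<times> carrier N)"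
abbreviation "H \<equiv> generate F (tensor_relations k M N)"
abbreviation "cls u \<equiv> H #>\<^bsub>F\<^esub> u"
text \<open>Scalars act through the left factor. On cosets the balancing relation makes this the
  same as acting through the right one.\<close>

abbreviation "scale c \<equiv> frag_extend (\<lambda>(x, y). frag_of (c \<odot>\<^bsub>M\<^esub> x, y))"

lemma tensor_relations_closed: "tensor_relations k M N \<subseteq> carrier F"
  unfolding tensor_relations_def by (auto dest!: subsetD[OF keys_diff])

sublocale F: comm_group F
  by (rule abelian_free_Abelian_group)

lemma subgroup_H: "subgroup H F"
  by (rule F.generate_is_subgroup[OF tensor_relations_closed])

sublocale H: normal H F
  using subgroup_H by (simp add: F.normal_iff_subgroup)

lemma cls_eq_iff:
  assumes "u \<in> carrier F" "v \<in> carrier F"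
  shows "cls u = cls v \<longleftrightarrow> u - v \<in> H"
proof -
  have "cls u = cls v \<longleftrightarrow> u \<in> cls v"
    using F.repr_independence[OF _ assms(2) subgroup_H] F.rcos_self[OF assms(1) subgroup_H] by blast
  also have "\<dots> \<longleftrightarrow> u \<otimes>\<^bsub>F\<^esub> inv\<^bsub>F\<^esub> v \<in> H"
    using H.rcos_module[OF F.group_axioms assms(2,1)] .
  finally show ?thesis using assms(2) by simp
qed

lemma mem_cls_iff: "\<lbrakk>u \<in> carrier F; v \<in> carrier F\<rbrakk> \<Longrightarrow> v \<in> cls u \<longleftrightarrow> v - u \<in> H"
  using H.rcos_module[OF F.group_axioms, of u v] by simp

lemma cls_subset: "u \<in> carrier F \<Longrightarrow> cls u \<subseteq> carrier F"
  by (rule F.r_coset_subset_G[OF H.subset])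

lemma H_closed_diff: "\<lbrakk>u \<in> H; v \<in> H\<rbrakk> \<Longrightarrow> u - v \<in> H"
proof -
  assume u: "u \<in> H" and v: "v \<in> H"
  have "inv\<^bsub>F\<^esub> v = - v" using H.mem_carrier[OF v] by simp
  then show ?thesis using H.m_closed[OF u H.m_inv_closed[OF v]] by simp
qed

lemma scale_closed: "\<lbrakk>c \<in> carrier k; u \<in> carrier F\<rbrakk> \<Longrightarrow> scale c u \<in> carrier F"
  using keys_frag_extend[of "\<lambda>(x, y). frag_of (c \<odot>\<^bsub>M\<^esub> x, y)" u]
  by (fastforce split: prod.splits)

text \<open>Scaling sends each generating relation to one of the same kind. For the balancing
  relation the scalars \<open>c\<close> and \<open>d\<close> have to trade places, which is where
  commutativity of \<open>k\<close> enters.\<close>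

lemma scale_relation:
  assumes c: "c \<in> carrier k" and u: "u \<in> tensor_relations k M N"
  shows "scale c u \<in> tensor_relations k M N"
proof -
  consider (left) x x' y where "u = frag_of (x \<oplus>\<^bsub>M\<^esub> x', y) - frag_of (x, y) - frag_of (x', y)"
      "x \<in> carrier M" "x' \<in> carrier M" "y \<in> carrier N"
    | (right) x y y' where "u = frag_of (x, y \<oplus>\<^bsub>N\<^esub> y') - frag_of (x, y) - frag_of (x, y')"
      "x \<in> carrier M" "y \<in> carrier N" "y' \<in> carrier N"
    | (smult) d x y where "u = frag_of (d \<odot>\<^bsub>M\<^esub> x, y) - frag_of (x, d \<odot>\<^bsub>N\<^esub> y)"
      "d \<in> carrier k" "x \<in> carrier M" "y \<in> carrier N"
    using u unfolding tensor_relations_def by blast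
  then show ?thesis
  proof cases
    case left
    then have "scale c u = frag_of (c \<odot>\<^bsub>M\<^esub> x \<oplus>\<^bsub>M\<^esub> c \<odot>\<^bsub>M\<^esub> x', y) - frag_of (c \<odot>\<^bsub>M\<^esub> x, y) - frag_of (c \<odot>\<^bsub>M\<^esub> x', y)"
      using c by (simp add: frag_extend_diff M.smult_r_distr)
    then show ?thesis
      unfolding tensor_relations_def using c left(2-4) by blast
  next
    case right
    then have "scale c u = frag_of (c \<odot>\<^bsub>M\<^esub> x, y \<oplus>\<^bsub>N\<^esub> y') - frag_of (c \<odot>\<^bsub>M\<^esub> x, y) - frag_of (c \<odot>\<^bsub>M\<^esub> x, y')"
      by (simp add: frag_extend_diff)
    then show ?thesis
      unfolding tensor_relations_def using c right(2-4) by blast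
  next
    case smult
    then have "scale c u = frag_of (d \<odot>\<^bsub>M\<^esub> (c \<odot>\<^bsub>M\<^esub> x), y) - frag_of (c \<odot>\<^bsub>M\<^esub> x, d \<odot>\<^bsub>N\<^esub> y)"
      using c by (simp add: frag_extend_diff M.smult_assoc1[symmetric] M.R.m_comm)
    then show ?thesis
      unfolding tensor_relations_def using c smult(2-4) by blast
  qed
qed

text \<open>This is what makes scalar multiplication well defined on cosets. It propagates from the
  generating relations because \<open>scale c\<close> is additive.\<close>

lemma scale_H:
  assumes c: "c \<in> carrier k" and "u \<in> H"
  shows "scale c u \<in> H"
  using assms(2)
proof (induction u rule: generate.induct)
  case (incl h)
  then show ?case using scale_relation[OF c] by (blast intro: generate.incl)
next
  case (inv h)
  then have "Poly_Mapping.keys h \<subseteq> carrier M \<times> carrier N"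
    using subsetD[OF tensor_relations_closed inv] by simp
  moreover have "- scale c h \<in> H"
    using generate.incl[OF scale_relation[OF c inv], of F] H_closed_diff[of 0 "scale c h"]
      generate.one[of F] by auto
  ultimately show ?case by (simp add: frag_extend_minus)
next
  case (eng h h')
  then show ?case using generate.eng[of "scale c h" F _ "scale c h'"] by (simp add: frag_extend_add)
qed (use generate.one[of F] in simp)

section \<open>The module operations on cosets and their axioms\<close>

lemma tensor_carrier: "carrier (M \<boxtimes> N) = cls ` carrier F"
  by (simp add: tensor_def Let_def carrier_FactGroup)

lemma tensor_cls_closed: "u \<in> carrier F \<Longrightarrow> cls u \<in> carrier (M \<boxtimes> N)"
  unfolding tensor_carrier by blast

lemma tensor_zero: "\<zero>\<^bsub>M \<boxtimes> N\<^esub> = cls 0"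
  using F.coset_mult_one[OF H.subset] by (simp add: tensor_def Let_def)

lemma tensor_add:
  "\<lbrakk>u \<in> carrier F; v \<in> carrier F\<rbrakk> \<Longrightarrow> cls u \<oplus>\<^bsub>M \<boxtimes> N\<^esub> cls v = cls (u + v)"
  using H.rcos_sum[of u v] by (simp add: tensor_def Let_def)

text \<open>The scalar multiple is defined as a union over all representatives. By
  \<open>scale_H\<close> they all contribute the same coset, so the union collapses.\<close>

lemma tensor_smult:
  assumes c: "c \<in> carrier k" and u: "u \<in> carrier F"
  shows "c \<odot>\<^bsub>M \<boxtimes> N\<^esub> cls u = cls (scale c u)"
proof -
  have eq: "cls (scale c v) = cls (scale c u)" if v: "v \<in> cls u" for v
  proof -
    have vF: "v \<in> carrier F" using v cls_subset[OF u] by blast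
    have "v - u \<in> H" using mem_cls_iff[OF u vF] v by simp
    then have "scale c v - scale c u \<in> H"
      using scale_H[OF c, of "v - u"] by (simp add: frag_extend_diff)
    then show ?thesis using cls_eq_iff scale_closed[OF c] u vF by blast
  qed
  have "u \<in> cls u" using F.rcos_self[OF u subgroup_H] .
  then have "(\<Union>v\<in>cls u. cls (scale c v)) = cls (scale c u)"
    using eq by blast
  then show ?thesis by (simp add: tensor_def Let_def)
qed

lemma pure_tensor_cls: "pure_tensor k M N x y = cls (frag_of (x, y))"
  by (simp add: pure_tensor_def Let_def)

lemma abelian_group_tensor: "abelian_group (M \<boxtimes> N)"
proof (rule abelian_groupI)
  show "\<And>s t. s \<in> carrier (M \<boxtimes> N) \<Longrightarrow> t \<in> carrier (M \<boxtimes> N)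
    \<Longrightarrow> s \<oplus>\<^bsub>M \<boxtimes> N\<^esub> t \<in> carrier (M \<boxtimes> N)"
    unfolding tensor_carrier using tensor_add F.m_closed by (auto simp del: carrier_free_Abelian_group_iff)
  show "\<zero>\<^bsub>M \<boxtimes> N\<^esub> \<in> carrier (M \<boxtimes> N)"
    unfolding tensor_zero by (rule tensor_cls_closed) simp
next
  fix s t u assume "s \<in> carrier (M \<boxtimes> N)" "t \<in> carrier (M \<boxtimes> N)" "u \<in> carrier (M \<boxtimes> N)"
  then obtain s' t' u' where *: "s = cls s'" "t = cls t'" "u = cls u'"
    "s' \<in> carrier F" "t' \<in> carrier F" "u' \<in> carrier F"
    unfolding tensor_carrier by blast
  then show "(s \<oplus>\<^bsub>M \<boxtimes> N\<^esub> t) \<oplus>\<^bsub>M \<boxtimes> N\<^esub> u = s \<oplus>\<^bsub>M \<boxtimes> N\<^esub> (t \<oplus>\<^bsub>M \<boxtimes> N\<^esub> u)"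
    using F.m_closed[of s' t'] F.m_closed[of t' u'] tensor_add by (simp add: add.assoc del: carrier_free_Abelian_group_iff)
next
  fix s t assume "s \<in> carrier (M \<boxtimes> N)" "t \<in> carrier (M \<boxtimes> N)"
  then show "s \<oplus>\<^bsub>M \<boxtimes> N\<^esub> t = t \<oplus>\<^bsub>M \<boxtimes> N\<^esub> s"
    unfolding tensor_carrier using tensor_add by (auto simp: add.commute simp del: carrier_free_Abelian_group_iff)
next
  fix s assume "s \<in> carrier (M \<boxtimes> N)"
  then obtain s' where s: "s = cls s'" "s' \<in> carrier F" unfolding tensor_carrier by blast
  show "\<zero>\<^bsub>M \<boxtimes> N\<^esub> \<oplus>\<^bsub>M \<boxtimes> N\<^esub> s = s"
    unfolding tensor_zero s(1) using s(2) by (subst tensor_add) auto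
  show "\<exists>t\<in>carrier (M \<boxtimes> N). t \<oplus>\<^bsub>M \<boxtimes> N\<^esub> s = \<zero>\<^bsub>M \<boxtimes> N\<^esub>"
    unfolding tensor_zero s(1) using s(2)
    by (intro bexI[of _ "cls (- s')"] tensor_cls_closed) (auto simp: tensor_add keys_minus)
qed

lemma tensor_smult_closed:
  "\<lbrakk>c \<in> carrier k; s \<in> carrier (M \<boxtimes> N)\<rbrakk> \<Longrightarrow> c \<odot>\<^bsub>M \<boxtimes> N\<^esub> s \<in> carrier (M \<boxtimes> N)"
  unfolding tensor_carrier using tensor_smult scale_closed by (auto simp del: carrier_free_Abelian_group_iff)

lemma tensor_smult_add:
  assumes "c \<in> carrier k" "s \<in> carrier (M \<boxtimes> N)" "t \<in> carrier (M \<boxtimes> N)"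
  shows "c \<odot>\<^bsub>M \<boxtimes> N\<^esub> (s \<oplus>\<^bsub>M \<boxtimes> N\<^esub> t)
    = c \<odot>\<^bsub>M \<boxtimes> N\<^esub> s \<oplus>\<^bsub>M \<boxtimes> N\<^esub> c \<odot>\<^bsub>M \<boxtimes> N\<^esub> t"
proof -
  obtain s' t' where *: "s = cls s'" "t = cls t'" "s' \<in> carrier F" "t' \<in> carrier F"
    using assms(2,3) unfolding tensor_carrier by blast
  then show ?thesis
    using assms(1) F.m_closed[of s' t'] scale_closed
    by (simp add: tensor_add tensor_smult frag_extend_add del: carrier_free_Abelian_group_iff)
qed

lemma pure_closed:
  "\<lbrakk>x \<in> carrier M; y \<in> carrier N\<rbrakk> \<Longrightarrow> pure_tensor k M N x y \<in> carrier (M \<boxtimes> N)"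
  unfolding pure_tensor_cls by (rule tensor_cls_closed) simp

text \<open>Pure tensors generate the tensor product as a group. Only additivity is asked of
  \<open>f\<close> and \<open>g\<close>, because this lemma is used to prove the module axioms of
  \<open>M \<boxtimes> N\<close>, at a stage where linearity is not yet available.\<close>

lemma tensor_additive_cong:
  assumes P: "abelian_group P"
    and f: "f \<in> carrier (M \<boxtimes> N) \<rightarrow> carrier P" and g: "g \<in> carrier (M \<boxtimes> N) \<rightarrow> carrier P"
    and fadd: "\<And>s t. \<lbrakk>s \<in> carrier (M \<boxtimes> N); t \<in> carrier (M \<boxtimes> N)\<rbrakk>
      \<Longrightarrow> f (s \<oplus>\<^bsub>M \<boxtimes> N\<^esub> t) = f s \<oplus>\<^bsub>P\<^esub> f t"
    and gadd: "\<And>s t. \<lbrakk>s \<in> carrier (M \<boxtimes> N); t \<in> carrier (M \<boxtimes> N)\<rbrakk>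
      \<Longrightarrow> g (s \<oplus>\<^bsub>M \<boxtimes> N\<^esub> t) = g s \<oplus>\<^bsub>P\<^esub> g t"
    and eq: "\<And>x y. \<lbrakk>x \<in> carrier M; y \<in> carrier N\<rbrakk>
      \<Longrightarrow> f (pure_tensor k M N x y) = g (pure_tensor k M N x y)"
    and t: "t \<in> carrier (M \<boxtimes> N)"
  shows "f t = g t"
proof -
  interpret P: abelian_group P by (rule P)
  interpret T: abelian_group "M \<boxtimes> N" by (rule abelian_group_tensor)
  obtain u where u: "t = cls u" "u \<in> carrier F" using t unfolding tensor_carrier by blast
  \<comment> \<open>The induction on the free group builds elements as differences
    \<open>u - v\<close>. Since \<open>(u - v) + v = u\<close>, agreement at a sum and at one
    summand must give agreement at the other.\<close>
  have cancel: "f (s \<oplus>\<^bsub>M \<boxtimes> N\<^esub> t) = g (s \<oplus>\<^bsub>M \<boxtimes> N\<^esub> t) \<Longrightarrow> f t = g t \<Longrightarrow> f s = g s"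
    if "s \<in> carrier (M \<boxtimes> N)" "t \<in> carrier (M \<boxtimes> N)" for s t
  proof -
    assume eqs: "f (s \<oplus>\<^bsub>M \<boxtimes> N\<^esub> t) = g (s \<oplus>\<^bsub>M \<boxtimes> N\<^esub> t)" "f t = g t"
    have "f s \<in> carrier P" "g s \<in> carrier P" "g t \<in> carrier P"
      using that f g by auto
    then show ?thesis using eqs fadd[OF that] gadd[OF that] by simp
  qed
  \<comment> \<open>The neutral coset is idempotent, so both of its images are idempotents of a
    group and hence zero.\<close>
  have zero: "f (cls 0) = g (cls 0)"
  proof -
    have z: "cls 0 \<in> carrier (M \<boxtimes> N)" "cls 0 \<oplus>\<^bsub>M \<boxtimes> N\<^esub> cls 0 = cls 0"
      using T.zero_closed unfolding tensor_zero[symmetric] by simp_all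
    then have "f (cls 0) = \<zero>\<^bsub>P\<^esub>" "g (cls 0) = \<zero>\<^bsub>P\<^esub>"
      using fadd[of "cls 0" "cls 0"] gadd[of "cls 0" "cls 0"] f g
      by (auto simp: Pi_iff P.add.l_cancel_one' P.add.r_cancel_one')
    then show ?thesis by simp
  qed
  have "f (cls u) = g (cls u)" if "Poly_Mapping.keys u \<subseteq> carrier M \<times> carrier N" for u
    using that
  proof (induction u rule: free_Abelian_group_induct[consumes 1])
    case (2 u v)
    have uv: "u - v \<in> carrier F" using 2(1,2) keys_diff[of u v] by auto
    show ?case
      by (rule cancel[of _ "cls v"]) (use 2 uv tensor_cls_closed tensor_add[of "u - v" v] in auto)
  next
    case (3 z)
    then show ?case using eq unfolding pure_tensor_cls by auto
  qed (rule zero)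
  then show ?thesis using u by simp
qed


lemma pure_cls_relation:
  "\<lbrakk>u \<in> carrier F; v \<in> carrier F; u - v \<in> tensor_relations k M N\<rbrakk> \<Longrightarrow> cls u = cls v"
  using cls_eq_iff generate.incl by metis

lemma pure_add_left:
  assumes "x \<in> carrier M" "x' \<in> carrier M" "y \<in> carrier N"
  shows "pure_tensor k M N (x \<oplus>\<^bsub>M\<^esub> x') y
    = pure_tensor k M N x y \<oplus>\<^bsub>M \<boxtimes> N\<^esub> pure_tensor k M N x' y"
proof -
  have "cls (frag_of (x \<oplus>\<^bsub>M\<^esub> x', y)) = cls (frag_of (x, y) + frag_of (x', y))"
    by (rule pure_cls_relation)
      (use assms in \<open>auto simp: tensor_relations_def diff_diff_eq[symmetric] dest!: subsetD[OF keys_add]\<close>)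
  then show ?thesis
    unfolding pure_tensor_cls using assms by (simp add: tensor_add)
qed

lemma pure_add_right:
  assumes "x \<in> carrier M" "y \<in> carrier N" "y' \<in> carrier N"
  shows "pure_tensor k M N x (y \<oplus>\<^bsub>N\<^esub> y')
    = pure_tensor k M N x y \<oplus>\<^bsub>M \<boxtimes> N\<^esub> pure_tensor k M N x y'"
proof -
  have "cls (frag_of (x, y \<oplus>\<^bsub>N\<^esub> y')) = cls (frag_of (x, y) + frag_of (x, y'))"
    by (rule pure_cls_relation)
      (use assms in \<open>auto simp: tensor_relations_def diff_diff_eq[symmetric] dest!: subsetD[OF keys_add]\<close>)
  then show ?thesis
    unfolding pure_tensor_cls using assms by (simp add: tensor_add)
qed

lemma pure_smult_left:
  assumes "c \<in> carrier k" "x \<in> carrier M" "y \<in> carrier N"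
  shows "pure_tensor k M N (c \<odot>\<^bsub>M\<^esub> x) y = c \<odot>\<^bsub>M \<boxtimes> N\<^esub> pure_tensor k M N x y"
  unfolding pure_tensor_cls using assms by (simp add: tensor_smult)

lemma pure_smult_right:
  assumes "c \<in> carrier k" "x \<in> carrier M" "y \<in> carrier N"
  shows "pure_tensor k M N x (c \<odot>\<^bsub>N\<^esub> y) = c \<odot>\<^bsub>M \<boxtimes> N\<^esub> pure_tensor k M N x y"
proof -
  have "cls (frag_of (c \<odot>\<^bsub>M\<^esub> x, y)) = cls (frag_of (x, c \<odot>\<^bsub>N\<^esub> y))"
    by (rule pure_cls_relation) (use assms in \<open>auto simp: tensor_relations_def\<close>)
  then show ?thesis
    using pure_smult_left[OF assms] unfolding pure_tensor_cls by simp
qed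

text \<open>The axioms not yet available compare two additive functions of \<open>t\<close>; it is
  enough to look at pure tensors, where the scalars move into \<open>M\<close>.\<close>

lemma module_tensor: "module k (M \<boxtimes> N)"
proof -
  interpret T: abelian_group "M \<boxtimes> N" by (rule abelian_group_tensor)
  show ?thesis
  proof (rule moduleI)
    fix c d t assume cd: "c \<in> carrier k" "d \<in> carrier k" and t: "t \<in> carrier (M \<boxtimes> N)"
    show "(c \<oplus> d) \<odot>\<^bsub>M \<boxtimes> N\<^esub> t
      = c \<odot>\<^bsub>M \<boxtimes> N\<^esub> t \<oplus>\<^bsub>M \<boxtimes> N\<^esub> d \<odot>\<^bsub>M \<boxtimes> N\<^esub> t"
    proof (rule tensor_additive_cong[OF abelian_group_tensor _ _ _ _ _ t])
      fix x y assume "x \<in> carrier M" "y \<in> carrier N"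
      then show "(c \<oplus> d) \<odot>\<^bsub>M \<boxtimes> N\<^esub> pure_tensor k M N x y
        = c \<odot>\<^bsub>M \<boxtimes> N\<^esub> pure_tensor k M N x y \<oplus>\<^bsub>M \<boxtimes> N\<^esub> d \<odot>\<^bsub>M \<boxtimes> N\<^esub> pure_tensor k M N x y"
        using cd by (simp add: pure_smult_left[symmetric] M.smult_l_distr pure_add_left)
    qed (use cd in \<open>auto simp: tensor_smult_closed tensor_smult_add T.add.m_ac\<close>)
    show "(c \<otimes> d) \<odot>\<^bsub>M \<boxtimes> N\<^esub> t = c \<odot>\<^bsub>M \<boxtimes> N\<^esub> (d \<odot>\<^bsub>M \<boxtimes> N\<^esub> t)"
    proof (rule tensor_additive_cong[OF abelian_group_tensor _ _ _ _ _ t])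
      fix x y assume "x \<in> carrier M" "y \<in> carrier N"
      then show "(c \<otimes> d) \<odot>\<^bsub>M \<boxtimes> N\<^esub> pure_tensor k M N x y
        = c \<odot>\<^bsub>M \<boxtimes> N\<^esub> (d \<odot>\<^bsub>M \<boxtimes> N\<^esub> pure_tensor k M N x y)"
        using cd by (simp add: pure_smult_left[symmetric] M.smult_assoc1)
    qed (use cd in \<open>auto simp: tensor_smult_closed tensor_smult_add\<close>)
  next
    fix t assume t: "t \<in> carrier (M \<boxtimes> N)"
    show "\<one> \<odot>\<^bsub>M \<boxtimes> N\<^esub> t = t"
    proof (rule tensor_additive_cong[OF abelian_group_tensor _ _ _ _ _ t])
      fix x y assume "x \<in> carrier M" "y \<in> carrier N"
      then show "\<one> \<odot>\<^bsub>M \<boxtimes> N\<^esub> pure_tensor k M N x y = pure_tensor k M N x y"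
        by (simp add: pure_smult_left[symmetric])
    qed (auto simp: tensor_smult_closed tensor_smult_add)
  qed (simp_all add: M.is_cring abelian_group_tensor tensor_smult_closed tensor_smult_add)
qed

end

lemma module_tensor: "\<lbrakk>module k M; module k N\<rbrakk> \<Longrightarrow> module k (M \<boxtimes>\<^bsub>k\<^esub> N)"
  by (intro module_pair.module_tensor module_pair.intro)

lemma pure_tensor_closed:
  "\<lbrakk>x \<in> carrier M; y \<in> carrier N; module k M; module k N\<rbrakk>
    \<Longrightarrow> pure_tensor k M N x y \<in> carrier (M \<boxtimes>\<^bsub>k\<^esub> N)"
  by (intro module_pair.pure_closed module_pair.intro)


section \<open>Linear and bilinear maps\<close>

lemma linear_mapI:
  assumes "\<And>x. x \<in> carrier M \<Longrightarrow> f x \<in> carrier N"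
    and "\<And>x y. \<lbrakk>x \<in> carrier M; y \<in> carrier M\<rbrakk> \<Longrightarrow> f (x \<oplus>\<^bsub>M\<^esub> y) = f x \<oplus>\<^bsub>N\<^esub> f y"
    and "\<And>c x. \<lbrakk>c \<in> carrier k; x \<in> carrier M\<rbrakk> \<Longrightarrow> f (c \<odot>\<^bsub>M\<^esub> x) = c \<odot>\<^bsub>N\<^esub> f x"
  shows "linear_map k M N f"
  using assms unfolding linear_map_def by blast

lemma linear_map_closed: "\<lbrakk>linear_map k M N f; x \<in> carrier M\<rbrakk> \<Longrightarrow> f x \<in> carrier N"
  unfolding linear_map_def by blast

lemma linear_map_add:
  "\<lbrakk>linear_map k M N f; x \<in> carrier M; y \<in> carrier M\<rbrakk> \<Longrightarrow> f (x \<oplus>\<^bsub>M\<^esub> y) = f x \<oplus>\<^bsub>N\<^esub> f y"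
  unfolding linear_map_def by blast

lemma linear_map_smult:
  "\<lbrakk>linear_map k M N f; c \<in> carrier k; x \<in> carrier M\<rbrakk> \<Longrightarrow> f (c \<odot>\<^bsub>M\<^esub> x) = c \<odot>\<^bsub>N\<^esub> f x"
  unfolding linear_map_def by blast

lemma linear_map_id: "linear_map k M M (\<lambda>x. x)"
  by (simp add: linear_map_def)

lemma linear_map_compose:
  "\<lbrakk>linear_map k N P g; linear_map k M N f\<rbrakk> \<Longrightarrow> linear_map k M P (\<lambda>x. g (f x))"
  unfolding linear_map_def by (simp add: Pi_iff)

lemmas linear_map_rules = linear_map_compose linear_map_closed

definition bilinear_map where
  "bilinear_map k M N P \<phi> \<longleftrightarrow>
    (\<forall>x\<in>carrier M. linear_map k N P (\<phi> x)) \<and> (\<forall>y\<in>carrier N. linear_map k M P (\<lambda>x. \<phi> x y))"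

lemma bilinear_mapI:
  assumes "\<And>x. x \<in> carrier M \<Longrightarrow> linear_map k N P (\<phi> x)"
    and "\<And>y. y \<in> carrier N \<Longrightarrow> linear_map k M P (\<lambda>x. \<phi> x y)"
  shows "bilinear_map k M N P \<phi>"
  using assms unfolding bilinear_map_def by blast

lemma bilinear_map_left:
  "\<lbrakk>bilinear_map k M N P \<phi>; y \<in> carrier N\<rbrakk> \<Longrightarrow> linear_map k M P (\<lambda>x. \<phi> x y)"
  unfolding bilinear_map_def by blast

lemma bilinear_map_right:
  "\<lbrakk>bilinear_map k M N P \<phi>; x \<in> carrier M\<rbrakk> \<Longrightarrow> linear_map k N P (\<phi> x)"
  unfolding bilinear_map_def by blast

lemma bilinear_map_closed:
  "\<lbrakk>bilinear_map k M N P \<phi>; x \<in> carrier M; y \<in> carrier N\<rbrakk> \<Longrightarrow> \<phi> x y \<in> carrier P"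
  using linear_map_closed bilinear_map_right by metis

lemma bilinear_pure_tensor:
  fixes k (structure)
  assumes "module k M" "module k N"
  shows "bilinear_map k M N (M \<boxtimes> N) (pure_tensor k M N)"
proof -
  interpret module_pair k M N using assms by (rule module_pair.intro)
  show ?thesis
    by (intro bilinear_mapI linear_mapI)
      (simp_all add: pure_closed pure_add_left pure_add_right pure_smult_left pure_smult_right)
qed

lemma tensor_linear_cong:
  fixes k (structure)
  assumes "module k M" "module k N" "module k P"
    and f: "linear_map k (M \<boxtimes> N) P f" and g: "linear_map k (M \<boxtimes> N) P g"
    and eq: "\<And>x y. \<lbrakk>x \<in> carrier M; y \<in> carrier N\<rbrakk>
      \<Longrightarrow> f (pure_tensor k M N x y) = g (pure_tensor k M N x y)"
    and t: "t \<in> carrier (M \<boxtimes> N)"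
  shows "f t = g t"
proof -
  interpret module_pair k M N using assms(1,2) by (rule module_pair.intro)
  interpret P: module k P by fact
  show ?thesis
    by (rule tensor_additive_cong[OF P.M.abelian_group_axioms, of f g t])
      (use f g eq t in \<open>auto simp: linear_map_closed linear_map_add\<close>)
qed

text \<open>The universal property of the tensor product. The evaluation \<open>ev\<close> is a
  homomorphism on the free group which kills the generating relations, hence the subgroup
  \<open>H\<close>, and is thus constant on cosets.\<close>

lemma
  fixes k (structure)
  assumes M: "module k M" and N: "module k N" and P: "module k P"
    and \<phi>: "bilinear_map k M N P \<phi>"
  shows linear_tensor_lift: "linear_map k (M \<boxtimes> N) P (tensor_lift P \<phi>)"
    and tensor_lift_pure: "\<lbrakk>x \<in> carrier M; y \<in> carrier N\<rbrakk>
      \<Longrightarrow> tensor_lift P \<phi> (pure_tensor k M N x y) = \<phi> x y"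
proof -
  interpret module_pair k M N using M N by (rule module_pair.intro)
  interpret P: module k P by fact
  define f where "f = (\<lambda>z. \<phi> (fst z) (snd z))"
  define ev where "ev = (\<lambda>u :: ('c \<times> 'e) \<Rightarrow>\<^sub>0 int. \<Oplus>\<^bsub>P\<^esub>z\<in>Poly_Mapping.keys u. [Poly_Mapping.lookup u z] \<cdot>\<^bsub>P\<^esub> f z)"
  have f_closed: "f \<in> carrier M \<times> carrier N \<rightarrow> carrier P"
    using \<phi> bilinear_map_closed by (fastforce simp: f_def)
  have hom: "ev \<in> hom F (add_monoid P)"
    unfolding ev_def by (rule P.M.frag_sum_hom[OF f_closed])
  interpret ev: group_hom F "add_monoid P" ev
    by (intro group_hom.intro F.group_axioms P.M.a_group group_hom_axioms.intro hom)
  have ev_closed: "ev u \<in> carrier P" if "u \<in> carrier F" for u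
    using ev.hom_closed[OF that] by simp
  have ev_add: "ev (u + v) = ev u \<oplus>\<^bsub>P\<^esub> ev v" if "u \<in> carrier F" "v \<in> carrier F" for u v
    using ev.hom_mult[OF that] by simp
  have ev_diff: "ev (u - v) = ev u \<ominus>\<^bsub>P\<^esub> ev v" if u: "u \<in> carrier F" and v: "v \<in> carrier F" for u v
    using ev_add[OF u, of "- v"] ev.hom_inv[OF v] v by (simp add: a_minus_def a_inv_def keys_minus)
  have ev_of: "ev (frag_of (x, y)) = \<phi> x y" if "x \<in> carrier M" "y \<in> carrier N" for x y
    using P.M.frag_sum_of[of f "(x, y)"] bilinear_map_closed[OF \<phi> that] by (simp add: ev_def f_def)
  have ev_relation: "ev u = \<zero>\<^bsub>P\<^esub>" if u: "u \<in> tensor_relations k M N" for u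
  proof -
    note bl = linear_map_add[OF bilinear_map_left[OF \<phi>]] linear_map_add[OF bilinear_map_right[OF \<phi>]]
      linear_map_smult[OF bilinear_map_left[OF \<phi>]] linear_map_smult[OF bilinear_map_right[OF \<phi>]]
      bilinear_map_closed[OF \<phi>]
    have cancel: "p \<oplus>\<^bsub>P\<^esub> q \<ominus>\<^bsub>P\<^esub> p \<ominus>\<^bsub>P\<^esub> q = \<zero>\<^bsub>P\<^esub>" if "p \<in> carrier P" "q \<in> carrier P" for p q
    proof -
      have "p \<oplus>\<^bsub>P\<^esub> q \<ominus>\<^bsub>P\<^esub> p \<ominus>\<^bsub>P\<^esub> q = (p \<oplus>\<^bsub>P\<^esub> q) \<oplus>\<^bsub>P\<^esub> \<ominus>\<^bsub>P\<^esub> (p \<oplus>\<^bsub>P\<^esub> q)"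
        using that by (simp add: a_minus_def P.M.minus_add P.M.a_ac)
      then show ?thesis using that by (simp add: P.M.r_neg)
    qed
    have *: "frag_of z - frag_of z' \<in> carrier F" if "z \<in> carrier M \<times> carrier N" "z' \<in> carrier M \<times> carrier N" for z z'
      using that by (auto dest!: subsetD[OF keys_diff])
    show ?thesis
      using u unfolding tensor_relations_def
      by (elim UnE CollectE exE conjE)
        (simp_all add: ev_diff * ev_of bl cancel P.M.r_neg a_minus_def[of P "_ \<odot>\<^bsub>P\<^esub> _"]
          del: carrier_free_Abelian_group_iff)
  qed
  have H_ker: "ev u = \<zero>\<^bsub>P\<^esub>" if "u \<in> H" for u
  proof -
    have "tensor_relations k M N \<subseteq> kernel F (add_monoid P) ev"
      using ev_relation tensor_relations_closed by (auto simp: kernel_def simp del: carrier_free_Abelian_group_iff)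
    then have "H \<subseteq> kernel F (add_monoid P) ev"
      by (rule F.generate_subgroup_incl[OF _ ev.subgroup_kernel])
    then show ?thesis using that by (auto simp: kernel_def)
  qed
  \<comment> \<open>All representatives have the same value, so the image set in the definition of
    \<open>tensor_lift\<close> is a singleton and \<open>the_elem\<close> returns its
    element.\<close>
  have lift_cls: "tensor_lift P \<phi> (cls u) = ev u" if u: "u \<in> carrier F" for u
  proof -
    have eq: "ev v = ev u" if v: "v \<in> cls u" for v
    proof -
      have vF: "v \<in> carrier F" using v cls_subset[OF u] by blast
      then have "v - u \<in> H" using mem_cls_iff[OF u vF] v by simp
      then have "ev ((v - u) + u) = ev u"
        using ev_add[of "v - u" u] H_ker H.mem_carrier u ev_closed by auto
      then show ?thesis by simp
    qed
    have "u \<in> cls u" using F.rcos_self[OF u subgroup_H] .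
    then have "ev ` cls u = {ev u}"
      using eq by blast
    then show ?thesis
      unfolding tensor_lift_def ev_def[unfolded f_def, symmetric] by simp
  qed
  show pure: "tensor_lift P \<phi> (pure_tensor k M N x y) = \<phi> x y" if "x \<in> carrier M" "y \<in> carrier N" for x y
    unfolding pure_tensor_cls using that by (subst lift_cls) (auto simp: ev_of)
  have closed: "tensor_lift P \<phi> t \<in> carrier P" if "t \<in> carrier (M \<boxtimes> N)" for t
    using that lift_cls ev_closed unfolding tensor_carrier by auto
  have add: "tensor_lift P \<phi> (s \<oplus>\<^bsub>M \<boxtimes> N\<^esub> t) = tensor_lift P \<phi> s \<oplus>\<^bsub>P\<^esub> tensor_lift P \<phi> t"
    if "s \<in> carrier (M \<boxtimes> N)" "t \<in> carrier (M \<boxtimes> N)" for s t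
  proof -
    obtain u v where "s = cls u" "t = cls v" "u \<in> carrier F" "v \<in> carrier F"
      using \<open>t \<in> _\<close> \<open>s \<in> _\<close> unfolding tensor_carrier by blast
    then show ?thesis
      using F.m_closed[of u v] by (simp add: tensor_add lift_cls ev_add del: carrier_free_Abelian_group_iff)
  qed
  interpret T: module k "M \<boxtimes> N" by (rule module_tensor)
  show "linear_map k (M \<boxtimes> N) P (tensor_lift P \<phi>)"
  proof (rule linear_mapI)
    fix c t assume c: "c \<in> carrier k" and t: "t \<in> carrier (M \<boxtimes> N)"
    \<comment> \<open>Both sides are additive in \<open>t\<close> by the facts above, so homogeneity
      too can be tested on pure tensors.\<close>
    show "tensor_lift P \<phi> (c \<odot>\<^bsub>M \<boxtimes> N\<^esub> t) = c \<odot>\<^bsub>P\<^esub> tensor_lift P \<phi> t"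
    proof (rule tensor_additive_cong[OF P.M.abelian_group_axioms _ _ _ _ _ t])
      fix x y assume xy: "x \<in> carrier M" "y \<in> carrier N"
      have "tensor_lift P \<phi> (c \<odot>\<^bsub>M \<boxtimes> N\<^esub> pure_tensor k M N x y) = \<phi> (c \<odot>\<^bsub>M\<^esub> x) y"
        using c xy by (simp add: pure_smult_left[symmetric] pure)
      then show "tensor_lift P \<phi> (c \<odot>\<^bsub>M \<boxtimes> N\<^esub> pure_tensor k M N x y)
        = c \<odot>\<^bsub>P\<^esub> tensor_lift P \<phi> (pure_tensor k M N x y)"
        using c xy linear_map_smult[OF bilinear_map_left[OF \<phi> xy(2)] c xy(1)] by (simp add: pure)
    qed (use c in \<open>auto simp: closed add tensor_smult_closed tensor_smult_add P.smult_r_distr\<close>)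
  qed (simp_all add: closed add)
qed

section \<open>Nested sums: dependence on parameters, substitution and interchange\<close>

lemma linear_map_fun_add:
  assumes "module k N" "linear_map k M N f" "linear_map k M N g"
  shows "linear_map k M N (\<lambda>x. f x \<oplus>\<^bsub>N\<^esub> g x)"
proof -
  interpret N: module k N by fact
  note f = linear_map_closed[OF assms(2)] linear_map_add[OF assms(2)] linear_map_smult[OF assms(2)]
  note g = linear_map_closed[OF assms(3)] linear_map_add[OF assms(3)] linear_map_smult[OF assms(3)]
  show ?thesis
    by (rule linear_mapI) (simp_all add: f g N.M.a_ac N.smult_r_distr)
qed

lemma linear_map_fun_smult:
  assumes "module k N" "linear_map k M N f" "c \<in> carrier k"
  shows "linear_map k M N (\<lambda>x. c \<odot>\<^bsub>N\<^esub> f x)"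
proof -
  interpret N: module k N by fact
  note f = linear_map_closed[OF assms(2)] linear_map_add[OF assms(2)] linear_map_smult[OF assms(2)]
  show ?thesis
    by (rule linear_mapI)
      (simp_all add: f assms(3) N.smult_r_distr N.smult_assoc1[symmetric] N.R.m_comm)
qed

lemma bilinear_map_compose_left:
  "\<lbrakk>bilinear_map k M N P \<phi>; linear_map k Z M f; y \<in> carrier N\<rbrakk> \<Longrightarrow> linear_map k Z P (\<lambda>z. \<phi> (f z) y)"
  by (rule linear_map_compose[OF bilinear_map_left])

lemma bilinear_map_compose_right:
  "\<lbrakk>bilinear_map k M N P \<phi>; linear_map k Z N f; x \<in> carrier M\<rbrakk> \<Longrightarrow> linear_map k Z P (\<lambda>z. \<phi> x (f z))"
  by (rule linear_map_compose[OF bilinear_map_right])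

lemma tensor_lift_closed:
  "\<lbrakk>t \<in> carrier (M \<boxtimes>\<^bsub>k\<^esub> N); bilinear_map k M N P \<phi>; module k M; module k N; module k P\<rbrakk>
    \<Longrightarrow> tensor_lift P \<phi> t \<in> carrier P"
  by (rule linear_map_closed[OF linear_tensor_lift])

lemma linear_tensor_lift_arg:
  "\<lbrakk>linear_map k Z (M \<boxtimes>\<^bsub>k\<^esub> N) f; bilinear_map k M N P \<phi>; module k M; module k N; module k P\<rbrakk>
    \<Longrightarrow> linear_map k Z P (\<lambda>z. tensor_lift P \<phi> (f z))"
  by (rule linear_map_compose[OF linear_tensor_lift])

text \<open>This allows a sum to serve as the summand of another sum, with \<open>z\<close> a
  variable of the outer one. For fixed parameters both sides of each linearity equation are linear
  in \<open>t\<close>, and on pure tensors the equation is the linearity of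
  \<open>\<phi>\<close>.\<close>

lemma linear_tensor_lift_fun:
  fixes k (structure)
  assumes t: "t \<in> carrier (M \<boxtimes> N)"
    and bilin: "\<And>z. z \<in> carrier Z \<Longrightarrow> bilinear_map k M N P (\<phi> z)"
    and lin: "\<And>x y. \<lbrakk>x \<in> carrier M; y \<in> carrier N\<rbrakk> \<Longrightarrow> linear_map k Z P (\<lambda>z. \<phi> z x y)"
    and mods: "module k Z" "module k M" "module k N" "module k P"
  shows "linear_map k Z P (\<lambda>z. tensor_lift P (\<phi> z) t)"
proof -
  interpret Z: module k Z by fact
  note lift = linear_tensor_lift[OF mods(2-4) bilin] tensor_lift_pure[OF mods(2-4) bilin]
  show ?thesis
  proof (rule linear_mapI)
    fix z assume "z \<in> carrier Z"
    then show "tensor_lift P (\<phi> z) t \<in> carrier P"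
      by (rule linear_map_closed[OF lift(1) t])
  next
    fix z z' assume z: "z \<in> carrier Z" "z' \<in> carrier Z"
    show "tensor_lift P (\<phi> (z \<oplus>\<^bsub>Z\<^esub> z')) t = tensor_lift P (\<phi> z) t \<oplus>\<^bsub>P\<^esub> tensor_lift P (\<phi> z') t"
    proof (rule tensor_linear_cong[OF mods(2-4) _ _ _ t,
          where f = "tensor_lift P (\<phi> (z \<oplus>\<^bsub>Z\<^esub> z'))" and g = "\<lambda>t. tensor_lift P (\<phi> z) t \<oplus>\<^bsub>P\<^esub> tensor_lift P (\<phi> z') t"])
      fix x y assume xy: "x \<in> carrier M" "y \<in> carrier N"
      show "tensor_lift P (\<phi> (z \<oplus>\<^bsub>Z\<^esub> z')) (pure_tensor k M N x y)
        = tensor_lift P (\<phi> z) (pure_tensor k M N x y) \<oplus>\<^bsub>P\<^esub> tensor_lift P (\<phi> z') (pure_tensor k M N x y)"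
        unfolding lift(2)[OF Z.M.a_closed[OF z] xy] lift(2)[OF z(1) xy] lift(2)[OF z(2) xy]
        by (rule linear_map_add[OF lin[OF xy] z])
    qed (intro linear_map_fun_add lift(1) mods Z.M.a_closed z)+
  next
    fix c z assume z: "c \<in> carrier k" "z \<in> carrier Z"
    show "tensor_lift P (\<phi> (c \<odot>\<^bsub>Z\<^esub> z)) t = c \<odot>\<^bsub>P\<^esub> tensor_lift P (\<phi> z) t"
    proof (rule tensor_linear_cong[OF mods(2-4) _ _ _ t,
          where f = "tensor_lift P (\<phi> (c \<odot>\<^bsub>Z\<^esub> z))" and g = "\<lambda>t. c \<odot>\<^bsub>P\<^esub> tensor_lift P (\<phi> z) t"])
      fix x y assume xy: "x \<in> carrier M" "y \<in> carrier N"
      show "tensor_lift P (\<phi> (c \<odot>\<^bsub>Z\<^esub> z)) (pure_tensor k M N x y)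
        = c \<odot>\<^bsub>P\<^esub> tensor_lift P (\<phi> z) (pure_tensor k M N x y)"
        unfolding lift(2)[OF Z.smult_closed[OF z] xy] lift(2)[OF z(2) xy]
        by (rule linear_map_smult[OF lin[OF xy] z])
    qed (intro linear_map_fun_smult lift(1) mods Z.smult_closed z)+
  qed
qed

text \<open>Rewriting under the summation sign. The equations in question hold only for carrier
  elements, and this congruence supplies the membership facts. Bilinearity of \<open>\<psi>\<close>
  is inherited from \<open>\<phi>\<close>.\<close>

lemma tensor_lift_cong:
  fixes k (structure)
  assumes t: "t \<in> carrier (M \<boxtimes> N)" and \<phi>: "bilinear_map k M N P \<phi>"
    and mods: "module k M" "module k N" "module k P"
    and eq: "\<And>x y. \<lbrakk>x \<in> carrier M; y \<in> carrier N\<rbrakk> \<Longrightarrow> \<phi> x y = \<psi> x y"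
  shows "tensor_lift P \<phi> t = tensor_lift P \<psi> t"
proof -
  interpret M: module k M by fact
  interpret N: module k N by fact
  have \<psi>: "bilinear_map k M N P \<psi>"
    using \<phi> eq unfolding bilinear_map_def linear_map_def by (simp add: Pi_iff)
  show ?thesis
    by (rule tensor_linear_cong[OF mods linear_tensor_lift[OF mods \<phi>] linear_tensor_lift[OF mods \<psi>] _ t])
      (simp add: tensor_lift_pure[OF mods \<phi>] tensor_lift_pure[OF mods \<psi>] eq)
qed

lemma linear_map_tensor_lift:
  fixes k (structure)
  assumes t: "t \<in> carrier (M \<boxtimes> N)" and h: "linear_map k P Q h" and \<phi>: "bilinear_map k M N P \<phi>"
    and mods: "module k M" "module k N" "module k P" "module k Q"
  shows "h (tensor_lift P \<phi> t) = tensor_lift Q (\<lambda>x y. h (\<phi> x y)) t"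
proof -
  have *: "bilinear_map k M N Q (\<lambda>x y. h (\<phi> x y))"
    by (intro bilinear_mapI linear_map_compose[OF h] bilinear_map_left[OF \<phi>] bilinear_map_right[OF \<phi>])
  show ?thesis
    by (rule tensor_linear_cong[OF mods(1,2,4) linear_map_compose[OF h linear_tensor_lift] _ _ t])
      (use mods \<phi> * in \<open>simp_all add: linear_tensor_lift tensor_lift_pure\<close>)
qed

text \<open>Introduces Sweedler notation for a tensor that is not given as pure, inside an
  expression linear in it.\<close>

lemma linear_map_expand:
  fixes k (structure)
  assumes t: "t \<in> carrier (M \<boxtimes> N)" and h: "linear_map k (M \<boxtimes> N) P h"
    and mods: "module k M" "module k N" "module k P"
  shows "h t = tensor_lift P (\<lambda>x y. h (pure_tensor k M N x y)) t"
proof -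
  note pure = bilinear_pure_tensor[OF mods(1,2)]
  have *: "bilinear_map k M N P (\<lambda>x y. h (pure_tensor k M N x y))"
    by (intro bilinear_mapI linear_map_compose[OF h] bilinear_map_left[OF pure] bilinear_map_right[OF pure])
  show ?thesis
    by (rule tensor_linear_cong[OF mods h linear_tensor_lift[OF mods *] _ t])
      (simp add: tensor_lift_pure[OF mods *])
qed

text \<open>The sums are independent: \<open>t\<close> does not depend on \<open>x\<close> and
  \<open>y\<close>, nor \<open>s\<close> on \<open>u\<close> and \<open>v\<close>. Both sides are
  linear in \<open>s\<close>, and for pure \<open>s\<close> the sum over \<open>s\<close> disappears
  from either side.\<close>

lemma tensor_lift_commute:
  fixes k (structure)
  assumes s: "s \<in> carrier (X \<boxtimes> Y)" and t: "t \<in> carrier (U \<boxtimes> V)"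
    and b1: "\<And>x y. \<lbrakk>x \<in> carrier X; y \<in> carrier Y\<rbrakk> \<Longrightarrow> bilinear_map k U V P (\<phi> x y)"
    and b2: "\<And>u v. \<lbrakk>u \<in> carrier U; v \<in> carrier V\<rbrakk> \<Longrightarrow> bilinear_map k X Y P (\<lambda>x y. \<phi> x y u v)"
    and mods: "module k X" "module k Y" "module k U" "module k V" "module k P"
  shows "tensor_lift P (\<lambda>x y. tensor_lift P (\<phi> x y) t) s
    = tensor_lift P (\<lambda>u v. tensor_lift P (\<lambda>x y. \<phi> x y u v) s) t"
proof (rule tensor_linear_cong[OF mods(1,2,5) _ _ _ s,
      where f = "\<lambda>s. tensor_lift P (\<lambda>x y. tensor_lift P (\<phi> x y) t) s"
        and g = "\<lambda>s. tensor_lift P (\<lambda>u v. tensor_lift P (\<lambda>x y. \<phi> x y u v) s) t"])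
  have b: "bilinear_map k X Y P (\<lambda>x y. tensor_lift P (\<phi> x y) t)"
    by (assumption | rule bilinear_mapI linear_tensor_lift_fun[OF t] b1 mods
        bilinear_map_left[OF b2] bilinear_map_right[OF b2])+
  show "linear_map k (X \<boxtimes> Y) P (tensor_lift P (\<lambda>x y. tensor_lift P (\<phi> x y) t))"
    by (rule linear_tensor_lift[OF mods(1,2,5) b])
  have b': "bilinear_map k U V P (\<lambda>u v. tensor_lift P (\<lambda>x y. \<phi> x y u v) s)"
    if "s \<in> carrier (X \<boxtimes> Y)" for s
    by (assumption | rule bilinear_mapI linear_tensor_lift_fun[OF that] b2 mods
        bilinear_map_left[OF b1] bilinear_map_right[OF b1])+
  show "linear_map k (X \<boxtimes> Y) P (\<lambda>s. tensor_lift P (\<lambda>u v. tensor_lift P (\<lambda>x y. \<phi> x y u v) s) t)"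
    by (assumption | rule linear_tensor_lift_fun[OF t] b' b2 mods module_tensor linear_tensor_lift)+
  fix x y assume xy: "x \<in> carrier X" "y \<in> carrier Y"
  have "tensor_lift P (\<lambda>x y. tensor_lift P (\<phi> x y) t) (pure_tensor k X Y x y) = tensor_lift P (\<phi> x y) t"
    using xy by (rule tensor_lift_pure[OF mods(1,2,5) b])
  also have "\<dots> = tensor_lift P (\<lambda>u v. tensor_lift P (\<lambda>x y. \<phi> x y u v) (pure_tensor k X Y x y)) t"
    by (rule tensor_lift_cong[OF t b1[OF xy] mods(3-5)])
      (simp add: tensor_lift_pure[OF mods(1,2,5) b2] xy)
  finally show "tensor_lift P (\<lambda>x y. tensor_lift P (\<phi> x y) t) (pure_tensor k X Y x y)
    = tensor_lift P (\<lambda>u v. tensor_lift P (\<lambda>x y. \<phi> x y u v) (pure_tensor k X Y x y)) t" .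
qed

text \<open>
  The rules \<open>lin\<close> discharge membership, linearity and bilinearity conditions by plain resolution,
  as in \<open>(assumption | rule lin \<dots>)+\<close>. Modules that do not occur in the conclusion of a rule are
  determined by its first premise. A linear map \<open>h\<close> takes part through \<open>linear_map_rules[OF h]\<close>;
  without \<open>OF h\<close> these rules have a variable at the head and loop.
\<close>

named_theorems lin

lemmas [lin] = linear_map_id bilinear_mapI linear_tensor_lift_arg linear_tensor_lift_fun
  tensor_lift_closed module_tensor pure_tensor_closed

lemma linear_pure_left [lin]:
  "\<lbrakk>linear_map k Z M f; y \<in> carrier N; module k M; module k N\<rbrakk>
    \<Longrightarrow> linear_map k Z (M \<boxtimes>\<^bsub>k\<^esub> N) (\<lambda>z. pure_tensor k M N (f z) y)"
  by (rule bilinear_map_compose_left[OF bilinear_pure_tensor])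

lemma linear_pure_right [lin]:
  "\<lbrakk>linear_map k Z N f; x \<in> carrier M; module k M; module k N\<rbrakk>
    \<Longrightarrow> linear_map k Z (M \<boxtimes>\<^bsub>k\<^esub> N) (\<lambda>z. pure_tensor k M N x (f z))"
  by (rule bilinear_map_compose_right[OF bilinear_pure_tensor])


section \<open>Structural maps on pure tensors\<close>

lemma
  fixes k (structure)
  assumes "module k X" "module k Y" "module k M" "module k N"
    and f: "linear_map k X M f" and g: "linear_map k Y N g"
  shows linear_tensor_map: "linear_map k (X \<boxtimes> Y) (M \<boxtimes> N) (tensor_map k M N f g)"
    and tensor_map_pure: "\<lbrakk>x \<in> carrier X; y \<in> carrier Y\<rbrakk>
      \<Longrightarrow> tensor_map k M N f g (pure_tensor k X Y x y) = pure_tensor k M N (f x) (g y)"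
proof -
  note [lin] = assms(1-4) linear_map_compose[OF f] linear_map_compose[OF g] linear_map_closed[OF f] linear_map_closed[OF g]
  have b: "bilinear_map k X Y (M \<boxtimes> N) (\<lambda>x y. pure_tensor k M N (f x) (g y))"
    by (assumption | rule lin)+
  show "linear_map k (X \<boxtimes> Y) (M \<boxtimes> N) (tensor_map k M N f g)"
    unfolding tensor_map_def by (assumption | rule b linear_tensor_lift lin)+
  show "tensor_map k M N f g (pure_tensor k X Y x y) = pure_tensor k M N (f x) (g y)"
    if "x \<in> carrier X" "y \<in> carrier Y"
    unfolding tensor_map_def using that by - (assumption | rule b tensor_lift_pure lin)+
qed

context
  fixes k :: "('k, 'r) ring_scheme" (structure) and X :: "('k, 'u, 'x) module_scheme"
    and Y :: "('k, 'v, 'y) module_scheme" and Z :: "('k, 'w, 'z) module_scheme"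
  assumes mods [lin]: "module k X" "module k Y" "module k Z"
begin

private lemma assoc_bilinear:
  "bilinear_map k (X \<boxtimes> Y) Z (X \<boxtimes> (Y \<boxtimes> Z)) (\<lambda>t z.
      tensor_lift (X \<boxtimes> (Y \<boxtimes> Z)) (\<lambda>x y.
        pure_tensor k X (Y \<boxtimes> Z) x (pure_tensor k Y Z y z)) t)"
  by (assumption | rule lin)+

lemma linear_assoc:
  "linear_map k ((X \<boxtimes> Y) \<boxtimes> Z) (X \<boxtimes> (Y \<boxtimes> Z)) (assoc k X Y Z)"
  unfolding assoc_def by (rule linear_tensor_lift assoc_bilinear lin)+

text \<open>The left factor is left arbitrary because the composites below apply
  \<open>assoc\<close> to an element whose left factor is a value of an exchange map, which need not
  be pure.\<close>

lemma assoc_pure_right: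
  assumes "t \<in> carrier (X \<boxtimes> Y)" "z \<in> carrier Z"
  shows "assoc k X Y Z (pure_tensor k (X \<boxtimes> Y) Z t z)
    = tensor_lift (X \<boxtimes> (Y \<boxtimes> Z)) (\<lambda>x y. pure_tensor k X (Y \<boxtimes> Z) x (pure_tensor k Y Z y z)) t"
  unfolding assoc_def using assms by - (assumption | rule assoc_bilinear tensor_lift_pure lin)+

lemma assoc_pure:
  assumes "x \<in> carrier X" "y \<in> carrier Y" "z \<in> carrier Z"
  shows "assoc k X Y Z (pure_tensor k (X \<boxtimes> Y) Z (pure_tensor k X Y x y) z)
    = pure_tensor k X (Y \<boxtimes> Z) x (pure_tensor k Y Z y z)"
proof -
  have "assoc k X Y Z (pure_tensor k (X \<boxtimes> Y) Z (pure_tensor k X Y x y) z)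
    = tensor_lift (X \<boxtimes> (Y \<boxtimes> Z)) (\<lambda>x y. pure_tensor k X (Y \<boxtimes> Z) x (pure_tensor k Y Z y z))
      (pure_tensor k X Y x y)"
    using assms by - (assumption | rule assoc_pure_right lin)+
  also have "\<dots> = pure_tensor k X (Y \<boxtimes> Z) x (pure_tensor k Y Z y z)"
    using assms by - (assumption | rule tensor_lift_pure lin)+
  finally show ?thesis .
qed

private lemma assoc_inv_bilinear:
  "bilinear_map k X (Y \<boxtimes> Z) ((X \<boxtimes> Y) \<boxtimes> Z) (\<lambda>x t.
      tensor_lift ((X \<boxtimes> Y) \<boxtimes> Z) (\<lambda>y z.
        pure_tensor k (X \<boxtimes> Y) Z (pure_tensor k X Y x y) z) t)"
  by (assumption | rule lin)+

lemma linear_assoc_inv: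
  "linear_map k (X \<boxtimes> (Y \<boxtimes> Z)) ((X \<boxtimes> Y) \<boxtimes> Z) (assoc_inv k X Y Z)"
  unfolding assoc_inv_def by (rule linear_tensor_lift assoc_inv_bilinear lin)+

lemma assoc_inv_pure_left:
  assumes "x \<in> carrier X" "t \<in> carrier (Y \<boxtimes> Z)"
  shows "assoc_inv k X Y Z (pure_tensor k X (Y \<boxtimes> Z) x t)
    = tensor_lift ((X \<boxtimes> Y) \<boxtimes> Z) (\<lambda>y z. pure_tensor k (X \<boxtimes> Y) Z (pure_tensor k X Y x y) z) t"
  unfolding assoc_inv_def using assms by - (assumption | rule assoc_inv_bilinear tensor_lift_pure lin)+

lemma assoc_inv_pure:
  assumes "x \<in> carrier X" "y \<in> carrier Y" "z \<in> carrier Z"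
  shows "assoc_inv k X Y Z (pure_tensor k X (Y \<boxtimes> Z) x (pure_tensor k Y Z y z))
    = pure_tensor k (X \<boxtimes> Y) Z (pure_tensor k X Y x y) z"
proof -
  have "assoc_inv k X Y Z (pure_tensor k X (Y \<boxtimes> Z) x (pure_tensor k Y Z y z))
    = tensor_lift ((X \<boxtimes> Y) \<boxtimes> Z) (\<lambda>y z. pure_tensor k (X \<boxtimes> Y) Z (pure_tensor k X Y x y) z)
      (pure_tensor k Y Z y z)"
    using assms by - (assumption | rule assoc_inv_pure_left lin)+
  also have "\<dots> = pure_tensor k (X \<boxtimes> Y) Z (pure_tensor k X Y x y) z"
    using assms by - (assumption | rule tensor_lift_pure lin)+
  finally show ?thesis .
qed

end

lemma linear_map_id_const [lin]: "linear_map k M M id"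
  by (simp add: linear_map_def)

lemma tensor_linear_cong_left:
  fixes k (structure)
  assumes mods: "module k X" "module k Y" "module k Z" "module k P"
    and f: "linear_map k ((X \<boxtimes> Y) \<boxtimes> Z) P f" and g: "linear_map k ((X \<boxtimes> Y) \<boxtimes> Z) P g"
    and eq: "\<And>x y z. \<lbrakk>x \<in> carrier X; y \<in> carrier Y; z \<in> carrier Z\<rbrakk>
      \<Longrightarrow> f (pure_tensor k (X \<boxtimes> Y) Z (pure_tensor k X Y x y) z)
        = g (pure_tensor k (X \<boxtimes> Y) Z (pure_tensor k X Y x y) z)"
    and t: "t \<in> carrier ((X \<boxtimes> Y) \<boxtimes> Z)"
  shows "f t = g t"
proof (rule tensor_linear_cong[OF module_tensor[OF mods(1,2)] mods(3,4) f g _ t])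
  note [lin] = mods linear_map_compose[OF f] linear_map_compose[OF g]
  fix s z assume s: "s \<in> carrier (X \<boxtimes> Y)" and z: "z \<in> carrier Z"
  show "f (pure_tensor k (X \<boxtimes> Y) Z s z) = g (pure_tensor k (X \<boxtimes> Y) Z s z)"
    by (rule tensor_linear_cong[OF mods(1,2,4) _ _ _ s,
          where f = "\<lambda>s. f (pure_tensor k (X \<boxtimes> Y) Z s z)" and g = "\<lambda>s. g (pure_tensor k (X \<boxtimes> Y) Z s z)"])
      (assumption | rule z eq lin)+
qed

lemma tensor_linear_cong_right:
  fixes k (structure)
  assumes mods: "module k X" "module k Y" "module k Z" "module k P"
    and f: "linear_map k (X \<boxtimes> (Y \<boxtimes> Z)) P f" and g: "linear_map k (X \<boxtimes> (Y \<boxtimes> Z)) P g"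
    and eq: "\<And>x y z. \<lbrakk>x \<in> carrier X; y \<in> carrier Y; z \<in> carrier Z\<rbrakk>
      \<Longrightarrow> f (pure_tensor k X (Y \<boxtimes> Z) x (pure_tensor k Y Z y z))
        = g (pure_tensor k X (Y \<boxtimes> Z) x (pure_tensor k Y Z y z))"
    and t: "t \<in> carrier (X \<boxtimes> (Y \<boxtimes> Z))"
  shows "f t = g t"
proof (rule tensor_linear_cong[OF mods(1) module_tensor[OF mods(2,3)] mods(4) f g _ t])
  note [lin] = mods linear_map_compose[OF f] linear_map_compose[OF g]
  fix x s assume x: "x \<in> carrier X" and s: "s \<in> carrier (Y \<boxtimes> Z)"
  show "f (pure_tensor k X (Y \<boxtimes> Z) x s) = g (pure_tensor k X (Y \<boxtimes> Z) x s)"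
    by (rule tensor_linear_cong[OF mods(2,3,4) _ _ _ s,
          where f = "\<lambda>s. f (pure_tensor k X (Y \<boxtimes> Z) x s)" and g = "\<lambda>s. g (pure_tensor k X (Y \<boxtimes> Z) x s)"])
      (assumption | rule x eq lin)+
qed

section \<open>The exchange composites on pure tensors\<close>

context
  fixes k :: "('k, 'r) ring_scheme" (structure) and X :: "('k, 'u, 'x) module_scheme"
    and Y :: "('k, 'v, 'y) module_scheme" and Z :: "('k, 'w, 'z) module_scheme"
  assumes mods [lin]: "module k X" "module k Y" "module k Z"
begin

context
  fixes f :: "('w, 'u) tensor \<Rightarrow> ('u, 'w) tensor" and g :: "('w, 'v) tensor \<Rightarrow> ('v, 'w) tensor"
  assumes f: "linear_map k (Z \<boxtimes> X) (X \<boxtimes> Z) f" and g: "linear_map k (Z \<boxtimes> Y) (Y \<boxtimes> Z) g"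
begin

private lemmas fg_right = f g linear_map_rules[OF f] linear_map_rules[OF g]

private lemma id_g: "linear_map k (X \<boxtimes> (Z \<boxtimes> Y)) (X \<boxtimes> (Y \<boxtimes> Z)) (tensor_map k X (Y \<boxtimes> Z) id g)"
  by (assumption | rule linear_tensor_map lin fg_right)+

private lemma f_id: "linear_map k ((Z \<boxtimes> X) \<boxtimes> Y) ((X \<boxtimes> Z) \<boxtimes> Y) (tensor_map k (X \<boxtimes> Z) Y f id)"
  by (assumption | rule linear_tensor_map lin fg_right)+

lemma linear_cross_right:
  "linear_map k (Z \<boxtimes> (X \<boxtimes> Y)) ((X \<boxtimes> Y) \<boxtimes> Z) (cross_right k X Y Z f g)"
  unfolding cross_right_def comp_def
  by (rule linear_map_compose[OF linear_assoc_inv] linear_map_compose[OF id_g] linear_map_compose[OF linear_assoc]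
      linear_map_compose[OF f_id] linear_assoc_inv mods)+

text \<open>Here \<open>z\<close> is the traveller: it passes \<open>x\<close> first, and what
  emerges as \<open>z1\<close> then passes \<open>y\<close>. The sum for \<open>f\<close> is
  therefore the outer one.\<close>

lemma cross_right_pure:
  assumes xyz: "z \<in> carrier Z" "x \<in> carrier X" "y \<in> carrier Y"
  shows "cross_right k X Y Z f g (pure_tensor k Z (X \<boxtimes> Y) z (pure_tensor k X Y x y)) =
    tensor_lift ((X \<boxtimes> Y) \<boxtimes> Z) (\<lambda>x1 z1.
      tensor_lift ((X \<boxtimes> Y) \<boxtimes> Z) (\<lambda>y1 z2. pure_tensor k (X \<boxtimes> Y) Z (pure_tensor k X Y x1 y1) z2)
        (g (pure_tensor k Z Y z1 y)))
      (f (pure_tensor k Z X z x))"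
proof -
  \<comment> \<open>The last two maps of the composite are bundled into one linear map, through
    which the sum produced by \<open>f\<close> can be pulled in a single step.\<close>
  let ?H = "\<lambda>s. assoc_inv k X Y Z (tensor_map k X (Y \<boxtimes> Z) id g s)"
  have H: "linear_map k (X \<boxtimes> (Z \<boxtimes> Y)) ((X \<boxtimes> Y) \<boxtimes> Z) ?H"
    by (rule linear_map_compose[OF linear_assoc_inv] id_g mods)+
  note [lin] = xyz
  have 1: "tensor_map k (X \<boxtimes> Z) Y f id (pure_tensor k (Z \<boxtimes> X) Y (pure_tensor k Z X z x) y)
    = pure_tensor k (X \<boxtimes> Z) Y (f (pure_tensor k Z X z x)) (id y)"
    by (assumption | rule tensor_map_pure lin fg_right)+
  have 2: "assoc k X Z Y (pure_tensor k (X \<boxtimes> Z) Y (f (pure_tensor k Z X z x)) y)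
    = tensor_lift (X \<boxtimes> (Z \<boxtimes> Y)) (\<lambda>x z. pure_tensor k X (Z \<boxtimes> Y) x (pure_tensor k Z Y z y))
      (f (pure_tensor k Z X z x))"
    by (assumption | rule assoc_pure_right lin fg_right)+
  have 3: "?H (pure_tensor k X (Z \<boxtimes> Y) x1 (pure_tensor k Z Y z1 y))
    = tensor_lift ((X \<boxtimes> Y) \<boxtimes> Z) (\<lambda>y1 z2. pure_tensor k (X \<boxtimes> Y) Z (pure_tensor k X Y x1 y1) z2)
        (g (pure_tensor k Z Y z1 y))"
    if "x1 \<in> carrier X" "z1 \<in> carrier Z" for x1 z1
  proof -
    note [lin] = that
    have "tensor_map k X (Y \<boxtimes> Z) id g (pure_tensor k X (Z \<boxtimes> Y) x1 (pure_tensor k Z Y z1 y))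
      = pure_tensor k X (Y \<boxtimes> Z) (id x1) (g (pure_tensor k Z Y z1 y))"
      by (assumption | rule tensor_map_pure lin fg_right)+
    moreover have "assoc_inv k X Y Z (pure_tensor k X (Y \<boxtimes> Z) x1 (g (pure_tensor k Z Y z1 y)))
      = tensor_lift ((X \<boxtimes> Y) \<boxtimes> Z) (\<lambda>y1 z2. pure_tensor k (X \<boxtimes> Y) Z (pure_tensor k X Y x1 y1) z2)
        (g (pure_tensor k Z Y z1 y))"
      by (assumption | rule assoc_inv_pure_left lin fg_right)+
    ultimately show ?thesis by simp
  qed
  have "cross_right k X Y Z f g (pure_tensor k Z (X \<boxtimes> Y) z (pure_tensor k X Y x y))
    = ?H (tensor_lift (X \<boxtimes> (Z \<boxtimes> Y)) (\<lambda>x z. pure_tensor k X (Z \<boxtimes> Y) x (pure_tensor k Z Y z y))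
      (f (pure_tensor k Z X z x)))"
    unfolding cross_right_def using assoc_inv_pure[OF mods(3,1,2) xyz] 1 2 by simp
  also have "\<dots> = tensor_lift ((X \<boxtimes> Y) \<boxtimes> Z) (\<lambda>x1 z1. ?H (pure_tensor k X (Z \<boxtimes> Y) x1 (pure_tensor k Z Y z1 y)))
      (f (pure_tensor k Z X z x))"
    by (assumption | rule linear_map_tensor_lift[OF _ H] lin fg_right)+
  also have "\<dots> = tensor_lift ((X \<boxtimes> Y) \<boxtimes> Z) (\<lambda>x1 z1.
      tensor_lift ((X \<boxtimes> Y) \<boxtimes> Z) (\<lambda>y1 z2. pure_tensor k (X \<boxtimes> Y) Z (pure_tensor k X Y x1 y1) z2)
        (g (pure_tensor k Z Y z1 y)))
      (f (pure_tensor k Z X z x))"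
    by (assumption | rule 3 tensor_lift_cong linear_map_compose[OF H] lin fg_right)+
  finally show ?thesis .
qed

end

context
  fixes f :: "('v, 'u) tensor \<Rightarrow> ('u, 'v) tensor" and g :: "('w, 'u) tensor \<Rightarrow> ('u, 'w) tensor"
  assumes f: "linear_map k (Y \<boxtimes> X) (X \<boxtimes> Y) f" and g: "linear_map k (Z \<boxtimes> X) (X \<boxtimes> Z) g"
begin

private lemmas fg_left = f g linear_map_rules[OF f] linear_map_rules[OF g]

private lemma left_id_g: "linear_map k (Y \<boxtimes> (Z \<boxtimes> X)) (Y \<boxtimes> (X \<boxtimes> Z)) (tensor_map k Y (X \<boxtimes> Z) id g)"
  by (assumption | rule linear_tensor_map lin fg_left)+

private lemma left_f_id: "linear_map k ((Y \<boxtimes> X) \<boxtimes> Z) ((X \<boxtimes> Y) \<boxtimes> Z) (tensor_map k (X \<boxtimes> Y) Z f id)"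
  by (assumption | rule linear_tensor_map lin fg_left)+

lemma linear_cross_left:
  "linear_map k ((Y \<boxtimes> Z) \<boxtimes> X) (X \<boxtimes> (Y \<boxtimes> Z)) (cross_left k X Y Z f g)"
  unfolding cross_left_def comp_def
  by (rule linear_map_compose[OF linear_assoc_inv] linear_map_compose[OF left_id_g] linear_map_compose[OF linear_assoc]
      linear_map_compose[OF left_f_id] linear_assoc mods)+

text \<open>Here \<open>x\<close> is overtaken by \<open>z\<close> first and by \<open>y\<close>
  afterwards, so the outer sum belongs to \<open>g\<close>, the second argument.\<close>

lemma cross_left_pure:
  assumes xyz: "y \<in> carrier Y" "z \<in> carrier Z" "x \<in> carrier X"
  shows "cross_left k X Y Z f g (pure_tensor k (Y \<boxtimes> Z) X (pure_tensor k Y Z y z) x) =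
    tensor_lift (X \<boxtimes> (Y \<boxtimes> Z)) (\<lambda>x1 z1.
      tensor_lift (X \<boxtimes> (Y \<boxtimes> Z)) (\<lambda>x2 y1. pure_tensor k X (Y \<boxtimes> Z) x2 (pure_tensor k Y Z y1 z1))
        (f (pure_tensor k Y X y x1)))
      (g (pure_tensor k Z X z x))"
proof -
  let ?H = "\<lambda>s. assoc k X Y Z (tensor_map k (X \<boxtimes> Y) Z f id s)"
  have H: "linear_map k ((Y \<boxtimes> X) \<boxtimes> Z) (X \<boxtimes> (Y \<boxtimes> Z)) ?H"
    by (rule linear_map_compose[OF linear_assoc] left_f_id mods)+
  note [lin] = xyz
  have 1: "tensor_map k Y (X \<boxtimes> Z) id g (pure_tensor k Y (Z \<boxtimes> X) y (pure_tensor k Z X z x))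
    = pure_tensor k Y (X \<boxtimes> Z) (id y) (g (pure_tensor k Z X z x))"
    by (assumption | rule tensor_map_pure lin fg_left)+
  have 2: "assoc_inv k Y X Z (pure_tensor k Y (X \<boxtimes> Z) y (g (pure_tensor k Z X z x)))
    = tensor_lift ((Y \<boxtimes> X) \<boxtimes> Z) (\<lambda>x z. pure_tensor k (Y \<boxtimes> X) Z (pure_tensor k Y X y x) z)
      (g (pure_tensor k Z X z x))"
    by (assumption | rule assoc_inv_pure_left lin fg_left)+
  have 3: "?H (pure_tensor k (Y \<boxtimes> X) Z (pure_tensor k Y X y x1) z1)
    = tensor_lift (X \<boxtimes> (Y \<boxtimes> Z)) (\<lambda>x2 y1. pure_tensor k X (Y \<boxtimes> Z) x2 (pure_tensor k Y Z y1 z1))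
        (f (pure_tensor k Y X y x1))"
    if "x1 \<in> carrier X" "z1 \<in> carrier Z" for x1 z1
  proof -
    note [lin] = that
    have "tensor_map k (X \<boxtimes> Y) Z f id (pure_tensor k (Y \<boxtimes> X) Z (pure_tensor k Y X y x1) z1)
      = pure_tensor k (X \<boxtimes> Y) Z (f (pure_tensor k Y X y x1)) (id z1)"
      by (assumption | rule tensor_map_pure lin fg_left)+
    moreover have "assoc k X Y Z (pure_tensor k (X \<boxtimes> Y) Z (f (pure_tensor k Y X y x1)) z1)
      = tensor_lift (X \<boxtimes> (Y \<boxtimes> Z)) (\<lambda>x2 y1. pure_tensor k X (Y \<boxtimes> Z) x2 (pure_tensor k Y Z y1 z1))
        (f (pure_tensor k Y X y x1))"
      by (assumption | rule assoc_pure_right lin fg_left)+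
    ultimately show ?thesis by simp
  qed
  have "cross_left k X Y Z f g (pure_tensor k (Y \<boxtimes> Z) X (pure_tensor k Y Z y z) x)
    = ?H (tensor_lift ((Y \<boxtimes> X) \<boxtimes> Z) (\<lambda>x z. pure_tensor k (Y \<boxtimes> X) Z (pure_tensor k Y X y x) z)
      (g (pure_tensor k Z X z x)))"
    unfolding cross_left_def using assoc_pure[OF mods(2,3,1) xyz] 1 2 by simp
  also have "\<dots> = tensor_lift (X \<boxtimes> (Y \<boxtimes> Z)) (\<lambda>x1 z1. ?H (pure_tensor k (Y \<boxtimes> X) Z (pure_tensor k Y X y x1) z1))
      (g (pure_tensor k Z X z x))"
    by (assumption | rule linear_map_tensor_lift[OF _ H] lin fg_left)+
  also have "\<dots> = tensor_lift (X \<boxtimes> (Y \<boxtimes> Z)) (\<lambda>x1 z1.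
      tensor_lift (X \<boxtimes> (Y \<boxtimes> Z)) (\<lambda>x2 y1. pure_tensor k X (Y \<boxtimes> Z) x2 (pure_tensor k Y Z y1 z1))
        (f (pure_tensor k Y X y x1)))
      (g (pure_tensor k Z X z x))"
    by (assumption | rule 3 tensor_lift_cong linear_map_compose[OF H] lin fg_left)+
  finally show ?thesis .
qed

end

end

section \<open>The middle exchange and the induced action on pure tensors\<close>

context
  fixes k :: "('k, 'r) ring_scheme" (structure) and A :: "('k, 'a, 'x) module_scheme"
    and B :: "('k, 'b, 'y) module_scheme" and M :: "('k, 'm, 'z) module_scheme"
    and N :: "('k, 'n, 's) module_scheme"
    and \<tau> :: "('b, 'm) tensor \<Rightarrow> ('m, 'b) tensor"
    and \<alpha> :: "('a, 'm) tensor \<Rightarrow> 'm" and \<beta> :: "('b, 'n) tensor \<Rightarrow> 'n"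
  assumes mods [lin]: "module k A" "module k B" "module k M" "module k N"
    and \<tau>: "linear_map k (B \<boxtimes> M) (M \<boxtimes> B) \<tau>"
begin

private lemmas tau = \<tau> linear_map_rules[OF \<tau>]

private lemma inner_linear:
  "linear_map k (B \<boxtimes> (M \<boxtimes> N)) (M \<boxtimes> (B \<boxtimes> N))
    (assoc k M B N \<circ> tensor_map k (M \<boxtimes> B) N \<tau> id \<circ> assoc_inv k B M N)"
  unfolding comp_def
  by (rule linear_map_compose[OF linear_assoc] linear_map_compose[OF linear_tensor_map]
      linear_assoc_inv lin tau)+

lemma linear_cross_middle:
  "linear_map k ((A \<boxtimes> B) \<boxtimes> (M \<boxtimes> N)) ((A \<boxtimes> M) \<boxtimes> (B \<boxtimes> N))
    (cross_middle k A B M N \<tau>)"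
  unfolding cross_middle_def comp_assoc
  \<comment> \<open>Only the outer compositions are opened. The inner one is an argument of
    \<open>tensor_map\<close> and has to keep the shape in which \<open>inner_linear\<close> speaks
    of it.\<close>
  unfolding comp_def[of "assoc_inv k A M (B \<boxtimes> N)"] comp_def[of "tensor_map k A _ id _"]
  by (rule linear_map_compose[OF linear_assoc_inv] linear_map_compose[OF linear_tensor_map]
      linear_assoc inner_linear[unfolded comp_assoc] lin tau)+

lemma cross_middle_pure:
  assumes "a \<in> carrier A" "b \<in> carrier B" "m \<in> carrier M" "n \<in> carrier N"
  shows "cross_middle k A B M N \<tau>
      (pure_tensor k (A \<boxtimes> B) (M \<boxtimes> N) (pure_tensor k A B a b) (pure_tensor k M N m n)) =
    tensor_lift ((A \<boxtimes> M) \<boxtimes> (B \<boxtimes> N))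
      (\<lambda>m1 b1. pure_tensor k (A \<boxtimes> M) (B \<boxtimes> N) (pure_tensor k A M a m1) (pure_tensor k B N b1 n))
      (\<tau> (pure_tensor k B M b m))"
proof -
  note [lin] = assms
  let ?G = "assoc k M B N \<circ> tensor_map k (M \<boxtimes> B) N \<tau> id \<circ> assoc_inv k B M N"
  have 1: "assoc k A B (M \<boxtimes> N)
      (pure_tensor k (A \<boxtimes> B) (M \<boxtimes> N) (pure_tensor k A B a b) (pure_tensor k M N m n))
    = pure_tensor k A (B \<boxtimes> (M \<boxtimes> N)) a (pure_tensor k B (M \<boxtimes> N) b (pure_tensor k M N m n))"
    by (rule assoc_pure lin tau)+
  have 2: "tensor_map k A (M \<boxtimes> (B \<boxtimes> N)) id ?G
      (pure_tensor k A (B \<boxtimes> (M \<boxtimes> N)) a (pure_tensor k B (M \<boxtimes> N) b (pure_tensor k M N m n)))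
    = pure_tensor k A (M \<boxtimes> (B \<boxtimes> N)) (id a) (?G (pure_tensor k B (M \<boxtimes> N) b (pure_tensor k M N m n)))"
    by (rule tensor_map_pure inner_linear lin tau)+
  have 3: "assoc_inv k B M N (pure_tensor k B (M \<boxtimes> N) b (pure_tensor k M N m n))
    = pure_tensor k (B \<boxtimes> M) N (pure_tensor k B M b m) n"
    by (rule assoc_inv_pure lin tau)+
  have 4: "tensor_map k (M \<boxtimes> B) N \<tau> id (pure_tensor k (B \<boxtimes> M) N (pure_tensor k B M b m) n)
    = pure_tensor k (M \<boxtimes> B) N (\<tau> (pure_tensor k B M b m)) (id n)"
    by (rule tensor_map_pure lin tau)+
  have 5: "assoc k M B N (pure_tensor k (M \<boxtimes> B) N (\<tau> (pure_tensor k B M b m)) n)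
    = tensor_lift (M \<boxtimes> (B \<boxtimes> N)) (\<lambda>m1 b1. pure_tensor k M (B \<boxtimes> N) m1 (pure_tensor k B N b1 n))
      (\<tau> (pure_tensor k B M b m))"
    by (rule assoc_pure_right lin tau)+
  have H: "linear_map k (M \<boxtimes> (B \<boxtimes> N)) ((A \<boxtimes> M) \<boxtimes> (B \<boxtimes> N))
      (\<lambda>s. assoc_inv k A M (B \<boxtimes> N) (pure_tensor k A (M \<boxtimes> (B \<boxtimes> N)) a s))"
    by (rule linear_map_compose[OF linear_assoc_inv] lin tau)+
  have "cross_middle k A B M N \<tau>
      (pure_tensor k (A \<boxtimes> B) (M \<boxtimes> N) (pure_tensor k A B a b) (pure_tensor k M N m n)) =
    assoc_inv k A M (B \<boxtimes> N) (pure_tensor k A (M \<boxtimes> (B \<boxtimes> N)) a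
      (tensor_lift (M \<boxtimes> (B \<boxtimes> N)) (\<lambda>m1 b1. pure_tensor k M (B \<boxtimes> N) m1 (pure_tensor k B N b1 n))
      (\<tau> (pure_tensor k B M b m))))"
    unfolding cross_middle_def o_apply[of _ "assoc k A B (M \<boxtimes> N)"]
      o_apply[of _ "tensor_map k A _ id _"] 1 2
    by (simp add: 3 4 5)
  also have "\<dots> = tensor_lift ((A \<boxtimes> M) \<boxtimes> (B \<boxtimes> N))
      (\<lambda>m1 b1. assoc_inv k A M (B \<boxtimes> N) (pure_tensor k A (M \<boxtimes> (B \<boxtimes> N)) a
        (pure_tensor k M (B \<boxtimes> N) m1 (pure_tensor k B N b1 n))))
      (\<tau> (pure_tensor k B M b m))"
    by (assumption | rule linear_map_tensor_lift[OF _ H] lin tau)+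
  also have "\<dots> = tensor_lift ((A \<boxtimes> M) \<boxtimes> (B \<boxtimes> N))
      (\<lambda>m1 b1. pure_tensor k (A \<boxtimes> M) (B \<boxtimes> N) (pure_tensor k A M a m1) (pure_tensor k B N b1 n))
      (\<tau> (pure_tensor k B M b m))"
    by (assumption | rule assoc_inv_pure tensor_lift_cong linear_map_compose[OF linear_assoc_inv] lin tau)+
  finally show ?thesis .
qed

context
  assumes \<alpha>: "linear_map k (A \<boxtimes> M) M \<alpha>" and \<beta>: "linear_map k (B \<boxtimes> N) N \<beta>"
begin

private lemmas actions = \<alpha> linear_map_rules[OF \<alpha>]
   \<beta> linear_map_rules[OF \<beta>]

lemma linear_induced_action:
  "linear_map k ((A \<boxtimes> B) \<boxtimes> (M \<boxtimes> N)) (M \<boxtimes> N) (induced_action k A B M N \<tau> \<alpha> \<beta>)"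
  unfolding induced_action_def comp_def
  by (rule linear_map_compose[OF linear_tensor_map] linear_cross_middle lin tau actions)+

text \<open>In Sweedler form
  \<open>(a \<otimes> b) (m \<otimes> n) = \<Sum> a m1 \<otimes> b1 n\<close>: \<open>b\<close>
  passes \<open>m\<close> on its way to \<open>n\<close>.\<close>

lemma induced_action_pure:
  assumes "a \<in> carrier A" "b \<in> carrier B" "m \<in> carrier M" "n \<in> carrier N"
  shows "induced_action k A B M N \<tau> \<alpha> \<beta>
      (pure_tensor k (A \<boxtimes> B) (M \<boxtimes> N) (pure_tensor k A B a b) (pure_tensor k M N m n)) =
    tensor_lift (M \<boxtimes> N)
      (\<lambda>m1 b1. pure_tensor k M N (\<alpha> (pure_tensor k A M a m1)) (\<beta> (pure_tensor k B N b1 n)))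
      (\<tau> (pure_tensor k B M b m))"
proof -
  note [lin] = assms
  have H: "linear_map k ((A \<boxtimes> M) \<boxtimes> (B \<boxtimes> N)) (M \<boxtimes> N) (tensor_map k M N \<alpha> \<beta>)"
    by (rule linear_tensor_map lin tau actions)+
  have "induced_action k A B M N \<tau> \<alpha> \<beta>
      (pure_tensor k (A \<boxtimes> B) (M \<boxtimes> N) (pure_tensor k A B a b) (pure_tensor k M N m n)) =
    tensor_map k M N \<alpha> \<beta> (tensor_lift ((A \<boxtimes> M) \<boxtimes> (B \<boxtimes> N))
      (\<lambda>m1 b1. pure_tensor k (A \<boxtimes> M) (B \<boxtimes> N) (pure_tensor k A M a m1) (pure_tensor k B N b1 n))
      (\<tau> (pure_tensor k B M b m)))"
    unfolding induced_action_def using assms by (simp add: cross_middle_pure)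
  also have "\<dots> = tensor_lift (M \<boxtimes> N)
      (\<lambda>m1 b1. tensor_map k M N \<alpha> \<beta>
        (pure_tensor k (A \<boxtimes> M) (B \<boxtimes> N) (pure_tensor k A M a m1) (pure_tensor k B N b1 n)))
      (\<tau> (pure_tensor k B M b m))"
    by (assumption | rule linear_map_tensor_lift[OF _ H] lin tau actions)+
  also have "\<dots> = tensor_lift (M \<boxtimes> N)
      (\<lambda>m1 b1. pure_tensor k M N (\<alpha> (pure_tensor k A M a m1)) (\<beta> (pure_tensor k B N b1 n)))
      (\<tau> (pure_tensor k B M b m))"
    by (assumption | rule tensor_map_pure tensor_lift_cong linear_map_compose[OF H] lin tau actions)+
  finally show ?thesis .
qed

end

end

text \<open>Flattens a sum taken over a tensor which is itself given as a sum, as happens whenever a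
  defining formula is substituted into a calculation.\<close>

lemma tensor_lift_tensor_lift:
  fixes k (structure)
  assumes "t \<in> carrier (X \<boxtimes> Y)" "bilinear_map k X Y (U \<boxtimes> V) \<psi>" "bilinear_map k U V P \<phi>"
    and "module k X" "module k Y" "module k U" "module k V" "module k P"
  shows "tensor_lift P \<phi> (tensor_lift (U \<boxtimes> V) \<psi> t) = tensor_lift P (\<lambda>x y. tensor_lift P \<phi> (\<psi> x y)) t"
  by (rule linear_map_tensor_lift[OF assms(1) linear_tensor_lift assms(2)] assms module_tensor)+


section \<open>Products of algebras\<close>

lemma assoc_algebra_module: "assoc_algebra k A \<Longrightarrow> module k A"
  by (simp add: assoc_algebra_def)

lemma algebra_mult_closed [lin]:
  assumes "x \<in> carrier A" "y \<in> carrier A" "assoc_algebra k A"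
  shows "x \<otimes>\<^bsub>A\<^esub> y \<in> carrier A"
proof -
  interpret assoc_algebra k A by fact
  show ?thesis using assms by simp
qed

lemma bilinear_mult:
  assumes "assoc_algebra k A"
  shows "bilinear_map k A A A (\<otimes>\<^bsub>A\<^esub>)"
proof -
  interpret assoc_algebra k A by fact
  show ?thesis
    by (intro bilinear_mapI linear_mapI)
      (simp_all add: A.l_distr A.r_distr smult_mult_left smult_mult_right)
qed

lemma linear_mult_left [lin]:
  "\<lbrakk>linear_map k Z A f; y \<in> carrier A; assoc_algebra k A\<rbrakk> \<Longrightarrow> linear_map k Z A (\<lambda>z. f z \<otimes>\<^bsub>A\<^esub> y)"
  by (rule bilinear_map_compose_left[OF bilinear_mult])

lemma linear_mult_right [lin]:
  "\<lbrakk>linear_map k Z A f; x \<in> carrier A; assoc_algebra k A\<rbrakk> \<Longrightarrow> linear_map k Z A (\<lambda>z. x \<otimes>\<^bsub>A\<^esub> f z)"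
  by (rule bilinear_map_compose_right[OF bilinear_mult])

lemma linear_product_map: "assoc_algebra k A \<Longrightarrow> linear_map k (A \<boxtimes>\<^bsub>k\<^esub> A) A (product_map A)"
  unfolding product_map_def by (rule linear_tensor_lift bilinear_mult assoc_algebra_module | assumption)+

lemma product_map_pure:
  "\<lbrakk>x \<in> carrier A; y \<in> carrier A; assoc_algebra k A\<rbrakk>
    \<Longrightarrow> product_map A (pure_tensor k A A x y) = x \<otimes>\<^bsub>A\<^esub> y"
  unfolding product_map_def by (rule tensor_lift_pure bilinear_mult assoc_algebra_module | assumption)+

lemma algebra_mult_assoc:
  assumes "x \<in> carrier A" "y \<in> carrier A" "z \<in> carrier A" "assoc_algebra k A"
  shows "(x \<otimes>\<^bsub>A\<^esub> y) \<otimes>\<^bsub>A\<^esub> z = x \<otimes>\<^bsub>A\<^esub> (y \<otimes>\<^bsub>A\<^esub> z)"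
proof -
  interpret assoc_algebra k A by fact
  show ?thesis using assms by (simp add: A.m_assoc)
qed


section \<open>The twisting conditions in Sweedler form\<close>

text \<open>The first module twisting axiom on pure tensors. The factor \<open>b'\<close> stands
  next to \<open>m\<close> and passes it first, so its sum is the outer one. With
  \<open>M = A\<close> and \<open>\<tau> = R\<close> this is also the twisting axiom for the product
  of \<open>B\<close>.\<close>

definition product_compatible where
  "product_compatible k B M \<tau> \<longleftrightarrow> (\<forall>b\<in>carrier B. \<forall>b'\<in>carrier B. \<forall>m\<in>carrier M.
    \<tau> (pure_tensor k B M (b \<otimes>\<^bsub>B\<^esub> b') m) =
    tensor_lift (M \<boxtimes>\<^bsub>k\<^esub> B) (\<lambda>m1 b1. tensor_lift (M \<boxtimes>\<^bsub>k\<^esub> B)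
      (\<lambda>m2 b2. pure_tensor k M B m2 (b2 \<otimes>\<^bsub>B\<^esub> b1)) (\<tau> (pure_tensor k B M b m1)))
      (\<tau> (pure_tensor k B M b' m)))"

text \<open>The second module twisting axiom on pure tensors: \<open>b\<close> passes
  \<open>a\<close>, and what is left of it passes \<open>m\<close>. With \<open>M = A\<close> and
  \<open>\<alpha>\<close> the product of \<open>A\<close> this is also the twisting axiom for the
  product of \<open>A\<close>.\<close>

definition action_compatible where
  "action_compatible k A B M R \<alpha> \<tau> \<longleftrightarrow> (\<forall>b\<in>carrier B. \<forall>a\<in>carrier A. \<forall>m\<in>carrier M.
    \<tau> (pure_tensor k B M b (\<alpha> (pure_tensor k A M a m))) =
    tensor_lift (M \<boxtimes>\<^bsub>k\<^esub> B) (\<lambda>a1 b1. tensor_lift (M \<boxtimes>\<^bsub>k\<^esub> B)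
      (\<lambda>m1 b2. pure_tensor k M B (\<alpha> (pure_tensor k A M a1 m1)) b2) (\<tau> (pure_tensor k B M b1 m)))
      (R (pure_tensor k B A b a)))"

context
  fixes k :: "('k, 'r) ring_scheme" (structure) and B :: "('k, 'b, 'y) module_scheme"
    and M :: "('k, 'm, 'z) module_scheme" and \<tau> :: "('b, 'm) tensor \<Rightarrow> ('m, 'b) tensor"
  assumes B: "assoc_algebra k B" and M: "module k M"
    and \<tau>: "linear_map k (B \<boxtimes> M) (M \<boxtimes> B) \<tau>"
begin

private lemmas product_hyps = B M assoc_algebra_module[OF B] \<tau> linear_map_rules[OF \<tau>]

private lemma product_id_pure:
  assumes "b \<in> carrier B" "b' \<in> carrier B" "m \<in> carrier M"
  shows "(\<tau> \<circ> tensor_map k B M (product_map B) id)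
      (pure_tensor k (B \<boxtimes> B) M (pure_tensor k B B b b') m) = \<tau> (pure_tensor k B M (b \<otimes>\<^bsub>B\<^esub> b') m)"
proof -
  have "tensor_map k B M (product_map B) id (pure_tensor k (B \<boxtimes> B) M (pure_tensor k B B b b') m)
    = pure_tensor k B M (product_map B (pure_tensor k B B b b')) (id m)"
    using assms by - (assumption | rule tensor_map_pure linear_product_map lin product_hyps)+
  then show ?thesis using assms by (simp add: product_map_pure[OF _ _ B])
qed

private lemma id_product_cross_left_pure:
  assumes "b \<in> carrier B" "b' \<in> carrier B" "m \<in> carrier M"
  shows "(tensor_map k M B id (product_map B) \<circ> cross_left k M B B \<tau> \<tau>)
      (pure_tensor k (B \<boxtimes> B) M (pure_tensor k B B b b') m) =
    tensor_lift (M \<boxtimes> B) (\<lambda>m1 b1. tensor_lift (M \<boxtimes> B)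
      (\<lambda>m2 b2. pure_tensor k M B m2 (b2 \<otimes>\<^bsub>B\<^esub> b1)) (\<tau> (pure_tensor k B M b m1)))
      (\<tau> (pure_tensor k B M b' m))"
proof -
  let ?H = "tensor_map k M B id (product_map B)"
  have H: "linear_map k (M \<boxtimes> (B \<boxtimes> B)) (M \<boxtimes> B) ?H"
    by (assumption | rule linear_tensor_map linear_product_map lin product_hyps)+
  have H_pure: "?H (pure_tensor k M (B \<boxtimes> B) m2 (pure_tensor k B B b2 b1)) = pure_tensor k M B m2 (b2 \<otimes>\<^bsub>B\<^esub> b1)"
    if "m2 \<in> carrier M" "b2 \<in> carrier B" "b1 \<in> carrier B" for m2 b2 b1
  proof -
    have "?H (pure_tensor k M (B \<boxtimes> B) m2 (pure_tensor k B B b2 b1))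
      = pure_tensor k M B (id m2) (product_map B (pure_tensor k B B b2 b1))"
      using that by - (assumption | rule tensor_map_pure linear_product_map lin product_hyps)+
    then show ?thesis using that by (simp add: product_map_pure[OF _ _ B])
  qed
  have "(?H \<circ> cross_left k M B B \<tau> \<tau>) (pure_tensor k (B \<boxtimes> B) M (pure_tensor k B B b b') m)
    = ?H (tensor_lift (M \<boxtimes> (B \<boxtimes> B)) (\<lambda>m1 b1. tensor_lift (M \<boxtimes> (B \<boxtimes> B))
      (\<lambda>m2 b2. pure_tensor k M (B \<boxtimes> B) m2 (pure_tensor k B B b2 b1)) (\<tau> (pure_tensor k B M b m1)))
      (\<tau> (pure_tensor k B M b' m)))"
    using cross_left_pure[OF M product_hyps(3,3) \<tau> \<tau> assms] by simp
  also have "\<dots> = tensor_lift (M \<boxtimes> B) (\<lambda>m1 b1. ?H (tensor_lift (M \<boxtimes> (B \<boxtimes> B))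
      (\<lambda>m2 b2. pure_tensor k M (B \<boxtimes> B) m2 (pure_tensor k B B b2 b1)) (\<tau> (pure_tensor k B M b m1))))
      (\<tau> (pure_tensor k B M b' m))"
    using assms by - (assumption | rule linear_map_tensor_lift[OF _ H] lin product_hyps)+
  also have "\<dots> = tensor_lift (M \<boxtimes> B) (\<lambda>m1 b1. tensor_lift (M \<boxtimes> B) (\<lambda>m2 b2. ?H
      (pure_tensor k M (B \<boxtimes> B) m2 (pure_tensor k B B b2 b1))) (\<tau> (pure_tensor k B M b m1)))
      (\<tau> (pure_tensor k B M b' m))"
    using assms by - (assumption | rule linear_map_tensor_lift[OF _ H] tensor_lift_cong
      linear_map_compose[OF H] lin product_hyps)+
  also have "\<dots> = tensor_lift (M \<boxtimes> B) (\<lambda>m1 b1. tensor_lift (M \<boxtimes> B)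
      (\<lambda>m2 b2. pure_tensor k M B m2 (b2 \<otimes>\<^bsub>B\<^esub> b1)) (\<tau> (pure_tensor k B M b m1)))
      (\<tau> (pure_tensor k B M b' m))"
    using assms by - (assumption | rule H_pure tensor_lift_cong linear_map_compose[OF H] lin product_hyps)+
  finally show ?thesis .
qed

text \<open>The bridge between the axiom as an equation of maps on a triple tensor product and its
  Sweedler form. Both sides are linear, so pure triples suffice.\<close>

lemma product_compatible_iff:
  "product_compatible k B M \<tau> \<longleftrightarrow> (\<forall>t\<in>carrier ((B \<boxtimes> B) \<boxtimes> M).
      (\<tau> \<circ> tensor_map k B M (product_map B) id) t =
      (tensor_map k M B id (product_map B) \<circ> cross_left k M B B \<tau> \<tau>) t)"
  (is "_ \<longleftrightarrow> (\<forall>t\<in>_. ?f t = ?g t)")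
proof
  assume pc: "product_compatible k B M \<tau>"
  have f: "linear_map k ((B \<boxtimes> B) \<boxtimes> M) (M \<boxtimes> B) ?f"
    unfolding comp_def by (assumption | rule linear_tensor_map linear_product_map lin product_hyps)+
  have g: "linear_map k ((B \<boxtimes> B) \<boxtimes> M) (M \<boxtimes> B) ?g"
    unfolding comp_def
    by (assumption | rule linear_map_compose[OF linear_tensor_map] linear_cross_left linear_product_map lin product_hyps)+
  show "\<forall>t\<in>carrier ((B \<boxtimes> B) \<boxtimes> M). ?f t = ?g t"
  proof
    fix t assume "t \<in> carrier ((B \<boxtimes> B) \<boxtimes> M)"
    then show "?f t = ?g t"
      by (rule tensor_linear_cong_left[OF product_hyps(3,3) M module_tensor[OF M product_hyps(3)] f g, rotated])
        (use pc in \<open>simp add: product_id_pure[unfolded o_apply] id_product_cross_left_pure[unfolded o_apply]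
          product_compatible_def\<close>)
  qed
next
  assume eq: "\<forall>t\<in>carrier ((B \<boxtimes> B) \<boxtimes> M). ?f t = ?g t"
  show "product_compatible k B M \<tau>"
    unfolding product_compatible_def
  proof (intro ballI)
    fix b b' m assume b: "b \<in> carrier B" "b' \<in> carrier B" "m \<in> carrier M"
    then have "pure_tensor k (B \<boxtimes> B) M (pure_tensor k B B b b') m \<in> carrier ((B \<boxtimes> B) \<boxtimes> M)"
      by - (assumption | rule lin product_hyps)+
    with eq have "?f (pure_tensor k (B \<boxtimes> B) M (pure_tensor k B B b b') m)
      = ?g (pure_tensor k (B \<boxtimes> B) M (pure_tensor k B B b b') m)" by blast
    then show "\<tau> (pure_tensor k B M (b \<otimes>\<^bsub>B\<^esub> b') m) =
      tensor_lift (M \<boxtimes> B) (\<lambda>m1 b1. tensor_lift (M \<boxtimes> B)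
        (\<lambda>m2 b2. pure_tensor k M B m2 (b2 \<otimes>\<^bsub>B\<^esub> b1)) (\<tau> (pure_tensor k B M b m1)))
        (\<tau> (pure_tensor k B M b' m))"
      unfolding product_id_pure[OF b] id_product_cross_left_pure[OF b] .
  qed
qed

text \<open>The form used in calculations: the axiom under a sum with arbitrary bilinear summand
  \<open>\<phi>\<close>, which may contain further sums. It follows by applying the lift of
  \<open>\<phi>\<close> to the axiom and flattening.\<close>

lemma tensor_lift_product_compatible:
  assumes pc: "product_compatible k B M \<tau>"
    and b: "b \<in> carrier B" "b' \<in> carrier B" "m \<in> carrier M"
    and P: "module k P" and \<phi>: "bilinear_map k M B P \<phi>"
  shows "tensor_lift P \<phi> (\<tau> (pure_tensor k B M (b \<otimes>\<^bsub>B\<^esub> b') m)) =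
    tensor_lift P (\<lambda>m1 b1. tensor_lift P (\<lambda>m2 b2. \<phi> m2 (b2 \<otimes>\<^bsub>B\<^esub> b1)) (\<tau> (pure_tensor k B M b m1)))
      (\<tau> (pure_tensor k B M b' m))"
proof -
  note \<phi>_lin = bilinear_map_compose_left[OF \<phi>] bilinear_map_compose_right[OF \<phi>] \<phi> P
  have "tensor_lift P \<phi> (\<tau> (pure_tensor k B M (b \<otimes>\<^bsub>B\<^esub> b') m)) =
    tensor_lift P \<phi> (tensor_lift (M \<boxtimes> B) (\<lambda>m1 b1. tensor_lift (M \<boxtimes> B)
        (\<lambda>m2 b2. pure_tensor k M B m2 (b2 \<otimes>\<^bsub>B\<^esub> b1)) (\<tau> (pure_tensor k B M b m1)))
        (\<tau> (pure_tensor k B M b' m)))"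
    using pc b by (simp add: product_compatible_def)
  also have "\<dots> = tensor_lift P (\<lambda>m1 b1. tensor_lift P \<phi> (tensor_lift (M \<boxtimes> B)
        (\<lambda>m2 b2. pure_tensor k M B m2 (b2 \<otimes>\<^bsub>B\<^esub> b1)) (\<tau> (pure_tensor k B M b m1))))
        (\<tau> (pure_tensor k B M b' m))"
    using b by - (assumption | rule tensor_lift_tensor_lift \<phi>_lin lin product_hyps)+
  also have "\<dots> = tensor_lift P (\<lambda>m1 b1. tensor_lift P
        (\<lambda>m2 b2. tensor_lift P \<phi> (pure_tensor k M B m2 (b2 \<otimes>\<^bsub>B\<^esub> b1))) (\<tau> (pure_tensor k B M b m1)))
        (\<tau> (pure_tensor k B M b' m))"
    using b by - (assumption | rule tensor_lift_tensor_lift tensor_lift_cong \<phi>_lin lin product_hyps)+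
  also have "\<dots> = tensor_lift P (\<lambda>m1 b1. tensor_lift P (\<lambda>m2 b2. \<phi> m2 (b2 \<otimes>\<^bsub>B\<^esub> b1)) (\<tau> (pure_tensor k B M b m1)))
      (\<tau> (pure_tensor k B M b' m))"
    using b by - (assumption | rule tensor_lift_pure tensor_lift_cong \<phi>_lin lin product_hyps)+
  finally show ?thesis .
qed

context
  fixes A :: "('k, 'a, 'x) module_scheme" and R :: "('b, 'a) tensor \<Rightarrow> ('a, 'b) tensor"
    and \<alpha> :: "('a, 'm) tensor \<Rightarrow> 'm"
  assumes A: "module k A" and R: "linear_map k (B \<boxtimes> A) (A \<boxtimes> B) R"
    and \<alpha>: "linear_map k (A \<boxtimes> M) M \<alpha>"
begin

private lemmas action_hyps = product_hyps A R linear_map_rules[OF R]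
  \<alpha> linear_map_rules[OF \<alpha>]

private lemma id_action_pure:
  assumes "b \<in> carrier B" "a \<in> carrier A" "m \<in> carrier M"
  shows "(\<tau> \<circ> tensor_map k B M id \<alpha>) (pure_tensor k B (A \<boxtimes> M) b (pure_tensor k A M a m)) =
    \<tau> (pure_tensor k B M b (\<alpha> (pure_tensor k A M a m)))"
proof -
  have "tensor_map k B M id \<alpha> (pure_tensor k B (A \<boxtimes> M) b (pure_tensor k A M a m))
    = pure_tensor k B M (id b) (\<alpha> (pure_tensor k A M a m))"
    using assms by - (assumption | rule tensor_map_pure lin action_hyps)+
  then show ?thesis by simp
qed

private lemma action_id_cross_right_pure:
  assumes "b \<in> carrier B" "a \<in> carrier A" "m \<in> carrier M"
  shows "(tensor_map k M B \<alpha> id \<circ> cross_right k A M B R \<tau>)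
      (pure_tensor k B (A \<boxtimes> M) b (pure_tensor k A M a m)) =
    tensor_lift (M \<boxtimes> B) (\<lambda>a1 b1. tensor_lift (M \<boxtimes> B)
      (\<lambda>m1 b2. pure_tensor k M B (\<alpha> (pure_tensor k A M a1 m1)) b2) (\<tau> (pure_tensor k B M b1 m)))
      (R (pure_tensor k B A b a))"
proof -
  let ?H = "tensor_map k M B \<alpha> id"
  have H: "linear_map k ((A \<boxtimes> M) \<boxtimes> B) (M \<boxtimes> B) ?H"
    by (assumption | rule linear_tensor_map lin action_hyps)+
  have H_pure: "?H (pure_tensor k (A \<boxtimes> M) B (pure_tensor k A M a1 m1) b2)
      = pure_tensor k M B (\<alpha> (pure_tensor k A M a1 m1)) b2"
    if "a1 \<in> carrier A" "m1 \<in> carrier M" "b2 \<in> carrier B" for a1 m1 b2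
  proof -
    have "?H (pure_tensor k (A \<boxtimes> M) B (pure_tensor k A M a1 m1) b2)
      = pure_tensor k M B (\<alpha> (pure_tensor k A M a1 m1)) (id b2)"
      using that by - (assumption | rule tensor_map_pure lin action_hyps)+
    then show ?thesis by simp
  qed
  have "(?H \<circ> cross_right k A M B R \<tau>) (pure_tensor k B (A \<boxtimes> M) b (pure_tensor k A M a m))
    = ?H (tensor_lift ((A \<boxtimes> M) \<boxtimes> B) (\<lambda>a1 b1. tensor_lift ((A \<boxtimes> M) \<boxtimes> B)
      (\<lambda>m1 b2. pure_tensor k (A \<boxtimes> M) B (pure_tensor k A M a1 m1) b2) (\<tau> (pure_tensor k B M b1 m)))
      (R (pure_tensor k B A b a)))"
    using cross_right_pure[OF A M product_hyps(3) R \<tau> assms] by simp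
  also have "\<dots> = tensor_lift (M \<boxtimes> B) (\<lambda>a1 b1. ?H (tensor_lift ((A \<boxtimes> M) \<boxtimes> B)
      (\<lambda>m1 b2. pure_tensor k (A \<boxtimes> M) B (pure_tensor k A M a1 m1) b2) (\<tau> (pure_tensor k B M b1 m))))
      (R (pure_tensor k B A b a))"
    using assms by - (assumption | rule linear_map_tensor_lift[OF _ H] lin action_hyps)+
  also have "\<dots> = tensor_lift (M \<boxtimes> B) (\<lambda>a1 b1. tensor_lift (M \<boxtimes> B)
      (\<lambda>m1 b2. ?H (pure_tensor k (A \<boxtimes> M) B (pure_tensor k A M a1 m1) b2)) (\<tau> (pure_tensor k B M b1 m)))
      (R (pure_tensor k B A b a))"
    using assms by - (assumption | rule linear_map_tensor_lift[OF _ H] tensor_lift_cong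
      linear_map_compose[OF H] lin action_hyps)+
  also have "\<dots> = tensor_lift (M \<boxtimes> B) (\<lambda>a1 b1. tensor_lift (M \<boxtimes> B)
      (\<lambda>m1 b2. pure_tensor k M B (\<alpha> (pure_tensor k A M a1 m1)) b2) (\<tau> (pure_tensor k B M b1 m)))
      (R (pure_tensor k B A b a))"
    using assms by - (assumption | rule H_pure tensor_lift_cong linear_map_compose[OF H] lin action_hyps)+
  finally show ?thesis .
qed

lemma action_compatible_iff:
  "action_compatible k A B M R \<alpha> \<tau> \<longleftrightarrow> (\<forall>t\<in>carrier (B \<boxtimes> (A \<boxtimes> M)).
      (\<tau> \<circ> tensor_map k B M id \<alpha>) t = (tensor_map k M B \<alpha> id \<circ> cross_right k A M B R \<tau>) t)"
  (is "_ \<longleftrightarrow> (\<forall>t\<in>_. ?f t = ?g t)")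
proof
  assume ac: "action_compatible k A B M R \<alpha> \<tau>"
  have f: "linear_map k (B \<boxtimes> (A \<boxtimes> M)) (M \<boxtimes> B) ?f"
    unfolding comp_def by (assumption | rule linear_tensor_map lin action_hyps)+
  have g: "linear_map k (B \<boxtimes> (A \<boxtimes> M)) (M \<boxtimes> B) ?g"
    unfolding comp_def
    by (assumption | rule linear_map_compose[OF linear_tensor_map] linear_cross_right lin action_hyps)+
  show "\<forall>t\<in>carrier (B \<boxtimes> (A \<boxtimes> M)). ?f t = ?g t"
  proof
    fix t assume "t \<in> carrier (B \<boxtimes> (A \<boxtimes> M))"
    then show "?f t = ?g t"
      by (rule tensor_linear_cong_right[OF product_hyps(3) A M module_tensor[OF M product_hyps(3)] f g, rotated])
        (use ac in \<open>simp add: id_action_pure[unfolded o_apply] action_id_cross_right_pure[unfolded o_apply]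
          action_compatible_def\<close>)
  qed
next
  assume eq: "\<forall>t\<in>carrier (B \<boxtimes> (A \<boxtimes> M)). ?f t = ?g t"
  show "action_compatible k A B M R \<alpha> \<tau>"
    unfolding action_compatible_def
  proof (intro ballI)
    fix b a m assume b: "b \<in> carrier B" "a \<in> carrier A" "m \<in> carrier M"
    then have "pure_tensor k B (A \<boxtimes> M) b (pure_tensor k A M a m) \<in> carrier (B \<boxtimes> (A \<boxtimes> M))"
      by - (assumption | rule lin action_hyps)+
    with eq have "?f (pure_tensor k B (A \<boxtimes> M) b (pure_tensor k A M a m))
      = ?g (pure_tensor k B (A \<boxtimes> M) b (pure_tensor k A M a m))" by blast
    then show "\<tau> (pure_tensor k B M b (\<alpha> (pure_tensor k A M a m))) =
      tensor_lift (M \<boxtimes> B) (\<lambda>a1 b1. tensor_lift (M \<boxtimes> B)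
        (\<lambda>m1 b2. pure_tensor k M B (\<alpha> (pure_tensor k A M a1 m1)) b2) (\<tau> (pure_tensor k B M b1 m)))
        (R (pure_tensor k B A b a))"
      unfolding id_action_pure[OF b] action_id_cross_right_pure[OF b] .
  qed
qed

text \<open>As for the product axiom, the summand is arbitrary. Read from right to left, this
  recombines an exchange with \<open>a\<close> followed by one with \<open>m\<close> into a single
  exchange with \<open>a m\<close>.\<close>

lemma tensor_lift_action_compatible:
  assumes ac: "action_compatible k A B M R \<alpha> \<tau>"
    and b: "b \<in> carrier B" "a \<in> carrier A" "m \<in> carrier M"
    and P: "module k P" and \<phi>: "bilinear_map k M B P \<phi>"
  shows "tensor_lift P \<phi> (\<tau> (pure_tensor k B M b (\<alpha> (pure_tensor k A M a m)))) =
    tensor_lift P (\<lambda>a1 b1. tensor_lift P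
      (\<lambda>m1 b2. \<phi> (\<alpha> (pure_tensor k A M a1 m1)) b2) (\<tau> (pure_tensor k B M b1 m)))
      (R (pure_tensor k B A b a))"
proof -
  note \<phi>_lin = bilinear_map_compose_left[OF \<phi>] bilinear_map_compose_right[OF \<phi>] \<phi> P
  have "tensor_lift P \<phi> (\<tau> (pure_tensor k B M b (\<alpha> (pure_tensor k A M a m)))) =
    tensor_lift P \<phi> (tensor_lift (M \<boxtimes> B) (\<lambda>a1 b1. tensor_lift (M \<boxtimes> B)
        (\<lambda>m1 b2. pure_tensor k M B (\<alpha> (pure_tensor k A M a1 m1)) b2) (\<tau> (pure_tensor k B M b1 m)))
        (R (pure_tensor k B A b a)))"
    using ac b by (simp add: action_compatible_def)
  also have "\<dots> = tensor_lift P (\<lambda>a1 b1. tensor_lift P \<phi> (tensor_lift (M \<boxtimes> B)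
        (\<lambda>m1 b2. pure_tensor k M B (\<alpha> (pure_tensor k A M a1 m1)) b2) (\<tau> (pure_tensor k B M b1 m))))
        (R (pure_tensor k B A b a))"
    using b by - (assumption | rule tensor_lift_tensor_lift \<phi>_lin lin action_hyps)+
  also have "\<dots> = tensor_lift P (\<lambda>a1 b1. tensor_lift P
        (\<lambda>m1 b2. tensor_lift P \<phi> (pure_tensor k M B (\<alpha> (pure_tensor k A M a1 m1)) b2)) (\<tau> (pure_tensor k B M b1 m)))
        (R (pure_tensor k B A b a))"
    using b by - (assumption | rule tensor_lift_tensor_lift tensor_lift_cong \<phi>_lin lin action_hyps)+
  also have "\<dots> = tensor_lift P (\<lambda>a1 b1. tensor_lift P
      (\<lambda>m1 b2. \<phi> (\<alpha> (pure_tensor k A M a1 m1)) b2) (\<tau> (pure_tensor k B M b1 m)))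
      (R (pure_tensor k B A b a))"
    using b by - (assumption | rule tensor_lift_pure tensor_lift_cong \<phi>_lin lin action_hyps)+
  finally show ?thesis .
qed

end

end

text \<open>The hexagon under a sum with arbitrary trilinear summand. The module \<open>X\<close> is
  left open so that the hexagon of three algebras and the module hexagon are both instances.\<close>

lemma tensor_lift_hexagon:
  fixes k (structure)
  assumes mods: "module k X" "module k Y" "module k Z" "module k P"
    and f: "linear_map k (Y \<boxtimes> X) (X \<boxtimes> Y) f"
    and g: "linear_map k (Z \<boxtimes> Y) (Y \<boxtimes> Z) g"
    and h: "linear_map k (Z \<boxtimes> X) (X \<boxtimes> Z) h"
    and hex: "hexagon k X Y Z f g h"
    and \<phi>1: "\<And>x. x \<in> carrier X \<Longrightarrow> bilinear_map k Y Z P (\<phi> x)"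
    and \<phi>2: "\<And>y z. \<lbrakk>y \<in> carrier Y; z \<in> carrier Z\<rbrakk> \<Longrightarrow> linear_map k X P (\<lambda>x. \<phi> x y z)"
    and xyz: "x \<in> carrier X" "y \<in> carrier Y" "z \<in> carrier Z"
  shows "tensor_lift P (\<lambda>x1 y1. tensor_lift P (\<lambda>x2 z1. tensor_lift P (\<lambda>y2 z2. \<phi> x2 y2 z2)
        (g (pure_tensor k Z Y z1 y1))) (h (pure_tensor k Z X z x1))) (f (pure_tensor k Y X y x)) =
    tensor_lift P (\<lambda>y1 z1. tensor_lift P (\<lambda>x1 z2. tensor_lift P (\<lambda>x2 y2. \<phi> x2 y2 z2)
        (f (pure_tensor k Y X y1 x1))) (h (pure_tensor k Z X z1 x))) (g (pure_tensor k Z Y z y))"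
proof -
  note hyps = mods f g h linear_map_rules[OF f] linear_map_rules[OF g] linear_map_rules[OF h] xyz
  \<comment> \<open>Both sides of the hexagon end in \<open>X \<otimes> (Y \<otimes> Z)\<close>. The
    linear extension of the trilinear summand to this module is applied to the equation.\<close>
  define \<Phi> where "\<Phi> = tensor_lift P (\<lambda>x t. tensor_lift P (\<phi> x) t)"
  have bil: "bilinear_map k X (Y \<boxtimes> Z) P (\<lambda>x t. tensor_lift P (\<phi> x) t)"
    by (assumption | rule linear_tensor_lift \<phi>1 \<phi>2 lin hyps)+
  have \<Phi>: "linear_map k (X \<boxtimes> (Y \<boxtimes> Z)) P \<Phi>"
    unfolding \<Phi>_def by (assumption | rule linear_tensor_lift bil lin hyps)+
  have \<Phi>_pure: "\<Phi> (pure_tensor k X (Y \<boxtimes> Z) x (pure_tensor k Y Z y z)) = \<phi> x y z"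
    if "x \<in> carrier X" "y \<in> carrier Y" "z \<in> carrier Z" for x y z
  proof -
    have "\<Phi> (pure_tensor k X (Y \<boxtimes> Z) x (pure_tensor k Y Z y z)) = tensor_lift P (\<phi> x) (pure_tensor k Y Z y z)"
      unfolding \<Phi>_def using that by - (assumption | rule tensor_lift_pure[OF _ _ _ bil] lin mods)+
    also have "\<dots> = \<phi> x y z"
      using that by - (assumption | rule tensor_lift_pure \<phi>1 mods)+
    finally show ?thesis .
  qed
  \<comment> \<open>On one side the final bracketing is reached only by an \<open>assoc\<close>
    after \<open>cross_right\<close>. Absorbing it into the linear map lets the values of
    \<open>cross_right\<close> be summed directly.\<close>
  let ?K = "\<lambda>u. \<Phi> (assoc k X Y Z u)"
  have K: "linear_map k ((X \<boxtimes> Y) \<boxtimes> Z) P ?K"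
    by (rule linear_map_compose[OF \<Phi>] linear_assoc mods)+
  have K_pure: "?K (pure_tensor k (X \<boxtimes> Y) Z (pure_tensor k X Y x y) z) = \<phi> x y z"
    if "x \<in> carrier X" "y \<in> carrier Y" "z \<in> carrier Z" for x y z
    using that by (simp add: assoc_pure[OF mods(1-3)] \<Phi>_pure)
  let ?cr = "cross_right k X Y Z h g" and ?cl = "cross_left k X Y Z f h"
  let ?t = "pure_tensor k Z (Y \<boxtimes> X) z (pure_tensor k Y X y x)"
  note cr = linear_cross_right[OF mods(1-3) h g] and cl = linear_cross_left[OF mods(1-3) f h]

  have "tensor_map k Z (X \<boxtimes> Y) id f ?t = pure_tensor k Z (X \<boxtimes> Y) (id z) (f (pure_tensor k Y X y x))"
    by (assumption | rule tensor_map_pure lin hyps)+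
  then have "\<Phi> ((assoc k X Y Z \<circ> ?cr \<circ> tensor_map k Z (X \<boxtimes> Y) id f) ?t)
    = ?K (?cr (pure_tensor k Z (X \<boxtimes> Y) z (f (pure_tensor k Y X y x))))"
    by simp
  \<comment> \<open>The value of \<open>f\<close> is not pure, so it is expanded before
    \<open>cross_right\<close> can be evaluated.\<close>
  also have "\<dots> = tensor_lift P (\<lambda>x1 y1. ?K (?cr (pure_tensor k Z (X \<boxtimes> Y) z (pure_tensor k X Y x1 y1))))
      (f (pure_tensor k Y X y x))"
    by (rule linear_map_expand[where h = "\<lambda>s. ?K (?cr (pure_tensor k Z (X \<boxtimes> Y) z s))"]
      linear_map_compose[OF K] linear_map_compose[OF cr] lin hyps)+
  also have "\<dots> = tensor_lift P (\<lambda>x1 y1. ?K (tensor_lift ((X \<boxtimes> Y) \<boxtimes> Z) (\<lambda>x2 z1.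
      tensor_lift ((X \<boxtimes> Y) \<boxtimes> Z) (\<lambda>y2 z2. pure_tensor k (X \<boxtimes> Y) Z (pure_tensor k X Y x2 y2) z2)
        (g (pure_tensor k Z Y z1 y1))) (h (pure_tensor k Z X z x1))))
      (f (pure_tensor k Y X y x))"
    by (assumption | rule arg_cong[where f = "?K"] cross_right_pure tensor_lift_cong
      linear_map_compose[OF K] linear_map_compose[OF cr] lin hyps)+
  also have "\<dots> = tensor_lift P (\<lambda>x1 y1. tensor_lift P (\<lambda>x2 z1. ?K (
      tensor_lift ((X \<boxtimes> Y) \<boxtimes> Z) (\<lambda>y2 z2. pure_tensor k (X \<boxtimes> Y) Z (pure_tensor k X Y x2 y2) z2)
        (g (pure_tensor k Z Y z1 y1)))) (h (pure_tensor k Z X z x1)))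
      (f (pure_tensor k Y X y x))"
    by (assumption | rule linear_map_tensor_lift[OF _ K] tensor_lift_cong linear_map_compose[OF K] lin hyps)+
  also have "\<dots> = tensor_lift P (\<lambda>x1 y1. tensor_lift P (\<lambda>x2 z1.
      tensor_lift P (\<lambda>y2 z2. ?K (pure_tensor k (X \<boxtimes> Y) Z (pure_tensor k X Y x2 y2) z2))
        (g (pure_tensor k Z Y z1 y1))) (h (pure_tensor k Z X z x1)))
      (f (pure_tensor k Y X y x))"
    by (assumption | rule linear_map_tensor_lift[OF _ K] tensor_lift_cong linear_map_compose[OF K] lin hyps)+
  also have "\<dots> = tensor_lift P (\<lambda>x1 y1. tensor_lift P (\<lambda>x2 z1. tensor_lift P (\<lambda>y2 z2. \<phi> x2 y2 z2)
        (g (pure_tensor k Z Y z1 y1))) (h (pure_tensor k Z X z x1))) (f (pure_tensor k Y X y x))"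
    by (assumption | rule K_pure tensor_lift_cong linear_map_compose[OF K] lin hyps)+
  finally have lhs: "\<Phi> ((assoc k X Y Z \<circ> ?cr \<circ> tensor_map k Z (X \<boxtimes> Y) id f) ?t) = \<dots>" .

  have "assoc_inv k Z Y X ?t = pure_tensor k (Z \<boxtimes> Y) X (pure_tensor k Z Y z y) x"
    by (rule assoc_inv_pure hyps)+
  moreover have "tensor_map k (Y \<boxtimes> Z) X g id (pure_tensor k (Z \<boxtimes> Y) X (pure_tensor k Z Y z y) x)
    = pure_tensor k (Y \<boxtimes> Z) X (g (pure_tensor k Z Y z y)) (id x)"
    by (assumption | rule tensor_map_pure lin hyps)+
  ultimately have "\<Phi> ((?cl \<circ> tensor_map k (Y \<boxtimes> Z) X g id \<circ> assoc_inv k Z Y X) ?t)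
    = \<Phi> (?cl (pure_tensor k (Y \<boxtimes> Z) X (g (pure_tensor k Z Y z y)) x))"
    by simp
  also have "\<dots> = tensor_lift P (\<lambda>y1 z1. \<Phi> (?cl (pure_tensor k (Y \<boxtimes> Z) X (pure_tensor k Y Z y1 z1) x)))
      (g (pure_tensor k Z Y z y))"
    by (rule linear_map_expand[where h = "\<lambda>s. \<Phi> (?cl (pure_tensor k (Y \<boxtimes> Z) X s x))"]
      linear_map_compose[OF \<Phi>] linear_map_compose[OF cl] lin hyps)+
  also have "\<dots> = tensor_lift P (\<lambda>y1 z1. \<Phi> (tensor_lift (X \<boxtimes> (Y \<boxtimes> Z)) (\<lambda>x1 z2.
      tensor_lift (X \<boxtimes> (Y \<boxtimes> Z)) (\<lambda>x2 y2. pure_tensor k X (Y \<boxtimes> Z) x2 (pure_tensor k Y Z y2 z2))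
        (f (pure_tensor k Y X y1 x1))) (h (pure_tensor k Z X z1 x)))) (g (pure_tensor k Z Y z y))"
    by (assumption | rule arg_cong[where f = \<Phi>] cross_left_pure tensor_lift_cong
      linear_map_compose[OF \<Phi>] linear_map_compose[OF cl] lin hyps)+
  also have "\<dots> = tensor_lift P (\<lambda>y1 z1. tensor_lift P (\<lambda>x1 z2. \<Phi> (
      tensor_lift (X \<boxtimes> (Y \<boxtimes> Z)) (\<lambda>x2 y2. pure_tensor k X (Y \<boxtimes> Z) x2 (pure_tensor k Y Z y2 z2))
        (f (pure_tensor k Y X y1 x1)))) (h (pure_tensor k Z X z1 x))) (g (pure_tensor k Z Y z y))"
    by (assumption | rule linear_map_tensor_lift[OF _ \<Phi>] tensor_lift_cong linear_map_compose[OF \<Phi>] lin hyps)+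
  also have "\<dots> = tensor_lift P (\<lambda>y1 z1. tensor_lift P (\<lambda>x1 z2.
      tensor_lift P (\<lambda>x2 y2. \<Phi> (pure_tensor k X (Y \<boxtimes> Z) x2 (pure_tensor k Y Z y2 z2)))
        (f (pure_tensor k Y X y1 x1))) (h (pure_tensor k Z X z1 x))) (g (pure_tensor k Z Y z y))"
    by (assumption | rule linear_map_tensor_lift[OF _ \<Phi>] tensor_lift_cong linear_map_compose[OF \<Phi>] lin hyps)+
  also have "\<dots> = tensor_lift P (\<lambda>y1 z1. tensor_lift P (\<lambda>x1 z2. tensor_lift P (\<lambda>x2 y2. \<phi> x2 y2 z2)
        (f (pure_tensor k Y X y1 x1))) (h (pure_tensor k Z X z1 x))) (g (pure_tensor k Z Y z y))"
    by (assumption | rule \<Phi>_pure tensor_lift_cong linear_map_compose[OF \<Phi>] lin hyps)+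
  finally have rhs: "\<Phi> ((?cl \<circ> tensor_map k (Y \<boxtimes> Z) X g id \<circ> assoc_inv k Z Y X) ?t) = \<dots>" .

  have "?t \<in> carrier (Z \<boxtimes> (Y \<boxtimes> X))"
    by (rule lin hyps)+
  with hex have "(assoc k X Y Z \<circ> ?cr \<circ> tensor_map k Z (X \<boxtimes> Y) id f) ?t
    = (?cl \<circ> tensor_map k (Y \<boxtimes> Z) X g id \<circ> assoc_inv k Z Y X) ?t"
    unfolding hexagon_def by blast
  then show ?thesis using lhs rhs by simp
qed


section \<open>The twisted tensor product as an algebra\<close>

lemma twisted_tensor_simps [simp]:
  "carrier (twisted_tensor k A B R) = carrier (A \<boxtimes>\<^bsub>k\<^esub> B)"
  "ring.add (twisted_tensor k A B R) = ring.add (A \<boxtimes>\<^bsub>k\<^esub> B)"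
  "ring.zero (twisted_tensor k A B R) = ring.zero (A \<boxtimes>\<^bsub>k\<^esub> B)"
  "smult (twisted_tensor k A B R) = smult (A \<boxtimes>\<^bsub>k\<^esub> B)"
  "\<one>\<^bsub>twisted_tensor k A B R\<^esub> = pure_tensor k A B \<one>\<^bsub>A\<^esub> \<one>\<^bsub>B\<^esub>"
  by (simp_all add: twisted_tensor_def)

text \<open>A tensor product sees only carriers, addition and scalars of its factors. The twisted
  product changes none of these, so questions about it reduce to the plain tensor product wherever
  no multiplication is involved.\<close>

lemma tensor_twisted [simp]:
  "twisted_tensor k A B R \<boxtimes>\<^bsub>k\<^esub> X = (A \<boxtimes>\<^bsub>k\<^esub> B) \<boxtimes>\<^bsub>k\<^esub> X"
  "X \<boxtimes>\<^bsub>k\<^esub> twisted_tensor k A B R = X \<boxtimes>\<^bsub>k\<^esub> (A \<boxtimes>\<^bsub>k\<^esub> B)"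
  by (simp_all add: tensor_def[of k "twisted_tensor k A B R"] tensor_def[of k X "twisted_tensor k A B R"]
    tensor_def[of k "A \<boxtimes>\<^bsub>k\<^esub> B"] tensor_def[of k X "A \<boxtimes>\<^bsub>k\<^esub> B"] tensor_relations_def)

lemma pure_tensor_twisted [simp]:
  "pure_tensor k (twisted_tensor k A B R) X = pure_tensor k (A \<boxtimes>\<^bsub>k\<^esub> B) X"
  "pure_tensor k X (twisted_tensor k A B R) = pure_tensor k X (A \<boxtimes>\<^bsub>k\<^esub> B)"
  by (intro ext; simp add: pure_tensor_def tensor_relations_def)+

lemma module_twisted [simp]: "module k (twisted_tensor k A B R) \<longleftrightarrow> module k (A \<boxtimes>\<^bsub>k\<^esub> B)"
  by (simp add: module_def module_axioms_def abelian_group_def abelian_group_axioms_def abelian_monoid_def)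

lemma induced_action_twisted:
  "induced_action k (twisted_tensor k A B R) C M N = induced_action k (A \<boxtimes>\<^bsub>k\<^esub> B) C M N"
  "induced_action k A (twisted_tensor k B C R') M N = induced_action k A (B \<boxtimes>\<^bsub>k\<^esub> C) M N"
  by (intro ext; simp add: induced_action_def cross_middle_def assoc_def assoc_inv_def tensor_map_def)+

text \<open>This concerns the module slot only; in the algebra slot the product itself occurs in the
  condition.\<close>

lemma product_compatible_twisted [simp]:
  "product_compatible k C (twisted_tensor k A B R) \<tau> = product_compatible k C (A \<boxtimes>\<^bsub>k\<^esub> B) \<tau>"
  by (simp add: product_compatible_def)

text \<open>Every slot can be replaced here: the action is passed explicitly and no product
  occurs.\<close>

lemma action_compatible_twisted [simp]:
  "action_compatible k (twisted_tensor k A B R) C M T \<alpha> \<tau> = action_compatible k (A \<boxtimes>\<^bsub>k\<^esub> B) C M T \<alpha> \<tau>"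
  "action_compatible k A (twisted_tensor k B C R') M T' \<alpha>' \<tau>' = action_compatible k A (B \<boxtimes>\<^bsub>k\<^esub> C) M T' \<alpha>' \<tau>'"
  "action_compatible k D C (twisted_tensor k A B R) T'' \<alpha>'' \<tau>'' = action_compatible k D C (A \<boxtimes>\<^bsub>k\<^esub> B) T'' \<alpha>'' \<tau>''"
  by (simp_all add: action_compatible_def)

lemma twisted_mult:
  "s \<otimes>\<^bsub>twisted_tensor k A B R\<^esub> t =
    induced_action k A B A B R (product_map A) (product_map B) (pure_tensor k (A \<boxtimes>\<^bsub>k\<^esub> B) (A \<boxtimes>\<^bsub>k\<^esub> B) s t)"
  by (simp add: twisted_tensor_def induced_action_def)

section \<open>The product of the twisted tensor product\<close>

context
  fixes k :: "('k, 'r) ring_scheme" (structure) and A :: "('k, 'a, 'x) module_scheme"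
    and B :: "('k, 'b, 'y) module_scheme" and R :: "('b, 'a) tensor \<Rightarrow> ('a, 'b) tensor"
  assumes A: "assoc_algebra k A" and B: "assoc_algebra k B"
    and R: "linear_map k (B \<boxtimes> A) (A \<boxtimes> B) R"
begin

private lemmas AB_mods = assoc_algebra_module[OF A] assoc_algebra_module[OF B]

private lemmas twisted_hyps = A B AB_mods R linear_map_rules[OF R]

lemma linear_twisted_product:
  "linear_map k ((A \<boxtimes> B) \<boxtimes> (A \<boxtimes> B)) (A \<boxtimes> B)
    (induced_action k A B A B R (product_map A) (product_map B))"
  by (rule linear_induced_action twisted_hyps linear_product_map)+

lemma linear_twisted_mult_left:
  "\<lbrakk>linear_map k Z (A \<boxtimes> B) f; t \<in> carrier (A \<boxtimes> B)\<rbrakk>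
    \<Longrightarrow> linear_map k Z (A \<boxtimes> B) (\<lambda>z. f z \<otimes>\<^bsub>twisted_tensor k A B R\<^esub> t)"
  unfolding twisted_mult
  by (assumption | rule linear_map_compose[OF linear_twisted_product] lin twisted_hyps)+

lemma linear_twisted_mult_right:
  "\<lbrakk>linear_map k Z (A \<boxtimes> B) f; t \<in> carrier (A \<boxtimes> B)\<rbrakk>
    \<Longrightarrow> linear_map k Z (A \<boxtimes> B) (\<lambda>z. t \<otimes>\<^bsub>twisted_tensor k A B R\<^esub> f z)"
  unfolding twisted_mult
  by (assumption | rule linear_map_compose[OF linear_twisted_product] lin twisted_hyps)+

lemma twisted_mult_closed:
  "\<lbrakk>s \<in> carrier (A \<boxtimes> B); t \<in> carrier (A \<boxtimes> B)\<rbrakk>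
    \<Longrightarrow> s \<otimes>\<^bsub>twisted_tensor k A B R\<^esub> t \<in> carrier (A \<boxtimes> B)"
  unfolding twisted_mult
  by (assumption | rule linear_map_closed[OF linear_twisted_product] lin twisted_hyps)+

lemma twisted_mult_pure:
  assumes "a \<in> carrier A" "b \<in> carrier B" "a' \<in> carrier A" "b' \<in> carrier B"
  shows "pure_tensor k A B a b \<otimes>\<^bsub>twisted_tensor k A B R\<^esub> pure_tensor k A B a' b' =
    tensor_lift (A \<boxtimes> B) (\<lambda>a1 b1. pure_tensor k A B (a \<otimes>\<^bsub>A\<^esub> a1) (b1 \<otimes>\<^bsub>B\<^esub> b')) (R (pure_tensor k B A b a'))"
proof -
  note hyps' = assms linear_map_compose[OF linear_product_map[OF A]] linear_map_compose[OF linear_product_map[OF B]]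
    linear_map_closed[OF linear_product_map[OF A]] linear_map_closed[OF linear_product_map[OF B]]
  have "pure_tensor k A B a b \<otimes>\<^bsub>twisted_tensor k A B R\<^esub> pure_tensor k A B a' b' =
    tensor_lift (A \<boxtimes> B) (\<lambda>a1 b1. pure_tensor k A B (product_map A (pure_tensor k A A a a1))
      (product_map B (pure_tensor k B B b1 b'))) (R (pure_tensor k B A b a'))"
    unfolding twisted_mult by (rule induced_action_pure linear_product_map twisted_hyps assms)+
  also have "\<dots> = tensor_lift (A \<boxtimes> B) (\<lambda>a1 b1. pure_tensor k A B (a \<otimes>\<^bsub>A\<^esub> a1) (b1 \<otimes>\<^bsub>B\<^esub> b'))
      (R (pure_tensor k B A b a'))"
    by (assumption | rule arg_cong2[where f = "pure_tensor k A B"] product_map_pure tensor_lift_cong lin twisted_hyps hyps')+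
  finally show ?thesis .
qed

section \<open>Associativity of the induced action\<close>

context
  fixes M :: "('k, 'm, 'z) module_scheme" and N :: "('k, 'n, 's) module_scheme"
    and \<tau> :: "('b, 'm) tensor \<Rightarrow> ('m, 'b) tensor"
    and \<alpha> :: "('a, 'm) tensor \<Rightarrow> 'm" and \<beta> :: "('b, 'n) tensor \<Rightarrow> 'n"
  assumes M: "module k M" and N: "module k N"
    and \<tau>: "linear_map k (B \<boxtimes> M) (M \<boxtimes> B) \<tau>"
    and \<alpha>: "linear_map k (A \<boxtimes> M) M \<alpha>" and \<beta>: "linear_map k (B \<boxtimes> N) N \<beta>"
    and pc: "product_compatible k B M \<tau>" and ac: "action_compatible k A B M R \<alpha> \<tau>"
    and \<alpha>_assoc: "\<And>a a' x. \<lbrakk>a \<in> carrier A; a' \<in> carrier A; x \<in> carrier M\<rbrakk> \<Longrightarrow>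
      \<alpha> (pure_tensor k A M (a \<otimes>\<^bsub>A\<^esub> a') x) = \<alpha> (pure_tensor k A M a (\<alpha> (pure_tensor k A M a' x)))"
    and \<beta>_assoc: "\<And>b b' x. \<lbrakk>b \<in> carrier B; b' \<in> carrier B; x \<in> carrier N\<rbrakk> \<Longrightarrow>
      \<beta> (pure_tensor k B N (b \<otimes>\<^bsub>B\<^esub> b') x) = \<beta> (pure_tensor k B N b (\<beta> (pure_tensor k B N b' x)))"
begin

private lemmas mod_hyps = twisted_hyps M N \<tau> linear_map_rules[OF \<tau>]
  \<alpha> linear_map_rules[OF \<alpha>]
  \<beta> linear_map_rules[OF \<beta>]

text \<open>The product axiom splits the passage of \<open>b1 b'\<close> past \<open>m\<close>. Then
  the sums for \<open>R (b \<otimes> a')\<close> and \<open>\<tau> (b' \<otimes> m)\<close> are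
  independent; once they are interchanged, \<open>b\<close> passes first \<open>a'\<close> and then
  \<open>m1\<close>, and the action axiom read backwards turns this into its passage past
  \<open>a' m1\<close>. That is the action of \<open>a \<otimes> b\<close> on the result of
  \<open>a' \<otimes> b'\<close>.\<close>

private lemma induced_action_assoc_pure:
  assumes "a \<in> carrier A" "a' \<in> carrier A" "b \<in> carrier B" "b' \<in> carrier B" "m \<in> carrier M" "n \<in> carrier N"
  shows "induced_action k A B M N \<tau> \<alpha> \<beta> (pure_tensor k (A \<boxtimes> B) (M \<boxtimes> N)
      (pure_tensor k A B a b \<otimes>\<^bsub>twisted_tensor k A B R\<^esub> pure_tensor k A B a' b') (pure_tensor k M N m n)) =
    induced_action k A B M N \<tau> \<alpha> \<beta> (pure_tensor k (A \<boxtimes> B) (M \<boxtimes> N) (pure_tensor k A B a b)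
      (induced_action k A B M N \<tau> \<alpha> \<beta> (pure_tensor k (A \<boxtimes> B) (M \<boxtimes> N) (pure_tensor k A B a' b') (pure_tensor k M N m n))))"
proof -
  let ?act = "induced_action k A B M N \<tau> \<alpha> \<beta>" and ?abmn = "pure_tensor k (A \<boxtimes> B) (M \<boxtimes> N)"
    and ?mul = "mult (twisted_tensor k A B R)"
  let ?Q = "M \<boxtimes> N"
  let ?ab = "pure_tensor k A B" and ?mn = "pure_tensor k M N" and ?bm = "pure_tensor k B M"
    and ?ba = "pure_tensor k B A" and ?am = "pure_tensor k A M" and ?bn = "pure_tensor k B N"
  note act = linear_induced_action[OF AB_mods M N \<tau> \<alpha> \<beta>]
  note hyps' = assms linear_map_rules[OF act] mod_hyps
  have "?act (?abmn (?mul (?ab a b) (?ab a' b')) (?mn m n)) =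
    ?act (?abmn (tensor_lift (A \<boxtimes> B) (\<lambda>a1 b1. ?ab (a \<otimes>\<^bsub>A\<^esub> a1) (b1 \<otimes>\<^bsub>B\<^esub> b')) (R (?ba b a'))) (?mn m n))"
    using twisted_mult_pure[of a b a' b'] assms by simp
  also have "\<dots> = tensor_lift ?Q (\<lambda>a1 b1. ?act (?abmn (?ab (a \<otimes>\<^bsub>A\<^esub> a1) (b1 \<otimes>\<^bsub>B\<^esub> b')) (?mn m n))) (R (?ba b a'))"
    by (assumption | rule linear_map_tensor_lift[where h = "\<lambda>s. ?act (?abmn s (?mn m n))"] lin hyps')+
  also have "\<dots> = tensor_lift ?Q (\<lambda>a1 b1. tensor_lift ?Q (\<lambda>m1 b2. ?mn (\<alpha> (?am (a \<otimes>\<^bsub>A\<^esub> a1) m1)) (\<beta> (?bn b2 n)))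
      (\<tau> (?bm (b1 \<otimes>\<^bsub>B\<^esub> b') m))) (R (?ba b a'))"
    by (assumption | rule induced_action_pure tensor_lift_cong lin hyps')+
  also have "\<dots> = tensor_lift ?Q (\<lambda>a1 b1. tensor_lift ?Q (\<lambda>m1 b2. tensor_lift ?Q (\<lambda>m2 b3.
      ?mn (\<alpha> (?am (a \<otimes>\<^bsub>A\<^esub> a1) m2)) (\<beta> (?bn (b3 \<otimes>\<^bsub>B\<^esub> b2) n))) (\<tau> (?bm b1 m1)))
      (\<tau> (?bm b' m))) (R (?ba b a'))"
    by (assumption | rule tensor_lift_product_compatible[OF _ _ _ pc] tensor_lift_cong lin hyps')+
  also have "\<dots> = tensor_lift ?Q (\<lambda>m1 b2. tensor_lift ?Q (\<lambda>a1 b1. tensor_lift ?Q (\<lambda>m2 b3.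
      ?mn (\<alpha> (?am (a \<otimes>\<^bsub>A\<^esub> a1) m2)) (\<beta> (?bn (b3 \<otimes>\<^bsub>B\<^esub> b2) n))) (\<tau> (?bm b1 m1)))
      (R (?ba b a'))) (\<tau> (?bm b' m))"
    by (assumption | rule tensor_lift_commute lin hyps')+
  also have "\<dots> = tensor_lift ?Q (\<lambda>m1 b2. tensor_lift ?Q (\<lambda>a1 b1. tensor_lift ?Q (\<lambda>m2 b3.
      ?mn (\<alpha> (?am a (\<alpha> (?am a1 m2)))) (\<beta> (?bn b3 (\<beta> (?bn b2 n))))) (\<tau> (?bm b1 m1)))
      (R (?ba b a'))) (\<tau> (?bm b' m))"
    by (assumption | rule arg_cong2[where f = ?mn] \<alpha>_assoc \<beta>_assoc tensor_lift_cong lin hyps')+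
  also have "\<dots> = tensor_lift ?Q (\<lambda>m1 b2. tensor_lift ?Q (\<lambda>m2 b3.
      ?mn (\<alpha> (?am a m2)) (\<beta> (?bn b3 (\<beta> (?bn b2 n))))) (\<tau> (?bm b (\<alpha> (?am a' m1))))) (\<tau> (?bm b' m))"
    by (assumption | rule tensor_lift_action_compatible[OF _ _ _ _ _ _ ac, symmetric] tensor_lift_cong lin hyps')+
  also have "\<dots> = tensor_lift ?Q (\<lambda>m1 b2. ?act (?abmn (?ab a b) (?mn (\<alpha> (?am a' m1)) (\<beta> (?bn b2 n))))) (\<tau> (?bm b' m))"
    by (assumption | rule induced_action_pure[symmetric] tensor_lift_cong lin hyps')+
  also have "\<dots> = ?act (?abmn (?ab a b) (tensor_lift ?Q (\<lambda>m1 b2. ?mn (\<alpha> (?am a' m1)) (\<beta> (?bn b2 n))) (\<tau> (?bm b' m))))"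
    by (assumption | rule linear_map_tensor_lift[where h = "\<lambda>s. ?act (?abmn (?ab a b) s)", symmetric] lin hyps')+
  also have "\<dots> = ?act (?abmn (?ab a b) (?act (?abmn (?ab a' b') (?mn m n))))"
    using induced_action_pure[OF AB_mods M N \<tau> \<alpha> \<beta>, of a' b' m n] assms by simp
  finally show ?thesis .
qed

lemma induced_action_assoc:
  assumes s: "s \<in> carrier (A \<boxtimes> B)" and s': "s' \<in> carrier (A \<boxtimes> B)" and u: "u \<in> carrier (M \<boxtimes> N)"
  shows "induced_action k A B M N \<tau> \<alpha> \<beta> (pure_tensor k (A \<boxtimes> B) (M \<boxtimes> N)
      (s \<otimes>\<^bsub>twisted_tensor k A B R\<^esub> s') u) =
    induced_action k A B M N \<tau> \<alpha> \<beta> (pure_tensor k (A \<boxtimes> B) (M \<boxtimes> N) s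
      (induced_action k A B M N \<tau> \<alpha> \<beta> (pure_tensor k (A \<boxtimes> B) (M \<boxtimes> N) s' u)))"
proof -
  let ?act = "induced_action k A B M N \<tau> \<alpha> \<beta>" and ?abmn = "pure_tensor k (A \<boxtimes> B) (M \<boxtimes> N)"
    and ?mul = "mult (twisted_tensor k A B R)"
  note act = linear_induced_action[OF AB_mods M N \<tau> \<alpha> \<beta>]
  note hyps' = linear_map_rules[OF act] mod_hyps
    linear_twisted_mult_left linear_twisted_mult_right twisted_mult_closed
  show ?thesis
    apply (rule tensor_linear_cong[OF AB_mods _ _ _ _ s, where f = "\<lambda>s. ?act (?abmn (?mul s s') u)"
      and g = "\<lambda>s. ?act (?abmn s (?act (?abmn s' u)))"])
    apply (rule lin hyps' s' u)+
    subgoal for a b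
      apply (rule tensor_linear_cong[OF AB_mods _ _ _ _ s', where f = "\<lambda>s'. ?act (?abmn (?mul (pure_tensor k A B a b) s') u)"
      and g = "\<lambda>s'. ?act (?abmn (pure_tensor k A B a b) (?act (?abmn s' u)))"])
      apply (assumption | rule lin hyps' u)+
      subgoal for a' b'
        by (rule tensor_linear_cong[OF M N _ _ _ _ u, where f = "\<lambda>u. ?act (?abmn (?mul (pure_tensor k A B a b) (pure_tensor k A B a' b')) u)"
          and g = "\<lambda>u. ?act (?abmn (pure_tensor k A B a b) (?act (?abmn (pure_tensor k A B a' b') u)))"])
          (assumption | rule induced_action_assoc_pure lin hyps')+
      done
    done
qed

end

end


section \<open>Exchange maps past a tensor product\<close>

text \<open>Unfolds the composite exchange under a sum. The calculations below use it mostly from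
  right to left, to fold two successive exchanges back into the composite.\<close>

lemma tensor_lift_cross_right:
  fixes k (structure)
  assumes mods: "module k X" "module k Y" "module k Z" "module k P"
    and f: "linear_map k (Z \<boxtimes> X) (X \<boxtimes> Z) f" and g: "linear_map k (Z \<boxtimes> Y) (Y \<boxtimes> Z) g"
    and \<phi>: "bilinear_map k (X \<boxtimes> Y) Z P \<phi>"
    and xyz: "z \<in> carrier Z" "x \<in> carrier X" "y \<in> carrier Y"
  shows "tensor_lift P \<phi> (cross_right k X Y Z f g (pure_tensor k Z (X \<boxtimes> Y) z (pure_tensor k X Y x y))) =
    tensor_lift P (\<lambda>x1 z1. tensor_lift P (\<lambda>y1 z2. \<phi> (pure_tensor k X Y x1 y1) z2)
        (g (pure_tensor k Z Y z1 y))) (f (pure_tensor k Z X z x))"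
proof -
  note hyps = mods f g linear_map_rules[OF f] linear_map_rules[OF g] xyz
    \<phi> bilinear_map_compose_left[OF \<phi>] bilinear_map_compose_right[OF \<phi>]
  let ?pure = "\<lambda>x y z. pure_tensor k (X \<boxtimes> Y) Z (pure_tensor k X Y x y) z"
  have "tensor_lift P \<phi> (cross_right k X Y Z f g (pure_tensor k Z (X \<boxtimes> Y) z (pure_tensor k X Y x y))) =
    tensor_lift P \<phi> (tensor_lift ((X \<boxtimes> Y) \<boxtimes> Z) (\<lambda>x1 z1.
      tensor_lift ((X \<boxtimes> Y) \<boxtimes> Z) (\<lambda>y1 z2. ?pure x1 y1 z2) (g (pure_tensor k Z Y z1 y)))
      (f (pure_tensor k Z X z x)))"
    using cross_right_pure[OF mods(1-3) f g xyz] by simp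
  also have "\<dots> = tensor_lift P (\<lambda>x1 z1. tensor_lift P \<phi> (
      tensor_lift ((X \<boxtimes> Y) \<boxtimes> Z) (\<lambda>y1 z2. ?pure x1 y1 z2) (g (pure_tensor k Z Y z1 y))))
      (f (pure_tensor k Z X z x))"
    by (assumption | rule tensor_lift_tensor_lift lin hyps)+
  also have "\<dots> = tensor_lift P (\<lambda>x1 z1. tensor_lift P (\<lambda>y1 z2. tensor_lift P \<phi> (?pure x1 y1 z2))
      (g (pure_tensor k Z Y z1 y))) (f (pure_tensor k Z X z x))"
    by (assumption | rule tensor_lift_tensor_lift tensor_lift_cong lin hyps)+
  also have "\<dots> = tensor_lift P (\<lambda>x1 z1. tensor_lift P (\<lambda>y1 z2. \<phi> (pure_tensor k X Y x1 y1) z2)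
        (g (pure_tensor k Z Y z1 y))) (f (pure_tensor k Z X z x))"
    by (assumption | rule tensor_lift_pure tensor_lift_cong lin hyps)+
  finally show ?thesis .
qed

lemma tensor_lift_cross_left:
  fixes k (structure)
  assumes mods: "module k X" "module k Y" "module k Z" "module k P"
    and f: "linear_map k (Y \<boxtimes> X) (X \<boxtimes> Y) f" and g: "linear_map k (Z \<boxtimes> X) (X \<boxtimes> Z) g"
    and \<phi>: "bilinear_map k X (Y \<boxtimes> Z) P \<phi>"
    and xyz: "y \<in> carrier Y" "z \<in> carrier Z" "x \<in> carrier X"
  shows "tensor_lift P \<phi> (cross_left k X Y Z f g (pure_tensor k (Y \<boxtimes> Z) X (pure_tensor k Y Z y z) x)) =
    tensor_lift P (\<lambda>x1 z1. tensor_lift P (\<lambda>x2 y1. \<phi> x2 (pure_tensor k Y Z y1 z1))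
        (f (pure_tensor k Y X y x1))) (g (pure_tensor k Z X z x))"
proof -
  note hyps = mods f g linear_map_rules[OF f] linear_map_rules[OF g] xyz
    \<phi> bilinear_map_compose_left[OF \<phi>] bilinear_map_compose_right[OF \<phi>]
  let ?pure = "\<lambda>x y z. pure_tensor k X (Y \<boxtimes> Z) x (pure_tensor k Y Z y z)"
  have "tensor_lift P \<phi> (cross_left k X Y Z f g (pure_tensor k (Y \<boxtimes> Z) X (pure_tensor k Y Z y z) x)) =
    tensor_lift P \<phi> (tensor_lift (X \<boxtimes> (Y \<boxtimes> Z)) (\<lambda>x1 z1.
      tensor_lift (X \<boxtimes> (Y \<boxtimes> Z)) (\<lambda>x2 y1. ?pure x2 y1 z1) (f (pure_tensor k Y X y x1)))
      (g (pure_tensor k Z X z x)))"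
    using cross_left_pure[OF mods(1-3) f g xyz] by simp
  also have "\<dots> = tensor_lift P (\<lambda>x1 z1. tensor_lift P \<phi> (
      tensor_lift (X \<boxtimes> (Y \<boxtimes> Z)) (\<lambda>x2 y1. ?pure x2 y1 z1) (f (pure_tensor k Y X y x1))))
      (g (pure_tensor k Z X z x))"
    by (assumption | rule tensor_lift_tensor_lift lin hyps)+
  also have "\<dots> = tensor_lift P (\<lambda>x1 z1. tensor_lift P (\<lambda>x2 y1. tensor_lift P \<phi> (?pure x2 y1 z1))
      (f (pure_tensor k Y X y x1))) (g (pure_tensor k Z X z x))"
    by (assumption | rule tensor_lift_tensor_lift tensor_lift_cong lin hyps)+
  also have "\<dots> = tensor_lift P (\<lambda>x1 z1. tensor_lift P (\<lambda>x2 y1. \<phi> x2 (pure_tensor k Y Z y1 z1))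
        (f (pure_tensor k Y X y x1))) (g (pure_tensor k Z X z x))"
    by (assumption | rule tensor_lift_pure tensor_lift_cong lin hyps)+
  finally show ?thesis .
qed

text \<open>Splitting \<open>c c'\<close> at \<open>m\<close> and then at \<open>n\<close> gives the
  passages in the order \<open>c'\<close> past \<open>m\<close>, \<open>c\<close> past
  \<open>m\<close>, \<open>c'\<close> past \<open>n\<close>, \<open>c\<close> past \<open>n\<close>.
  Letting \<open>c'\<close> finish first only means interchanging the middle two, which involve
  disjoint factors.\<close>

lemma product_compatible_cross_right:
  fixes k (structure)
  assumes mods: "module k M" "module k N" and C: "assoc_algebra k C"
    and f: "linear_map k (C \<boxtimes> M) (M \<boxtimes> C) f" and g: "linear_map k (C \<boxtimes> N) (N \<boxtimes> C) g"
    and pf: "product_compatible k C M f" and pg: "product_compatible k C N g"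
  shows "product_compatible k C (M \<boxtimes> N) (cross_right k M N C f g)"
  unfolding product_compatible_def
proof (intro ballI)
  fix c c' u assume c: "c \<in> carrier C" "c' \<in> carrier C" and u: "u \<in> carrier (M \<boxtimes> N)"
  note Cm = assoc_algebra_module[OF C]
  let ?Q = "(M \<boxtimes> N) \<boxtimes> C" and ?\<sigma> = "cross_right k M N C f g"
  let ?Pu = "pure_tensor k (M \<boxtimes> N) C" and ?mn = "pure_tensor k M N" and ?cm = "pure_tensor k C M"
    and ?cn = "pure_tensor k C N" and ?cu = "pure_tensor k C (M \<boxtimes> N)"
  note \<sigma> = linear_cross_right[OF mods Cm f g]
  note hyps = mods C Cm c f g linear_map_rules[OF f] linear_map_rules[OF g] linear_map_rules[OF \<sigma>]
  have pure: "?\<sigma> (?cu (c \<otimes>\<^bsub>C\<^esub> c') (?mn m n)) = tensor_lift ?Q (\<lambda>u1 c1. tensor_lift ?Q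
      (\<lambda>u2 c2. ?Pu u2 (c2 \<otimes>\<^bsub>C\<^esub> c1)) (?\<sigma> (?cu c u1))) (?\<sigma> (?cu c' (?mn m n)))"
    if m: "m \<in> carrier M" and n: "n \<in> carrier N" for m n
  proof -
    note hyps' = hyps m n
    have "?\<sigma> (?cu (c \<otimes>\<^bsub>C\<^esub> c') (?mn m n)) =
      tensor_lift ?Q (\<lambda>m1 c1. tensor_lift ?Q (\<lambda>n1 c2. ?Pu (?mn m1 n1) c2) (g (?cn c1 n))) (f (?cm (c \<otimes>\<^bsub>C\<^esub> c') m))"
      by (rule cross_right_pure lin hyps')+
    also have "\<dots> = tensor_lift ?Q (\<lambda>m1 c1. tensor_lift ?Q (\<lambda>m2 c2. tensor_lift ?Q (\<lambda>n1 c3. ?Pu (?mn m2 n1) c3)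
        (g (?cn (c2 \<otimes>\<^bsub>C\<^esub> c1) n))) (f (?cm c m1))) (f (?cm c' m))"
      by (assumption | rule tensor_lift_product_compatible[OF _ _ _ pf] lin hyps')+
    also have "\<dots> = tensor_lift ?Q (\<lambda>m1 c1. tensor_lift ?Q (\<lambda>m2 c2. tensor_lift ?Q (\<lambda>n1 c3.
        tensor_lift ?Q (\<lambda>n2 c4. ?Pu (?mn m2 n2) (c4 \<otimes>\<^bsub>C\<^esub> c3)) (g (?cn c2 n1))) (g (?cn c1 n)))
        (f (?cm c m1))) (f (?cm c' m))"
      by (assumption | rule tensor_lift_product_compatible[OF _ _ _ pg] tensor_lift_cong lin hyps')+
    \<comment> \<open>The passage of \<open>c\<close> past \<open>m1\<close> and that of
      \<open>c1\<close> past \<open>n\<close> change places, inside the sum that produces both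
      \<open>m1\<close> and \<open>c1\<close>.\<close>
    also have "\<dots> = tensor_lift ?Q (\<lambda>m1 c1. tensor_lift ?Q (\<lambda>n1 c3. tensor_lift ?Q (\<lambda>m2 c2.
        tensor_lift ?Q (\<lambda>n2 c4. ?Pu (?mn m2 n2) (c4 \<otimes>\<^bsub>C\<^esub> c3)) (g (?cn c2 n1))) (f (?cm c m1)))
        (g (?cn c1 n))) (f (?cm c' m))"
      by (rule tensor_lift_cong) (assumption | rule tensor_lift_commute lin hyps')+
    also have "\<dots> = tensor_lift ?Q (\<lambda>m1 c1. tensor_lift ?Q (\<lambda>n1 c3. tensor_lift ?Q
        (\<lambda>u2 c2. ?Pu u2 (c2 \<otimes>\<^bsub>C\<^esub> c3)) (?\<sigma> (?cu c (?mn m1 n1)))) (g (?cn c1 n))) (f (?cm c' m))"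
      by (assumption | rule tensor_lift_cross_right[symmetric] tensor_lift_cong lin hyps')+
    also have "\<dots> = tensor_lift ?Q (\<lambda>u1 c1. tensor_lift ?Q
        (\<lambda>u2 c2. ?Pu u2 (c2 \<otimes>\<^bsub>C\<^esub> c1)) (?\<sigma> (?cu c u1))) (?\<sigma> (?cu c' (?mn m n)))"
      by (assumption | rule tensor_lift_cross_right[symmetric] lin hyps')+
    finally show ?thesis .
  qed
  show "?\<sigma> (?cu (c \<otimes>\<^bsub>C\<^esub> c') u) = tensor_lift ?Q (\<lambda>u1 c1. tensor_lift ?Q
      (\<lambda>u2 c2. ?Pu u2 (c2 \<otimes>\<^bsub>C\<^esub> c1)) (?\<sigma> (?cu c u1))) (?\<sigma> (?cu c' u))"
    by (rule tensor_linear_cong[OF mods _ _ _ _ u, where f = "\<lambda>u. ?\<sigma> (?cu (c \<otimes>\<^bsub>C\<^esub> c') u)"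
        and g = "\<lambda>u. tensor_lift ?Q (\<lambda>u1 c1. tensor_lift ?Q
          (\<lambda>u2 c2. ?Pu u2 (c2 \<otimes>\<^bsub>C\<^esub> c1)) (?\<sigma> (?cu c u1))) (?\<sigma> (?cu c' u))"])
      (assumption | rule pure lin hyps)+
qed

text \<open>On the left side \<open>b\<close> passes \<open>m\<close> before \<open>c\<close>
  arrives; on the right side \<open>c\<close> passes \<open>b\<close> and \<open>m\<close> before
  they are exchanged. The hexagon for \<open>M\<close>, \<open>B\<close>, \<open>C\<close> is
  exactly the equality of these two orders, and the action axioms bring the calculation to the point
  where it applies.\<close>

lemma action_compatible_cross_right:
  fixes k (structure)
  assumes A: "module k A" and B: "module k B" and C: "assoc_algebra k C" and M: "module k M" and N: "module k N"
    and R2: "linear_map k (C \<boxtimes> B) (B \<boxtimes> C) R2"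
    and R3: "linear_map k (C \<boxtimes> A) (A \<boxtimes> C) R3"
    and \<tau>: "linear_map k (B \<boxtimes> M) (M \<boxtimes> B) \<tau>"
    and f: "linear_map k (C \<boxtimes> M) (M \<boxtimes> C) f" and g: "linear_map k (C \<boxtimes> N) (N \<boxtimes> C) g"
    and \<alpha>: "linear_map k (A \<boxtimes> M) M \<alpha>" and \<beta>: "linear_map k (B \<boxtimes> N) N \<beta>"
    and af: "action_compatible k A C M R3 \<alpha> f" and ag: "action_compatible k B C N R2 \<beta> g"
    and hex: "hexagon k M B C \<tau> R2 f"
  shows "action_compatible k (A \<boxtimes> B) C (M \<boxtimes> N) (cross_right k A B C R3 R2)
    (induced_action k A B M N \<tau> \<alpha> \<beta>) (cross_right k M N C f g)"
  unfolding action_compatible_def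
proof (intro ballI)
  fix c s u assume c: "c \<in> carrier C" and s: "s \<in> carrier (A \<boxtimes> B)" and u: "u \<in> carrier (M \<boxtimes> N)"
  let ?Q = "(M \<boxtimes> N) \<boxtimes> C" and ?\<sigma> = "cross_right k M N C f g" and ?T = "cross_right k A B C R3 R2"
    and ?act = "induced_action k A B M N \<tau> \<alpha> \<beta>"
  let ?Pu = "pure_tensor k (M \<boxtimes> N) C" and ?mn = "pure_tensor k M N" and ?cm = "pure_tensor k C M"
    and ?cn = "pure_tensor k C N" and ?cu = "pure_tensor k C (M \<boxtimes> N)" and ?ab = "pure_tensor k A B"
    and ?abmn = "pure_tensor k (A \<boxtimes> B) (M \<boxtimes> N)" and ?cs = "pure_tensor k C (A \<boxtimes> B)"
    and ?am = "pure_tensor k A M" and ?bn = "pure_tensor k B N" and ?bm = "pure_tensor k B M"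
    and ?ca = "pure_tensor k C A" and ?cb = "pure_tensor k C B"
  note Cm = assoc_algebra_module[OF C]
  note \<sigma> = linear_cross_right[OF M N Cm f g] and T = linear_cross_right[OF A B Cm R3 R2]
    and act = linear_induced_action[OF A B M N \<tau> \<alpha> \<beta>]
  note hyps = A B C Cm M N c R2 R3 \<tau> f g \<alpha> \<beta> \<sigma> T act
    linear_map_rules[OF R2] linear_map_rules[OF R3] linear_map_rules[OF \<tau>]
    linear_map_rules[OF f] linear_map_rules[OF g] linear_map_rules[OF \<alpha>] linear_map_rules[OF \<beta>]
    linear_map_rules[OF \<sigma>] linear_map_rules[OF T] linear_map_rules[OF act]
  have pure: "?\<sigma> (?cu c (?act (?abmn (?ab a b) (?mn m n)))) = tensor_lift ?Q (\<lambda>s1 c1. tensor_lift ?Q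
      (\<lambda>u1 c2. ?Pu (?act (?abmn s1 u1)) c2) (?\<sigma> (?cu c1 (?mn m n)))) (?T (?cs c (?ab a b)))"
    if a: "a \<in> carrier A" and b: "b \<in> carrier B" and m: "m \<in> carrier M" and n: "n \<in> carrier N" for a b m n
  proof -
    note hyps' = hyps a b m n
    have "?\<sigma> (?cu c (?act (?abmn (?ab a b) (?mn m n)))) =
      ?\<sigma> (?cu c (tensor_lift (M \<boxtimes> N) (\<lambda>m1 b1. ?mn (\<alpha> (?am a m1)) (\<beta> (?bn b1 n))) (\<tau> (?bm b m))))"
      by (simp add: induced_action_pure[OF A B M N \<tau> \<alpha> \<beta> a b m n])
    also have "\<dots> = tensor_lift ?Q (\<lambda>m1 b1. ?\<sigma> (?cu c (?mn (\<alpha> (?am a m1)) (\<beta> (?bn b1 n))))) (\<tau> (?bm b m))"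
      by (assumption | rule linear_map_tensor_lift[where h = "\<lambda>s. ?\<sigma> (?cu c s)"] lin hyps')+
    also have "\<dots> = tensor_lift ?Q (\<lambda>m1 b1. tensor_lift ?Q (\<lambda>x c1. tensor_lift ?Q (\<lambda>y c2. ?Pu (?mn x y) c2)
        (g (?cn c1 (\<beta> (?bn b1 n))))) (f (?cm c (\<alpha> (?am a m1))))) (\<tau> (?bm b m))"
      by (assumption | rule cross_right_pure tensor_lift_cong lin hyps')+
    also have "\<dots> = tensor_lift ?Q (\<lambda>m1 b1. tensor_lift ?Q (\<lambda>a1 c1. tensor_lift ?Q (\<lambda>m2 c2.
        tensor_lift ?Q (\<lambda>y c3. ?Pu (?mn (\<alpha> (?am a1 m2)) y) c3)
        (g (?cn c2 (\<beta> (?bn b1 n))))) (f (?cm c1 m1))) (R3 (?ca c a))) (\<tau> (?bm b m))"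
      by (assumption | rule tensor_lift_action_compatible[OF _ _ _ _ _ _ af] tensor_lift_cong lin hyps')+
    also have "\<dots> = tensor_lift ?Q (\<lambda>m1 b1. tensor_lift ?Q (\<lambda>a1 c1. tensor_lift ?Q (\<lambda>m2 c2.
        tensor_lift ?Q (\<lambda>b2 c3. tensor_lift ?Q (\<lambda>n1 c4. ?Pu (?mn (\<alpha> (?am a1 m2)) (\<beta> (?bn b2 n1))) c4)
        (g (?cn c3 n))) (R2 (?cb c2 b1))) (f (?cm c1 m1))) (R3 (?ca c a))) (\<tau> (?bm b m))"
      by (assumption | rule tensor_lift_action_compatible[OF _ _ _ _ _ _ ag] tensor_lift_cong lin hyps')+
    \<comment> \<open>The passage of \<open>c\<close> past \<open>a\<close> is moved to the outside,
      so that the three exchanges among \<open>c1\<close>, \<open>b\<close> and \<open>m\<close> are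
      adjacent, as the hexagon requires.\<close>
    also have "\<dots> = tensor_lift ?Q (\<lambda>a1 c1. tensor_lift ?Q (\<lambda>m1 b1. tensor_lift ?Q (\<lambda>m2 c2.
        tensor_lift ?Q (\<lambda>b2 c3. tensor_lift ?Q (\<lambda>n1 c4. ?Pu (?mn (\<alpha> (?am a1 m2)) (\<beta> (?bn b2 n1))) c4)
        (g (?cn c3 n))) (R2 (?cb c2 b1))) (f (?cm c1 m1))) (\<tau> (?bm b m))) (R3 (?ca c a))"
      by (assumption | rule tensor_lift_commute lin hyps')+
    also have "\<dots> = tensor_lift ?Q (\<lambda>a1 c1. tensor_lift ?Q (\<lambda>b1 c2. tensor_lift ?Q (\<lambda>m1 c3.
        tensor_lift ?Q (\<lambda>m2 b2. tensor_lift ?Q (\<lambda>n1 c4. ?Pu (?mn (\<alpha> (?am a1 m2)) (\<beta> (?bn b2 n1))) c4)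
        (g (?cn c3 n))) (\<tau> (?bm b1 m1))) (f (?cm c2 m))) (R2 (?cb c1 b))) (R3 (?ca c a))"
      by (assumption | rule tensor_lift_hexagon[OF _ _ _ _ _ _ _ hex] tensor_lift_cong lin hyps')+
    \<comment> \<open>The exchange \<open>\<tau> (b1 \<otimes> m1)\<close> becomes the innermost
      sum, where with the two actions it forms the action of \<open>a1 \<otimes> b1\<close> on
      \<open>m1 \<otimes> n1\<close>. The congruence descends as long as both sides sum over the
      same tensor, that is, down to the interchanged pair.\<close>
    also have "\<dots> = tensor_lift ?Q (\<lambda>a1 c1. tensor_lift ?Q (\<lambda>b1 c2. tensor_lift ?Q (\<lambda>m1 c3.
        tensor_lift ?Q (\<lambda>n1 c4. tensor_lift ?Q (\<lambda>m2 b2. ?Pu (?mn (\<alpha> (?am a1 m2)) (\<beta> (?bn b2 n1))) c4)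
        (\<tau> (?bm b1 m1))) (g (?cn c3 n))) (f (?cm c2 m))) (R2 (?cb c1 b))) (R3 (?ca c a))"
      by (rule tensor_lift_cong, (assumption | rule lin hyps')+)+
        (assumption | rule tensor_lift_commute lin hyps')+
    also have "\<dots> = tensor_lift ?Q (\<lambda>a1 c1. tensor_lift ?Q (\<lambda>b1 c2. tensor_lift ?Q (\<lambda>m1 c3.
        tensor_lift ?Q (\<lambda>n1 c4. ?Pu (tensor_lift (M \<boxtimes> N) (\<lambda>m2 b2. ?mn (\<alpha> (?am a1 m2)) (\<beta> (?bn b2 n1)))
        (\<tau> (?bm b1 m1))) c4) (g (?cn c3 n))) (f (?cm c2 m))) (R2 (?cb c1 b))) (R3 (?ca c a))"
      by (assumption | rule linear_map_tensor_lift[where h = "\<lambda>s. ?Pu s _", symmetric] tensor_lift_cong lin hyps')+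
    also have "\<dots> = tensor_lift ?Q (\<lambda>a1 c1. tensor_lift ?Q (\<lambda>b1 c2. tensor_lift ?Q (\<lambda>m1 c3.
        tensor_lift ?Q (\<lambda>n1 c4. ?Pu (?act (?abmn (?ab a1 b1) (?mn m1 n1))) c4)
        (g (?cn c3 n))) (f (?cm c2 m))) (R2 (?cb c1 b))) (R3 (?ca c a))"
      by (assumption | rule arg_cong2[where f = ?Pu, OF _ refl] induced_action_pure[symmetric] tensor_lift_cong lin hyps')+
    also have "\<dots> = tensor_lift ?Q (\<lambda>a1 c1. tensor_lift ?Q (\<lambda>b1 c2. tensor_lift ?Q
        (\<lambda>u1 c3. ?Pu (?act (?abmn (?ab a1 b1) u1)) c3) (?\<sigma> (?cu c2 (?mn m n)))) (R2 (?cb c1 b))) (R3 (?ca c a))"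
      by (assumption | rule tensor_lift_cross_right[symmetric] tensor_lift_cong lin hyps')+
    also have "\<dots> = tensor_lift ?Q (\<lambda>s1 c1. tensor_lift ?Q
      (\<lambda>u1 c2. ?Pu (?act (?abmn s1 u1)) c2) (?\<sigma> (?cu c1 (?mn m n)))) (?T (?cs c (?ab a b)))"
      by (assumption | rule tensor_lift_cross_right[symmetric] lin hyps')+
    finally show ?thesis .
  qed
  have pure': "?\<sigma> (?cu c (?act (?abmn (?ab a b) u))) = tensor_lift ?Q (\<lambda>s1 c1. tensor_lift ?Q
      (\<lambda>u1 c2. ?Pu (?act (?abmn s1 u1)) c2) (?\<sigma> (?cu c1 u))) (?T (?cs c (?ab a b)))"
    if a: "a \<in> carrier A" and b: "b \<in> carrier B" for a b
    by (rule tensor_linear_cong[OF M N _ _ _ _ u, where f = "\<lambda>u. ?\<sigma> (?cu c (?act (?abmn (?ab a b) u)))"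
        and g = "\<lambda>u. tensor_lift ?Q (\<lambda>s1 c1. tensor_lift ?Q
          (\<lambda>u1 c2. ?Pu (?act (?abmn s1 u1)) c2) (?\<sigma> (?cu c1 u))) (?T (?cs c (?ab a b)))"])
      (assumption | rule pure lin hyps a b)+
  show "?\<sigma> (?cu c (?act (?abmn s u))) = tensor_lift ?Q (\<lambda>s1 c1. tensor_lift ?Q
      (\<lambda>u1 c2. ?Pu (?act (?abmn s1 u1)) c2) (?\<sigma> (?cu c1 u))) (?T (?cs c s))"
    by (rule tensor_linear_cong[OF A B _ _ _ _ s, where f = "\<lambda>s. ?\<sigma> (?cu c (?act (?abmn s u)))"
        and g = "\<lambda>s. tensor_lift ?Q (\<lambda>s1 c1. tensor_lift ?Q
          (\<lambda>u1 c2. ?Pu (?act (?abmn s1 u1)) c2) (?\<sigma> (?cu c1 u))) (?T (?cs c s))"])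
      (assumption | rule pure' lin hyps u)+
qed

text \<open>Multiplying \<open>b \<otimes> c\<close> and \<open>b' \<otimes> c'\<close> exchanges
  \<open>c\<close> with \<open>b'\<close> before both pass \<open>m\<close>; on the other side each
  pair passes \<open>m\<close> as a whole and the exchange comes afterwards. The hexagon, read from
  right to left, moves the exchange behind the passages.\<close>

lemma product_compatible_cross_left:
  fixes k (structure)
  assumes M: "module k M" and B: "assoc_algebra k B" and C: "assoc_algebra k C"
    and R: "linear_map k (C \<boxtimes> B) (B \<boxtimes> C) R"
    and f: "linear_map k (B \<boxtimes> M) (M \<boxtimes> B) f" and g: "linear_map k (C \<boxtimes> M) (M \<boxtimes> C) g"
    and pf: "product_compatible k B M f" and pg: "product_compatible k C M g"
    and hex: "hexagon k M B C f R g"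
  shows "product_compatible k (twisted_tensor k B C R) M (cross_left k M B C f g)"
  unfolding product_compatible_def twisted_tensor_simps tensor_twisted pure_tensor_twisted
proof (intro ballI)
  fix s s' m assume s: "s \<in> carrier (B \<boxtimes> C)" and s': "s' \<in> carrier (B \<boxtimes> C)" and m: "m \<in> carrier M"
  note Bm = assoc_algebra_module[OF B] and Cm = assoc_algebra_module[OF C]
  let ?Q = "M \<boxtimes> (B \<boxtimes> C)" and ?\<sigma> = "cross_left k M B C f g" and ?mul = "mult (twisted_tensor k B C R)"
  let ?Pr = "pure_tensor k M (B \<boxtimes> C)" and ?bc = "pure_tensor k B C" and ?cm = "pure_tensor k C M"
    and ?bm = "pure_tensor k B M" and ?cb = "pure_tensor k C B" and ?sm = "pure_tensor k (B \<boxtimes> C) M"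
  note \<sigma> = linear_cross_left[OF M Bm Cm f g]
  note hyps = M B C Bm Cm m R f g \<sigma> linear_map_rules[OF R] linear_map_rules[OF f] linear_map_rules[OF g]
    linear_map_rules[OF \<sigma>]
    linear_twisted_mult_left[OF B C R] linear_twisted_mult_right[OF B C R] twisted_mult_closed[OF B C R]
  have pure: "?\<sigma> (?sm (?mul (?bc b c) (?bc b' c')) m) = tensor_lift ?Q (\<lambda>m1 t1. tensor_lift ?Q
      (\<lambda>m2 t2. ?Pr m2 (?mul t2 t1)) (?\<sigma> (?sm (?bc b c) m1))) (?\<sigma> (?sm (?bc b' c') m))"
    if b: "b \<in> carrier B" and c: "c \<in> carrier C" and b': "b' \<in> carrier B" and c': "c' \<in> carrier C" for b c b' c'
  proof -
    note hyps' = hyps b c b' c'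
    have "?\<sigma> (?sm (?mul (?bc b c) (?bc b' c')) m) =
      ?\<sigma> (?sm (tensor_lift (B \<boxtimes> C) (\<lambda>b1 c1. ?bc (b \<otimes>\<^bsub>B\<^esub> b1) (c1 \<otimes>\<^bsub>C\<^esub> c')) (R (?cb c b'))) m)"
      by (simp add: twisted_mult_pure[OF B C R b c b' c'])
    also have "\<dots> = tensor_lift ?Q (\<lambda>b1 c1. ?\<sigma> (?sm (?bc (b \<otimes>\<^bsub>B\<^esub> b1) (c1 \<otimes>\<^bsub>C\<^esub> c')) m)) (R (?cb c b'))"
      by (assumption | rule linear_map_tensor_lift[where h = "\<lambda>s. ?\<sigma> (?sm s m)"] lin hyps')+
    also have "\<dots> = tensor_lift ?Q (\<lambda>b1 c1. tensor_lift ?Q (\<lambda>m1 d. tensor_lift ?Q (\<lambda>m2 e. ?Pr m2 (?bc e d))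
        (f (?bm (b \<otimes>\<^bsub>B\<^esub> b1) m1))) (g (?cm (c1 \<otimes>\<^bsub>C\<^esub> c') m))) (R (?cb c b'))"
      by (assumption | rule cross_left_pure tensor_lift_cong lin hyps')+
    also have "\<dots> = tensor_lift ?Q (\<lambda>b1 c1. tensor_lift ?Q (\<lambda>m1 c2. tensor_lift ?Q (\<lambda>m2 c3.
        tensor_lift ?Q (\<lambda>m3 e. ?Pr m3 (?bc e (c3 \<otimes>\<^bsub>C\<^esub> c2)))
        (f (?bm (b \<otimes>\<^bsub>B\<^esub> b1) m2))) (g (?cm c1 m1))) (g (?cm c' m))) (R (?cb c b'))"
      by (assumption | rule tensor_lift_product_compatible[OF _ _ _ pg] tensor_lift_cong lin hyps')+
    also have "\<dots> = tensor_lift ?Q (\<lambda>b1 c1. tensor_lift ?Q (\<lambda>m1 c2. tensor_lift ?Q (\<lambda>m2 c3.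
        tensor_lift ?Q (\<lambda>m3 b2. tensor_lift ?Q (\<lambda>m4 b3. ?Pr m4 (?bc (b3 \<otimes>\<^bsub>B\<^esub> b2) (c3 \<otimes>\<^bsub>C\<^esub> c2)))
        (f (?bm b m3))) (f (?bm b1 m2))) (g (?cm c1 m1))) (g (?cm c' m))) (R (?cb c b'))"
      by (assumption | rule tensor_lift_product_compatible[OF _ _ _ pf] tensor_lift_cong lin hyps')+
    \<comment> \<open>The factor \<open>c'\<close> passes \<open>m\<close> before all others and
      takes no part in the exchange, so its sum moves outside and leaves the hexagon configuration
      adjacent.\<close>
    also have "\<dots> = tensor_lift ?Q (\<lambda>m1 c2. tensor_lift ?Q (\<lambda>b1 c1. tensor_lift ?Q (\<lambda>m2 c3.
        tensor_lift ?Q (\<lambda>m3 b2. tensor_lift ?Q (\<lambda>m4 b3. ?Pr m4 (?bc (b3 \<otimes>\<^bsub>B\<^esub> b2) (c3 \<otimes>\<^bsub>C\<^esub> c2)))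
        (f (?bm b m3))) (f (?bm b1 m2))) (g (?cm c1 m1))) (R (?cb c b'))) (g (?cm c' m))"
      by (assumption | rule tensor_lift_commute lin hyps')+
    also have "\<dots> = tensor_lift ?Q (\<lambda>m1 c2. tensor_lift ?Q (\<lambda>m2 b1. tensor_lift ?Q (\<lambda>m3 c3.
        tensor_lift ?Q (\<lambda>b2 c4. tensor_lift ?Q (\<lambda>m4 b3. ?Pr m4 (?bc (b3 \<otimes>\<^bsub>B\<^esub> b2) (c4 \<otimes>\<^bsub>C\<^esub> c2)))
        (f (?bm b m3))) (R (?cb c3 b1))) (g (?cm c m2))) (f (?bm b' m1))) (g (?cm c' m))"
      by (assumption | rule tensor_lift_hexagon[OF _ _ _ _ _ _ _ hex, symmetric] tensor_lift_cong lin hyps')+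
    \<comment> \<open>The exchange of \<open>c3\<close> with \<open>b1\<close> moves inside the
      passage of \<open>b\<close>, where it is the sum defining the product of
      \<open>b3 \<otimes> c3\<close> and \<open>b1 \<otimes> c2\<close>.\<close>
    also have "\<dots> = tensor_lift ?Q (\<lambda>m1 c2. tensor_lift ?Q (\<lambda>m2 b1. tensor_lift ?Q (\<lambda>m3 c3.
        tensor_lift ?Q (\<lambda>m4 b3. tensor_lift ?Q (\<lambda>b2 c4. ?Pr m4 (?bc (b3 \<otimes>\<^bsub>B\<^esub> b2) (c4 \<otimes>\<^bsub>C\<^esub> c2)))
        (R (?cb c3 b1))) (f (?bm b m3))) (g (?cm c m2))) (f (?bm b' m1))) (g (?cm c' m))"
      by (rule tensor_lift_cong, (assumption | rule lin hyps')+)+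
        (assumption | rule tensor_lift_commute lin hyps')+
    also have "\<dots> = tensor_lift ?Q (\<lambda>m1 c2. tensor_lift ?Q (\<lambda>m2 b1. tensor_lift ?Q (\<lambda>m3 c3.
        tensor_lift ?Q (\<lambda>m4 b3. ?Pr m4 (tensor_lift (B \<boxtimes> C) (\<lambda>b2 c4. ?bc (b3 \<otimes>\<^bsub>B\<^esub> b2) (c4 \<otimes>\<^bsub>C\<^esub> c2))
        (R (?cb c3 b1)))) (f (?bm b m3))) (g (?cm c m2))) (f (?bm b' m1))) (g (?cm c' m))"
      by (assumption | rule linear_map_tensor_lift[where h = "?Pr _", symmetric] tensor_lift_cong lin hyps')+
    also have "\<dots> = tensor_lift ?Q (\<lambda>m1 c2. tensor_lift ?Q (\<lambda>m2 b1. tensor_lift ?Q (\<lambda>m3 c3.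
        tensor_lift ?Q (\<lambda>m4 b3. ?Pr m4 (?mul (?bc b3 c3) (?bc b1 c2)))
        (f (?bm b m3))) (g (?cm c m2))) (f (?bm b' m1))) (g (?cm c' m))"
      by (assumption | rule arg_cong[where f = "?Pr _"] twisted_mult_pure[OF B C R, symmetric] tensor_lift_cong lin hyps')+
    also have "\<dots> = tensor_lift ?Q (\<lambda>m1 c2. tensor_lift ?Q (\<lambda>m2 b1. tensor_lift ?Q
        (\<lambda>m2 t2. ?Pr m2 (?mul t2 (?bc b1 c2))) (?\<sigma> (?sm (?bc b c) m2))) (f (?bm b' m1))) (g (?cm c' m))"
      by (assumption | rule tensor_lift_cross_left[symmetric] tensor_lift_cong lin hyps')+
    also have "\<dots> = tensor_lift ?Q (\<lambda>m1 t1. tensor_lift ?Q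
      (\<lambda>m2 t2. ?Pr m2 (?mul t2 t1)) (?\<sigma> (?sm (?bc b c) m1))) (?\<sigma> (?sm (?bc b' c') m))"
      by (assumption | rule tensor_lift_cross_left[symmetric] lin hyps')+
    finally show ?thesis .
  qed
  have pure': "?\<sigma> (?sm (?mul (?bc b c) s') m) = tensor_lift ?Q (\<lambda>m1 t1. tensor_lift ?Q
      (\<lambda>m2 t2. ?Pr m2 (?mul t2 t1)) (?\<sigma> (?sm (?bc b c) m1))) (?\<sigma> (?sm s' m))"
    if b: "b \<in> carrier B" and c: "c \<in> carrier C" for b c
    by (rule tensor_linear_cong[OF Bm Cm _ _ _ _ s', where f = "\<lambda>s'. ?\<sigma> (?sm (?mul (?bc b c) s') m)"
        and g = "\<lambda>s'. tensor_lift ?Q (\<lambda>m1 t1. tensor_lift ?Q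
          (\<lambda>m2 t2. ?Pr m2 (?mul t2 t1)) (?\<sigma> (?sm (?bc b c) m1))) (?\<sigma> (?sm s' m))"])
      (assumption | rule pure lin hyps b c)+
  show "?\<sigma> (?sm (?mul s s') m) = tensor_lift ?Q (\<lambda>m1 t1. tensor_lift ?Q
      (\<lambda>m2 t2. ?Pr m2 (?mul t2 t1)) (?\<sigma> (?sm s m1))) (?\<sigma> (?sm s' m))"
    by (rule tensor_linear_cong[OF Bm Cm _ _ _ _ s, where f = "\<lambda>s. ?\<sigma> (?sm (?mul s s') m)"
        and g = "\<lambda>s. tensor_lift ?Q (\<lambda>m1 t1. tensor_lift ?Q
          (\<lambda>m2 t2. ?Pr m2 (?mul t2 t1)) (?\<sigma> (?sm s m1))) (?\<sigma> (?sm s' m))"])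
      (assumption | rule pure' lin hyps s')+
qed

text \<open>The action axioms give the order \<open>c\<close> past \<open>a\<close>,
  \<open>c\<close> past \<open>m\<close>, \<open>b\<close> past \<open>a\<close>, \<open>b\<close>
  past \<open>m\<close>. The middle two involve disjoint factors; after their interchange
  \<open>b \<otimes> c\<close> passes \<open>a\<close> as a whole and then \<open>m\<close> as a
  whole.\<close>

lemma action_compatible_cross_left:
  fixes k (structure)
  assumes A: "module k A" and B: "assoc_algebra k B" and C: "assoc_algebra k C" and M: "module k M"
    and R1: "linear_map k (B \<boxtimes> A) (A \<boxtimes> B) R1"
    and R3: "linear_map k (C \<boxtimes> A) (A \<boxtimes> C) R3"
    and f: "linear_map k (B \<boxtimes> M) (M \<boxtimes> B) f" and g: "linear_map k (C \<boxtimes> M) (M \<boxtimes> C) g"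
    and \<alpha>: "linear_map k (A \<boxtimes> M) M \<alpha>"
    and af: "action_compatible k A B M R1 \<alpha> f" and ag: "action_compatible k A C M R3 \<alpha> g"
  shows "action_compatible k A (B \<boxtimes> C) M (cross_left k A B C R1 R3) \<alpha> (cross_left k M B C f g)"
  unfolding action_compatible_def
proof (intro ballI)
  fix s a m assume s: "s \<in> carrier (B \<boxtimes> C)" and a: "a \<in> carrier A" and m: "m \<in> carrier M"
  note Bm = assoc_algebra_module[OF B] and Cm = assoc_algebra_module[OF C]
  let ?Q = "M \<boxtimes> (B \<boxtimes> C)" and ?\<sigma> = "cross_left k M B C f g" and ?T = "cross_left k A B C R1 R3"
  let ?Pr = "pure_tensor k M (B \<boxtimes> C)" and ?bc = "pure_tensor k B C" and ?cm = "pure_tensor k C M"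
    and ?bm = "pure_tensor k B M" and ?sm = "pure_tensor k (B \<boxtimes> C) M" and ?sa = "pure_tensor k (B \<boxtimes> C) A"
    and ?am = "pure_tensor k A M" and ?ba = "pure_tensor k B A" and ?ca = "pure_tensor k C A"
  note \<sigma> = linear_cross_left[OF M Bm Cm f g] and T = linear_cross_left[OF A Bm Cm R1 R3]
  note hyps = A M B C Bm Cm a m R1 R3 f g \<alpha> \<sigma> T linear_map_rules[OF R1] linear_map_rules[OF R3]
    linear_map_rules[OF f] linear_map_rules[OF g] linear_map_rules[OF \<alpha>] linear_map_rules[OF \<sigma>]
    linear_map_rules[OF T]
  have pure: "?\<sigma> (?sm (?bc b c) (\<alpha> (?am a m))) = tensor_lift ?Q (\<lambda>a1 t1. tensor_lift ?Q
      (\<lambda>m1 t2. ?Pr (\<alpha> (?am a1 m1)) t2) (?\<sigma> (?sm t1 m))) (?T (?sa (?bc b c) a))"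
    if b: "b \<in> carrier B" and c: "c \<in> carrier C" for b c
  proof -
    note hyps' = hyps b c
    have "?\<sigma> (?sm (?bc b c) (\<alpha> (?am a m))) =
      tensor_lift ?Q (\<lambda>x c1. tensor_lift ?Q (\<lambda>y b1. ?Pr y (?bc b1 c1)) (f (?bm b x))) (g (?cm c (\<alpha> (?am a m))))"
      by (assumption | rule cross_left_pure lin hyps')+
    also have "\<dots> = tensor_lift ?Q (\<lambda>a1 c1. tensor_lift ?Q (\<lambda>m1 c2. tensor_lift ?Q (\<lambda>y b1. ?Pr y (?bc b1 c2))
        (f (?bm b (\<alpha> (?am a1 m1))))) (g (?cm c1 m))) (R3 (?ca c a))"
      by (assumption | rule tensor_lift_action_compatible[OF _ _ _ _ _ _ ag] lin hyps')+
    also have "\<dots> = tensor_lift ?Q (\<lambda>a1 c1. tensor_lift ?Q (\<lambda>m1 c2. tensor_lift ?Q (\<lambda>a2 b1. tensor_lift ?Q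
        (\<lambda>m2 b2. ?Pr (\<alpha> (?am a2 m2)) (?bc b2 c2)) (f (?bm b1 m1))) (R1 (?ba b a1))) (g (?cm c1 m))) (R3 (?ca c a))"
      by (assumption | rule tensor_lift_action_compatible[OF _ _ _ _ _ _ af] tensor_lift_cong lin hyps')+
    also have "\<dots> = tensor_lift ?Q (\<lambda>a1 c1. tensor_lift ?Q (\<lambda>a2 b1. tensor_lift ?Q (\<lambda>m1 c2. tensor_lift ?Q
        (\<lambda>m2 b2. ?Pr (\<alpha> (?am a2 m2)) (?bc b2 c2)) (f (?bm b1 m1))) (g (?cm c1 m))) (R1 (?ba b a1))) (R3 (?ca c a))"
      by (rule tensor_lift_cong) (assumption | rule tensor_lift_commute lin hyps')+
    also have "\<dots> = tensor_lift ?Q (\<lambda>a1 c1. tensor_lift ?Q (\<lambda>a2 b1. tensor_lift ?Q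
        (\<lambda>m1 t2. ?Pr (\<alpha> (?am a2 m1)) t2) (?\<sigma> (?sm (?bc b1 c1) m))) (R1 (?ba b a1))) (R3 (?ca c a))"
      by (assumption | rule tensor_lift_cross_left[symmetric] tensor_lift_cong lin hyps')+
    also have "\<dots> = tensor_lift ?Q (\<lambda>a1 t1. tensor_lift ?Q
      (\<lambda>m1 t2. ?Pr (\<alpha> (?am a1 m1)) t2) (?\<sigma> (?sm t1 m))) (?T (?sa (?bc b c) a))"
      by (assumption | rule tensor_lift_cross_left[symmetric] lin hyps')+
    finally show ?thesis .
  qed
  show "?\<sigma> (?sm s (\<alpha> (?am a m))) = tensor_lift ?Q (\<lambda>a1 t1. tensor_lift ?Q
      (\<lambda>m1 t2. ?Pr (\<alpha> (?am a1 m1)) t2) (?\<sigma> (?sm t1 m))) (?T (?sa s a))"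
    by (rule tensor_linear_cong[OF Bm Cm _ _ _ _ s, where f = "\<lambda>s. ?\<sigma> (?sm s (\<alpha> (?am a m)))"
        and g = "\<lambda>s. tensor_lift ?Q (\<lambda>a1 t1. tensor_lift ?Q
          (\<lambda>m1 t2. ?Pr (\<alpha> (?am a1 m1)) t2) (?\<sigma> (?sm t1 m))) (?T (?sa s a))"])
      (assumption | rule pure lin hyps)+
qed

text \<open>Both actions send \<open>(a \<otimes> b \<otimes> c) \<otimes> (m \<otimes> n \<otimes>
  p)\<close> to the sum of terms \<open>a m2 \<otimes> b1 n1 \<otimes> c2 p\<close>, and in both
  \<open>c\<close> passes \<open>m\<close> first. They differ only in whether \<open>c1\<close>
  passes \<open>n\<close> before or after \<open>b\<close> passes \<open>m1\<close>. The map
  \<open>assoc\<close> transports between the bracketings, on algebras and modules alike.\<close>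

lemma induced_actions_agree:
  fixes k (structure)
  assumes mods: "module k A" "module k B" "module k C" "module k M" "module k N" "module k P"
    and \<tau>: "linear_map k (B \<boxtimes> M) (M \<boxtimes> B) \<tau>"
    and f: "linear_map k (C \<boxtimes> M) (M \<boxtimes> C) f" and g: "linear_map k (C \<boxtimes> N) (N \<boxtimes> C) g"
    and \<alpha>: "linear_map k (A \<boxtimes> M) M \<alpha>" and \<beta>: "linear_map k (B \<boxtimes> N) N \<beta>"
    and \<gamma>: "linear_map k (C \<boxtimes> P) P \<gamma>"
    and t: "t \<in> carrier (((A \<boxtimes> B) \<boxtimes> C) \<boxtimes> ((M \<boxtimes> N) \<boxtimes> P))"
  shows "assoc k M N P (induced_action k (A \<boxtimes> B) C (M \<boxtimes> N) P (cross_right k M N C f g)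
      (induced_action k A B M N \<tau> \<alpha> \<beta>) \<gamma> t) =
    induced_action k A (B \<boxtimes> C) M (N \<boxtimes> P) (cross_left k M B C \<tau> f) \<alpha> (induced_action k B C N P g \<beta> \<gamma>)
      (tensor_map k (A \<boxtimes> (B \<boxtimes> C)) (M \<boxtimes> (N \<boxtimes> P)) (assoc k A B C) (assoc k M N P) t)"
proof -
  let ?ABC = "(A \<boxtimes> B) \<boxtimes> C" and ?MNP = "(M \<boxtimes> N) \<boxtimes> P" and ?Q = "M \<boxtimes> (N \<boxtimes> P)"
  let ?\<sigma>1 = "cross_right k M N C f g" and ?\<sigma>2 = "cross_left k M B C \<tau> f"
  let ?MN = "induced_action k A B M N \<tau> \<alpha> \<beta>" and ?NP = "induced_action k B C N P g \<beta> \<gamma>"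
  let ?act1 = "induced_action k (A \<boxtimes> B) C (M \<boxtimes> N) P ?\<sigma>1 ?MN \<gamma>"
    and ?act2 = "induced_action k A (B \<boxtimes> C) M (N \<boxtimes> P) ?\<sigma>2 \<alpha> ?NP"
    and ?as = "tensor_map k (A \<boxtimes> (B \<boxtimes> C)) (M \<boxtimes> (N \<boxtimes> P)) (assoc k A B C) (assoc k M N P)"
  let ?pure = "pure_tensor k ?ABC ?MNP" and ?abc = "pure_tensor k (A \<boxtimes> B) C" and ?ab = "pure_tensor k A B"
    and ?mnp = "pure_tensor k (M \<boxtimes> N) P" and ?mn = "pure_tensor k M N"
    and ?a_bc = "pure_tensor k A (B \<boxtimes> C)" and ?bc = "pure_tensor k B C"
    and ?m_np = "pure_tensor k M (N \<boxtimes> P)" and ?np = "pure_tensor k N P"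
    and ?abmn = "pure_tensor k (A \<boxtimes> B) (M \<boxtimes> N)" and ?bcnp = "pure_tensor k (B \<boxtimes> C) (N \<boxtimes> P)"
    and ?cu = "pure_tensor k C (M \<boxtimes> N)" and ?sm = "pure_tensor k (B \<boxtimes> C) M"
    and ?am = "pure_tensor k A M" and ?bm = "pure_tensor k B M" and ?cm = "pure_tensor k C M"
    and ?bn = "pure_tensor k B N" and ?cn = "pure_tensor k C N" and ?cp = "pure_tensor k C P"
  let ?as_mnp = "assoc k M N P"
  note \<sigma>1 = linear_cross_right[OF mods(4,5,3) f g] and \<sigma>2 = linear_cross_left[OF mods(4,2,3) \<tau> f]
    and MN = linear_induced_action[OF mods(1,2,4,5) \<tau> \<alpha> \<beta>]
    and NP = linear_induced_action[OF mods(2,3,5,6) g \<beta> \<gamma>]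
  note AB_mod = module_tensor[OF mods(1,2)] and MN_mod = module_tensor[OF mods(4,5)]
    and BC_mod = module_tensor[OF mods(2,3)] and NP_mod = module_tensor[OF mods(5,6)]
  note act1 = linear_induced_action[OF AB_mod mods(3) MN_mod mods(6) \<sigma>1 MN \<gamma>]
    and act2 = linear_induced_action[OF mods(1) BC_mod mods(4) NP_mod \<sigma>2 \<alpha> NP]
  note as_abc = linear_assoc[OF mods(1,2,3)] and as_mnp = linear_assoc[OF mods(4,5,6)]
  have as: "linear_map k (?ABC \<boxtimes> ?MNP) ((A \<boxtimes> (B \<boxtimes> C)) \<boxtimes> ?Q) ?as"
    by (rule linear_tensor_map as_abc as_mnp lin mods)+
  note hyps = mods \<tau> f g \<alpha> \<beta> \<gamma> \<sigma>1 \<sigma>2 MN NP linear_map_rules[OF \<tau>] linear_map_rules[OF f] linear_map_rules[OF g]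
    linear_map_rules[OF \<alpha>] linear_map_rules[OF \<beta>] linear_map_rules[OF \<gamma>]
    linear_map_rules[OF \<sigma>1] linear_map_rules[OF \<sigma>2] linear_map_rules[OF MN] linear_map_rules[OF NP]
    linear_map_compose[OF act1] linear_map_compose[OF act2] linear_map_compose[OF as] linear_map_rules[OF as_mnp]
  have pure: "?as_mnp (?act1 (?pure (?abc (?ab a b) c) (?mnp (?mn m n) p))) =
      ?act2 (?as (?pure (?abc (?ab a b) c) (?mnp (?mn m n) p)))"
    if elems: "a \<in> carrier A" "b \<in> carrier B" "c \<in> carrier C" "m \<in> carrier M" "n \<in> carrier N" "p \<in> carrier P"
    for a b c m n p
  proof -
    note hyps' = hyps elems
    have "?act1 (?pure (?abc (?ab a b) c) (?mnp (?mn m n) p)) =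
      tensor_lift ?MNP (\<lambda>u c1. ?mnp (?MN (?abmn (?ab a b) u)) (\<gamma> (?cp c1 p))) (?\<sigma>1 (?cu c (?mn m n)))"
      by (rule induced_action_pure lin hyps')+
    also have "\<dots> = tensor_lift ?MNP (\<lambda>m1 c1. tensor_lift ?MNP (\<lambda>n1 c2.
        ?mnp (?MN (?abmn (?ab a b) (?mn m1 n1))) (\<gamma> (?cp c2 p))) (g (?cn c1 n))) (f (?cm c m))"
      by (assumption | rule tensor_lift_cross_right lin hyps')+
    finally have "?as_mnp (?act1 (?pure (?abc (?ab a b) c) (?mnp (?mn m n) p))) =
      ?as_mnp (tensor_lift ?MNP (\<lambda>m1 c1. tensor_lift ?MNP (\<lambda>n1 c2.
        ?mnp (?MN (?abmn (?ab a b) (?mn m1 n1))) (\<gamma> (?cp c2 p))) (g (?cn c1 n))) (f (?cm c m)))"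
      by simp
    also have "\<dots> = tensor_lift ?Q (\<lambda>m1 c1. ?as_mnp (tensor_lift ?MNP (\<lambda>n1 c2.
        ?mnp (?MN (?abmn (?ab a b) (?mn m1 n1))) (\<gamma> (?cp c2 p))) (g (?cn c1 n)))) (f (?cm c m))"
      by (assumption | rule linear_map_tensor_lift[OF _ as_mnp] lin hyps')+
    also have "\<dots> = tensor_lift ?Q (\<lambda>m1 c1. tensor_lift ?Q (\<lambda>n1 c2. ?as_mnp
        (?mnp (?MN (?abmn (?ab a b) (?mn m1 n1))) (\<gamma> (?cp c2 p)))) (g (?cn c1 n))) (f (?cm c m))"
      by (assumption | rule linear_map_tensor_lift[OF _ as_mnp] tensor_lift_cong lin hyps')+
    also have "\<dots> = tensor_lift ?Q (\<lambda>m1 c1. tensor_lift ?Q (\<lambda>n1 c2. ?as_mnp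
        (?mnp (tensor_lift (M \<boxtimes> N) (\<lambda>m2 b1. ?mn (\<alpha> (?am a m2)) (\<beta> (?bn b1 n1))) (\<tau> (?bm b m1)))
          (\<gamma> (?cp c2 p)))) (g (?cn c1 n))) (f (?cm c m))"
      by (assumption | rule arg_cong[where f = "\<lambda>s. ?as_mnp (?mnp s _)"] induced_action_pure tensor_lift_cong lin hyps')+
    also have "\<dots> = tensor_lift ?Q (\<lambda>m1 c1. tensor_lift ?Q (\<lambda>n1 c2. tensor_lift ?Q (\<lambda>m2 b1. ?as_mnp
        (?mnp (?mn (\<alpha> (?am a m2)) (\<beta> (?bn b1 n1))) (\<gamma> (?cp c2 p)))) (\<tau> (?bm b m1))) (g (?cn c1 n))) (f (?cm c m))"
      by (assumption | rule linear_map_tensor_lift[where h = "\<lambda>s. ?as_mnp (?mnp s _)"] tensor_lift_cong lin hyps')+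
    also have "\<dots> = tensor_lift ?Q (\<lambda>m1 c1. tensor_lift ?Q (\<lambda>n1 c2. tensor_lift ?Q (\<lambda>m2 b1.
        ?m_np (\<alpha> (?am a m2)) (?np (\<beta> (?bn b1 n1)) (\<gamma> (?cp c2 p)))) (\<tau> (?bm b m1))) (g (?cn c1 n))) (f (?cm c m))"
      by (assumption | rule assoc_pure tensor_lift_cong lin hyps')+
    \<comment> \<open>The decisive interchange: \<open>b\<close> past \<open>m1\<close> and
      \<open>c1\<close> past \<open>n\<close> involve disjoint factors.\<close>
    also have "\<dots> = tensor_lift ?Q (\<lambda>m1 c1. tensor_lift ?Q (\<lambda>m2 b1. tensor_lift ?Q (\<lambda>n1 c2.
        ?m_np (\<alpha> (?am a m2)) (?np (\<beta> (?bn b1 n1)) (\<gamma> (?cp c2 p)))) (g (?cn c1 n))) (\<tau> (?bm b m1))) (f (?cm c m))"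
      by (rule tensor_lift_cong) (assumption | rule tensor_lift_commute lin hyps')+
    also have "\<dots> = tensor_lift ?Q (\<lambda>m1 c1. tensor_lift ?Q (\<lambda>m2 b1. ?m_np (\<alpha> (?am a m2))
        (tensor_lift (N \<boxtimes> P) (\<lambda>n1 c2. ?np (\<beta> (?bn b1 n1)) (\<gamma> (?cp c2 p))) (g (?cn c1 n))))
        (\<tau> (?bm b m1))) (f (?cm c m))"
      by (assumption | rule linear_map_tensor_lift[where h = "?m_np _", symmetric] tensor_lift_cong lin hyps')+
    also have "\<dots> = tensor_lift ?Q (\<lambda>m1 c1. tensor_lift ?Q (\<lambda>m2 b1. ?m_np (\<alpha> (?am a m2))
        (?NP (?bcnp (?bc b1 c1) (?np n p)))) (\<tau> (?bm b m1))) (f (?cm c m))"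
      by (assumption | rule arg_cong[where f = "?m_np _"] induced_action_pure[symmetric] tensor_lift_cong lin hyps')+
    also have "\<dots> = tensor_lift ?Q (\<lambda>m1 t1. ?m_np (\<alpha> (?am a m1)) (?NP (?bcnp t1 (?np n p)))) (?\<sigma>2 (?sm (?bc b c) m))"
      by (assumption | rule tensor_lift_cross_left[symmetric] lin hyps')+
    also have "\<dots> = ?act2 (pure_tensor k (A \<boxtimes> (B \<boxtimes> C)) ?Q (?a_bc a (?bc b c)) (?m_np m (?np n p)))"
      by (rule induced_action_pure[symmetric] lin hyps')+
    \<comment> \<open>Only the argument of the second action is rewritten here, to recognise it as
      the image of the original element under the two associativity maps.\<close>
    also have "pure_tensor k (A \<boxtimes> (B \<boxtimes> C)) ?Q (?a_bc a (?bc b c)) (?m_np m (?np n p)) =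
      pure_tensor k (A \<boxtimes> (B \<boxtimes> C)) ?Q (assoc k A B C (?abc (?ab a b) c)) (?as_mnp (?mnp (?mn m n) p))"
      using assoc_pure[OF mods(1,2,3)] assoc_pure[OF mods(4,5,6)] elems by simp
    also have "\<dots> = ?as (?pure (?abc (?ab a b) c) (?mnp (?mn m n) p))"
      by (rule tensor_map_pure[symmetric] as_abc as_mnp lin hyps')+
    finally show ?thesis .
  qed
  have pure': "?as_mnp (?act1 (?pure (?abc (?ab a b) c) u)) = ?act2 (?as (?pure (?abc (?ab a b) c) u))"
    if "a \<in> carrier A" "b \<in> carrier B" "c \<in> carrier C" "u \<in> carrier ?MNP" for a b c u
    by (rule tensor_linear_cong_left[OF mods(4,5,6) _ _ _ _ that(4),
          where f = "\<lambda>u. ?as_mnp (?act1 (?pure (?abc (?ab a b) c) u))"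
            and g = "\<lambda>u. ?act2 (?as (?pure (?abc (?ab a b) c) u))"])
      (assumption | rule pure lin hyps that)+
  have pure'': "?as_mnp (?act1 (?pure s u)) = ?act2 (?as (?pure s u))"
    if "s \<in> carrier ?ABC" "u \<in> carrier ?MNP" for s u
    by (rule tensor_linear_cong_left[OF mods(1,2,3) _ _ _ _ that(1),
          where f = "\<lambda>s. ?as_mnp (?act1 (?pure s u))" and g = "\<lambda>s. ?act2 (?as (?pure s u))"])
      (assumption | rule pure' lin hyps that)+
  show ?thesis
    by (rule tensor_linear_cong[OF _ _ _ _ _ _ t,
          where f = "\<lambda>t. ?as_mnp (?act1 t)" and g = "\<lambda>t. ?act2 (?as t)"])
      (assumption | rule pure'' act1 as lin hyps)+
qed


section \<open>Twisting maps and module twisting maps\<close>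

context twisting_map
begin

lemma product_compatible: "product_compatible k B A R"
  using product_compatible_iff[OF B.assoc_algebra_axioms A.module_axioms linear] twist_product_right by blast

lemma action_compatible: "action_compatible k A B A R (product_map A) R"
  using action_compatible_iff[OF B.assoc_algebra_axioms A.module_axioms linear A.module_axioms linear
      linear_product_map[OF A.assoc_algebra_axioms]] twist_product_left by blast

end

context module_twisting_map
begin

lemma module_product_compatible: "product_compatible k B M \<tau>"
  using product_compatible_iff[OF B.assoc_algebra_axioms M.module_axioms module_twist_linear]
    module_twist_product by blast

lemma module_action_compatible: "action_compatible k A B M R act \<tau>"
  using action_compatible_iff[OF B.assoc_algebra_axioms M.module_axioms module_twist_linear
      A.module_axioms linear action_linear] module_twist_action by blast

end

lemma twisting_mapI:
  fixes k (structure)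
  assumes "assoc_algebra k A" "assoc_algebra k B" "linear_map k (B \<boxtimes> A) (A \<boxtimes> B) R"
    and "product_compatible k B A R" "action_compatible k A B A R (product_map A) R"
  shows "twisting_map k A B R"
  using assms product_compatible_iff[OF assms(2) assoc_algebra_module[OF assms(1)] assms(3)]
    action_compatible_iff[OF assms(2) assoc_algebra_module[OF assms(1)] assms(3)
      assoc_algebra_module[OF assms(1)] assms(3) linear_product_map[OF assms(1)]]
  by (intro twisting_map.intro twisting_map_axioms.intro) blast+

lemma module_twisting_mapI:
  fixes k (structure)
  assumes R: "twisting_map k A B R" and act: "left_action k A M act"
    and \<tau>: "linear_map k (B \<boxtimes> M) (M \<boxtimes> B) \<tau>"
    and "product_compatible k B M \<tau>" "action_compatible k A B M R act \<tau>"
  shows "module_twisting_map k A B R M act \<tau>"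
proof -
  interpret twisting_map k A B R by (rule R)
  interpret left_action k A M act by (rule act)
  show ?thesis
    using assms(4,5) product_compatible_iff[OF B.assoc_algebra_axioms M.module_axioms \<tau>]
      action_compatible_iff[OF B.assoc_algebra_axioms M.module_axioms \<tau> A.module_axioms linear action_linear]
    by (intro module_twisting_map.intro module_twisting_map_axioms.intro R act \<tau>) blast+
qed

text \<open>Associativity in the shape of an action axiom, for the regular module.\<close>

lemma product_map_assoc:
  assumes A: "assoc_algebra k A" and a: "a \<in> carrier A" "a' \<in> carrier A" "x \<in> carrier A"
  shows "product_map A (pure_tensor k A A (a \<otimes>\<^bsub>A\<^esub> a') x) =
    product_map A (pure_tensor k A A a (product_map A (pure_tensor k A A a' x)))"
  using algebra_mult_assoc[OF a A] algebra_mult_closed[OF a(1,2) A] algebra_mult_closed[OF a(2,3) A] a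
  by (simp add: product_map_pure[OF _ _ A])

text \<open>The product map of a twisted tensor product and the induced action on regular modules
  are different terms that agree on tensors of carrier elements. The condition must therefore be
  transported from one to the other.\<close>

lemma action_compatible_cong:
  fixes k (structure)
  assumes mods: "module k A" "module k B" "module k M"
    and R: "linear_map k (B \<boxtimes> A) (A \<boxtimes> B) R" and \<tau>: "linear_map k (B \<boxtimes> M) (M \<boxtimes> B) \<tau>"
    and \<alpha>: "linear_map k (A \<boxtimes> M) M \<alpha>"
    and ac: "action_compatible k A B M R \<alpha> \<tau>"
    and eq: "\<And>a m. \<lbrakk>a \<in> carrier A; m \<in> carrier M\<rbrakk> \<Longrightarrow> \<alpha> (pure_tensor k A M a m) = \<alpha>' (pure_tensor k A M a m)"
  shows "action_compatible k A B M R \<alpha>' \<tau>"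
  unfolding action_compatible_def
proof (intro ballI)
  fix b a m assume b: "b \<in> carrier B" "a \<in> carrier A" "m \<in> carrier M"
  note hyps = mods R \<tau> \<alpha> linear_map_rules[OF R] linear_map_rules[OF \<tau>] linear_map_rules[OF \<alpha>] b
  have "\<tau> (pure_tensor k B M b (\<alpha>' (pure_tensor k A M a m))) =
    tensor_lift (M \<boxtimes> B) (\<lambda>a1 b1. tensor_lift (M \<boxtimes> B)
      (\<lambda>m1 b2. pure_tensor k M B (\<alpha> (pure_tensor k A M a1 m1)) b2) (\<tau> (pure_tensor k B M b1 m)))
      (R (pure_tensor k B A b a))"
    using ac b by (simp add: action_compatible_def eq[symmetric])
  also have "\<dots> = tensor_lift (M \<boxtimes> B) (\<lambda>a1 b1. tensor_lift (M \<boxtimes> B)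
      (\<lambda>m1 b2. pure_tensor k M B (\<alpha>' (pure_tensor k A M a1 m1)) b2) (\<tau> (pure_tensor k B M b1 m)))
      (R (pure_tensor k B A b a))"
    by (assumption | rule arg_cong[where f = "\<lambda>x. pure_tensor k M B x _"] eq tensor_lift_cong lin hyps)+
  finally show "\<tau> (pure_tensor k B M b (\<alpha>' (pure_tensor k A M a m))) = \<dots>" .
qed

context unital_twisting_map
begin

text \<open>For the unit laws, the unit conditions make the relevant values of \<open>R\<close>
  pure, and the sum defining the product collapses to one term. Distributivity and the scalar laws
  are the linearity of the product in each factor.\<close>

lemma assoc_algebra_twisted_tensor: "assoc_algebra k (twisted_tensor k A B R)"
proof -
  let ?AB = "twisted_tensor k A B R"
  note algs = A.assoc_algebra_axioms B.assoc_algebra_axioms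
  note mods = A.module_axioms B.module_axioms
  interpret T: module k "A \<boxtimes>\<^bsub>k\<^esub> B" by (rule module_tensor[OF mods])
  interpret AB: module k ?AB by (simp add: T.module_axioms)
  note closed = twisted_mult_closed[OF algs linear]
  note linear_left = linear_twisted_mult_left[OF algs linear linear_map_id]
    and linear_right = linear_twisted_mult_right[OF algs linear linear_map_id]
  have assoc: "(s \<otimes>\<^bsub>?AB\<^esub> t) \<otimes>\<^bsub>?AB\<^esub> u = s \<otimes>\<^bsub>?AB\<^esub> (t \<otimes>\<^bsub>?AB\<^esub> u)"
    if "s \<in> carrier (A \<boxtimes>\<^bsub>k\<^esub> B)" "t \<in> carrier (A \<boxtimes>\<^bsub>k\<^esub> B)" "u \<in> carrier (A \<boxtimes>\<^bsub>k\<^esub> B)" for s t u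
    using induced_action_assoc[OF algs linear mods linear linear_product_map[OF algs(1)] linear_product_map[OF algs(2)]
        product_compatible action_compatible product_map_assoc[OF algs(1)] product_map_assoc[OF algs(2)] that]
    unfolding twisted_mult .
  note hyps = algs mods A.A.one_closed B.A.one_closed linear_map_closed[OF linear]
  have one_closed: "pure_tensor k A B \<one>\<^bsub>A\<^esub> \<one>\<^bsub>B\<^esub> \<in> carrier (A \<boxtimes>\<^bsub>k\<^esub> B)"
    by (rule lin hyps)+
  have l_one: "pure_tensor k A B \<one>\<^bsub>A\<^esub> \<one>\<^bsub>B\<^esub> \<otimes>\<^bsub>?AB\<^esub> s = s" if s: "s \<in> carrier (A \<boxtimes>\<^bsub>k\<^esub> B)" for s
  proof (rule tensor_linear_cong[OF mods T.module_axioms linear_right[OF one_closed] linear_map_id _ s])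
    fix a b assume ab: "a \<in> carrier A" "b \<in> carrier B"
    have "pure_tensor k A B \<one>\<^bsub>A\<^esub> \<one>\<^bsub>B\<^esub> \<otimes>\<^bsub>?AB\<^esub> pure_tensor k A B a b =
      tensor_lift (A \<boxtimes>\<^bsub>k\<^esub> B) (\<lambda>a1 b1. pure_tensor k A B (\<one>\<^bsub>A\<^esub> \<otimes>\<^bsub>A\<^esub> a1) (b1 \<otimes>\<^bsub>B\<^esub> b)) (pure_tensor k A B a \<one>\<^bsub>B\<^esub>)"
      using twisted_mult_pure[OF algs linear A.A.one_closed B.A.one_closed ab] twist_one_left[OF ab(1)] by simp
    also have "\<dots> = pure_tensor k A B (\<one>\<^bsub>A\<^esub> \<otimes>\<^bsub>A\<^esub> a) (\<one>\<^bsub>B\<^esub> \<otimes>\<^bsub>B\<^esub> b)"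
      by (assumption | rule tensor_lift_pure lin hyps ab)+
    finally show "pure_tensor k A B \<one>\<^bsub>A\<^esub> \<one>\<^bsub>B\<^esub> \<otimes>\<^bsub>?AB\<^esub> pure_tensor k A B a b = pure_tensor k A B a b"
      using ab by simp
  qed
  have r_one: "s \<otimes>\<^bsub>?AB\<^esub> pure_tensor k A B \<one>\<^bsub>A\<^esub> \<one>\<^bsub>B\<^esub> = s" if s: "s \<in> carrier (A \<boxtimes>\<^bsub>k\<^esub> B)" for s
  proof (rule tensor_linear_cong[OF mods T.module_axioms linear_left[OF one_closed] linear_map_id _ s])
    fix a b assume ab: "a \<in> carrier A" "b \<in> carrier B"
    have "pure_tensor k A B a b \<otimes>\<^bsub>?AB\<^esub> pure_tensor k A B \<one>\<^bsub>A\<^esub> \<one>\<^bsub>B\<^esub> =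
      tensor_lift (A \<boxtimes>\<^bsub>k\<^esub> B) (\<lambda>a1 b1. pure_tensor k A B (a \<otimes>\<^bsub>A\<^esub> a1) (b1 \<otimes>\<^bsub>B\<^esub> \<one>\<^bsub>B\<^esub>)) (pure_tensor k A B \<one>\<^bsub>A\<^esub> b)"
      using twisted_mult_pure[OF algs linear ab A.A.one_closed B.A.one_closed] twist_one_right[OF ab(2)] by simp
    also have "\<dots> = pure_tensor k A B (a \<otimes>\<^bsub>A\<^esub> \<one>\<^bsub>A\<^esub>) (b \<otimes>\<^bsub>B\<^esub> \<one>\<^bsub>B\<^esub>)"
      by (assumption | rule tensor_lift_pure lin hyps ab)+
    finally show "pure_tensor k A B a b \<otimes>\<^bsub>?AB\<^esub> pure_tensor k A B \<one>\<^bsub>A\<^esub> \<one>\<^bsub>B\<^esub> = pure_tensor k A B a b"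
      using ab by simp
  qed
  have "ring ?AB"
  proof (rule ringI)
    show "monoid ?AB"
      by (rule monoidI) (use closed one_closed assoc l_one r_one in simp_all)
  next
    fix s t u assume "s \<in> carrier ?AB" "t \<in> carrier ?AB" "u \<in> carrier ?AB"
    then have stu: "s \<in> carrier (A \<boxtimes>\<^bsub>k\<^esub> B)" "t \<in> carrier (A \<boxtimes>\<^bsub>k\<^esub> B)" "u \<in> carrier (A \<boxtimes>\<^bsub>k\<^esub> B)" by simp_all
    show "(s \<oplus>\<^bsub>?AB\<^esub> t) \<otimes>\<^bsub>?AB\<^esub> u = s \<otimes>\<^bsub>?AB\<^esub> u \<oplus>\<^bsub>?AB\<^esub> t \<otimes>\<^bsub>?AB\<^esub> u"
      using linear_map_add[OF linear_left[OF stu(3)] stu(1,2)] by simp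
    show "u \<otimes>\<^bsub>?AB\<^esub> (s \<oplus>\<^bsub>?AB\<^esub> t) = u \<otimes>\<^bsub>?AB\<^esub> s \<oplus>\<^bsub>?AB\<^esub> u \<otimes>\<^bsub>?AB\<^esub> t"
      using linear_map_add[OF linear_right[OF stu(3)] stu(1,2)] by simp
  qed (rule AB.M.abelian_group_axioms)
  then show ?thesis
  proof (intro assoc_algebra.intro AB.module_axioms assoc_algebra_axioms.intro)
    fix c s t assume c: "c \<in> carrier k" and "s \<in> carrier ?AB" "t \<in> carrier ?AB"
    then have st: "s \<in> carrier (A \<boxtimes>\<^bsub>k\<^esub> B)" "t \<in> carrier (A \<boxtimes>\<^bsub>k\<^esub> B)" by simp_all
    show "(c \<odot>\<^bsub>?AB\<^esub> s) \<otimes>\<^bsub>?AB\<^esub> t = c \<odot>\<^bsub>?AB\<^esub> (s \<otimes>\<^bsub>?AB\<^esub> t)"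
      using linear_map_smult[OF linear_left[OF st(2)] c st(1)] by simp
    show "s \<otimes>\<^bsub>?AB\<^esub> (c \<odot>\<^bsub>?AB\<^esub> t) = c \<odot>\<^bsub>?AB\<^esub> (s \<otimes>\<^bsub>?AB\<^esub> t)"
      using linear_map_smult[OF linear_right[OF st(1)] c st(2)] by simp
  qed
qed

lemma product_map_twisted_tensor:
  assumes "s \<in> carrier (A \<boxtimes>\<^bsub>k\<^esub> B)" "t \<in> carrier (A \<boxtimes>\<^bsub>k\<^esub> B)"
  shows "product_map (twisted_tensor k A B R) (pure_tensor k (A \<boxtimes>\<^bsub>k\<^esub> B) (A \<boxtimes>\<^bsub>k\<^esub> B) s t) =
    induced_action k A B A B R (product_map A) (product_map B) (pure_tensor k (A \<boxtimes>\<^bsub>k\<^esub> B) (A \<boxtimes>\<^bsub>k\<^esub> B) s t)"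
  using product_map_pure[OF _ _ assoc_algebra_twisted_tensor, of s t] assms by (simp add: twisted_mult)

end

text \<open>Needed at two levels: for \<open>M \<otimes> N\<close> and \<open>N \<otimes> P\<close>,
  and again over the iterated products on all three factors. Unitality of \<open>R\<close> makes the
  acting object a unital algebra. The result is only a \<open>left_action\<close>: with no unit
  condition on \<open>\<tau>\<close>, the unit need not act as the identity.\<close>

lemma left_action_induced:
  fixes k (structure)
  assumes R: "unital_twisting_map k A B R" and \<tau>: "module_twisting_map k A B R M actM \<tau>"
    and N: "left_action k B N actN"
  shows "left_action k (twisted_tensor k A B R) (M \<boxtimes> N) (induced_action k A B M N \<tau> actM actN)"
proof -
  interpret R: unital_twisting_map k A B R by (rule R)
  interpret M: module_twisting_map k A B R M actM \<tau> by (rule \<tau>)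
  interpret N: left_action k B N actN by (rule N)
  note mods = R.A.module_axioms R.B.module_axioms M.M.module_axioms N.M.module_axioms
  show ?thesis
  proof (intro left_action.intro R.assoc_algebra_twisted_tensor left_action_axioms.intro)
    show "module k (M \<boxtimes> N)"
      by (rule module_tensor[OF mods(3,4)])
    show "linear_map k (twisted_tensor k A B R \<boxtimes> (M \<boxtimes> N)) (M \<boxtimes> N) (induced_action k A B M N \<tau> actM actN)"
      using linear_induced_action[OF mods M.module_twist_linear M.action_linear N.action_linear] by simp
  qed (use induced_action_assoc[OF R.A.assoc_algebra_axioms R.B.assoc_algebra_axioms R.linear mods(3,4)
      M.module_twist_linear M.action_linear N.action_linear M.module_product_compatible
      M.module_action_compatible M.action_assoc N.action_assoc] in simp_all)
qed


section \<open>Iterated twisted tensor products\<close>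

locale twisting_hexagon =
  AB: unital_twisting_map k A B R1 + BC: unital_twisting_map k B C R2 + AC: unital_twisting_map k A C R3
  for k :: "('k, 'r) ring_scheme" (structure) and A :: "('k, 'a, 'x) module_scheme"
    and B :: "('k, 'b, 'y) module_scheme" and C :: "('k, 'c, 'z) module_scheme"
    and R1 :: "('b, 'a) tensor \<Rightarrow> ('a, 'b) tensor" and R2 :: "('c, 'b) tensor \<Rightarrow> ('b, 'c) tensor"
    and R3 :: "('c, 'a) tensor \<Rightarrow> ('a, 'c) tensor" +
  assumes hexagon: "hexagon k A B C R1 R2 R3"
begin

lemmas algs = AB.A.assoc_algebra_axioms AB.B.assoc_algebra_axioms BC.B.assoc_algebra_axioms

lemmas mods = AB.A.module_axioms AB.B.module_axioms BC.B.module_axioms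

lemmas linear_T1 = linear_cross_right[OF mods AC.linear BC.linear]

lemmas linear_T2 = linear_cross_left[OF mods AB.linear AC.linear]

lemmas hyps = algs mods AB.linear BC.linear AC.linear
  AB.A.A.one_closed AB.B.A.one_closed BC.B.A.one_closed

text \<open>The hexagon of the algebras is the module hexagon for the regular modules
  \<open>A\<close> and \<open>B\<close> with \<open>R1\<close> as module twisting map. For the unit
  conditions, the unit of \<open>C\<close> passes \<open>a\<close> and \<open>b\<close> one after
  the other unchanged, and \<open>c\<close> passes both units.\<close>

lemma unital_twisting_map_T1:
  "unital_twisting_map k (twisted_tensor k A B R1) C (cross_right k A B C R3 R2)"
proof (intro unital_twisting_map.intro twisting_mapI unital_twisting_map_axioms.intro
    AB.assoc_algebra_twisted_tensor algs)
  let ?T = "cross_right k A B C R3 R2"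
  note T = linear_T1
  show "linear_map k (C \<boxtimes> twisted_tensor k A B R1) (twisted_tensor k A B R1 \<boxtimes> C) ?T"
    using T by simp
  show "product_compatible k C (twisted_tensor k A B R1) ?T"
    using product_compatible_cross_right[OF mods(1,2) algs(3) AC.linear BC.linear
        AC.product_compatible BC.product_compatible] by simp
  have "action_compatible k (A \<boxtimes> B) C (A \<boxtimes> B) ?T (induced_action k A B A B R1 (product_map A) (product_map B)) ?T"
    by (rule action_compatible_cross_right linear_product_map AC.action_compatible BC.action_compatible hexagon hyps)+
  \<comment> \<open>The induced action of the regular modules is replaced by the product map of the
    twisted algebra, as the twisting axiom is formulated with the latter.\<close>
  then have "action_compatible k (A \<boxtimes> B) C (A \<boxtimes> B) ?T (product_map (twisted_tensor k A B R1)) ?T"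
    by (rule action_compatible_cong[rotated 6])
      (simp_all add: module_tensor mods T linear_twisted_product algs AB.linear AB.product_map_twisted_tensor)
  then show "action_compatible k (twisted_tensor k A B R1) C (twisted_tensor k A B R1) ?T
      (product_map (twisted_tensor k A B R1)) ?T" by simp
next
  let ?T = "cross_right k A B C R3 R2"
  let ?AB = "A \<boxtimes> B" and ?ab = "pure_tensor k A B"
  have AB_mod: "module k ?AB" by (rule module_tensor[OF mods(1,2)])
  fix s assume "s \<in> carrier (twisted_tensor k A B R1)"
  then have s: "s \<in> carrier ?AB" by simp
  have "?T (pure_tensor k C ?AB \<one>\<^bsub>C\<^esub> s) = pure_tensor k ?AB C s \<one>\<^bsub>C\<^esub>"
  proof (rule tensor_linear_cong[OF mods(1,2) module_tensor[OF AB_mod mods(3)] _ _ _ s,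
        where f = "\<lambda>s. ?T (pure_tensor k C ?AB \<one>\<^bsub>C\<^esub> s)" and g = "\<lambda>s. pure_tensor k ?AB C s \<one>\<^bsub>C\<^esub>"])
    fix a b assume ab: "a \<in> carrier A" "b \<in> carrier B"
    have "?T (pure_tensor k C ?AB \<one>\<^bsub>C\<^esub> (?ab a b)) = tensor_lift (?AB \<boxtimes> C) (\<lambda>a1 c1. tensor_lift (?AB \<boxtimes> C)
        (\<lambda>b1 c2. pure_tensor k ?AB C (?ab a1 b1) c2) (R2 (pure_tensor k C B c1 b))) (R3 (pure_tensor k C A \<one>\<^bsub>C\<^esub> a))"
      by (rule cross_right_pure hyps ab)+
    also have "\<dots> = tensor_lift (?AB \<boxtimes> C) (\<lambda>b1 c2. pure_tensor k ?AB C (?ab a b1) c2) (R2 (pure_tensor k C B \<one>\<^bsub>C\<^esub> b))"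
      unfolding AC.twist_one_left[OF ab(1)]
      by (assumption | rule tensor_lift_pure lin hyps ab linear_map_compose[OF BC.linear] linear_map_closed[OF BC.linear])+
    also have "\<dots> = pure_tensor k ?AB C (?ab a b) \<one>\<^bsub>C\<^esub>"
      unfolding BC.twist_one_left[OF ab(2)] by (assumption | rule tensor_lift_pure lin hyps ab)+
    finally show "?T (pure_tensor k C ?AB \<one>\<^bsub>C\<^esub> (?ab a b)) = pure_tensor k ?AB C (?ab a b) \<one>\<^bsub>C\<^esub>" .
  qed (assumption | rule linear_map_compose[OF linear_T1] lin hyps)+
  then show "?T (pure_tensor k C (twisted_tensor k A B R1) \<one>\<^bsub>C\<^esub> s) = pure_tensor k (twisted_tensor k A B R1) C s \<one>\<^bsub>C\<^esub>"
    by simp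
next
  let ?T = "cross_right k A B C R3 R2"
  let ?AB = "A \<boxtimes> B" and ?ab = "pure_tensor k A B"
  fix c assume c: "c \<in> carrier C"
  have "?T (pure_tensor k C ?AB c (?ab \<one>\<^bsub>A\<^esub> \<one>\<^bsub>B\<^esub>)) = tensor_lift (?AB \<boxtimes> C) (\<lambda>a1 c1. tensor_lift (?AB \<boxtimes> C)
        (\<lambda>b1 c2. pure_tensor k ?AB C (?ab a1 b1) c2) (R2 (pure_tensor k C B c1 \<one>\<^bsub>B\<^esub>))) (R3 (pure_tensor k C A c \<one>\<^bsub>A\<^esub>))"
    by (rule cross_right_pure hyps c)+
  also have "\<dots> = tensor_lift (?AB \<boxtimes> C) (\<lambda>b1 c2. pure_tensor k ?AB C (?ab \<one>\<^bsub>A\<^esub> b1) c2) (R2 (pure_tensor k C B c \<one>\<^bsub>B\<^esub>))"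
    unfolding AC.twist_one_right[OF c]
    by (assumption | rule tensor_lift_pure lin hyps c linear_map_compose[OF BC.linear] linear_map_closed[OF BC.linear])+
  also have "\<dots> = pure_tensor k ?AB C (?ab \<one>\<^bsub>A\<^esub> \<one>\<^bsub>B\<^esub>) c"
    unfolding BC.twist_one_right[OF c] by (assumption | rule tensor_lift_pure lin hyps c)+
  finally show "?T (pure_tensor k C (twisted_tensor k A B R1) c \<one>\<^bsub>twisted_tensor k A B R1\<^esub>)
    = pure_tensor k (twisted_tensor k A B R1) C \<one>\<^bsub>twisted_tensor k A B R1\<^esub> c" by simp
qed

text \<open>Here the regular module is \<open>A\<close> itself, whose action already is its product
  map. The twisted product is on the passing side, where
  \<open>product_compatible_cross_left\<close> speaks of it directly.\<close>

lemma unital_twisting_map_T2: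
  "unital_twisting_map k A (twisted_tensor k B C R2) (cross_left k A B C R1 R3)"
proof (intro unital_twisting_map.intro twisting_mapI unital_twisting_map_axioms.intro
    BC.assoc_algebra_twisted_tensor algs)
  let ?T = "cross_left k A B C R1 R3"
  show "linear_map k (twisted_tensor k B C R2 \<boxtimes> A) (A \<boxtimes> twisted_tensor k B C R2) ?T"
    using linear_T2 by simp
  show "product_compatible k (twisted_tensor k B C R2) A ?T"
    by (rule product_compatible_cross_left AB.product_compatible AC.product_compatible hexagon hyps)+
  have "action_compatible k A (B \<boxtimes> C) A ?T (product_map A) ?T"
    by (rule action_compatible_cross_left linear_product_map AB.action_compatible AC.action_compatible hyps)+
  then show "action_compatible k A (twisted_tensor k B C R2) A ?T (product_map A) ?T" by simp
next
  let ?T = "cross_left k A B C R1 R3"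
  let ?BC = "B \<boxtimes> C" and ?bc = "pure_tensor k B C"
  fix a assume a: "a \<in> carrier A"
  have "?T (pure_tensor k ?BC A (?bc \<one>\<^bsub>B\<^esub> \<one>\<^bsub>C\<^esub>) a) = tensor_lift (A \<boxtimes> ?BC) (\<lambda>a1 c1. tensor_lift (A \<boxtimes> ?BC)
        (\<lambda>a2 b1. pure_tensor k A ?BC a2 (?bc b1 c1)) (R1 (pure_tensor k B A \<one>\<^bsub>B\<^esub> a1))) (R3 (pure_tensor k C A \<one>\<^bsub>C\<^esub> a))"
    by (rule cross_left_pure hyps a)+
  also have "\<dots> = tensor_lift (A \<boxtimes> ?BC) (\<lambda>a2 b1. pure_tensor k A ?BC a2 (?bc b1 \<one>\<^bsub>C\<^esub>)) (R1 (pure_tensor k B A \<one>\<^bsub>B\<^esub> a))"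
    unfolding AC.twist_one_left[OF a]
    by (assumption | rule tensor_lift_pure lin hyps a linear_map_compose[OF AB.linear] linear_map_closed[OF AB.linear])+
  also have "\<dots> = pure_tensor k A ?BC a (?bc \<one>\<^bsub>B\<^esub> \<one>\<^bsub>C\<^esub>)"
    unfolding AB.twist_one_left[OF a] by (assumption | rule tensor_lift_pure lin hyps a)+
  finally show "?T (pure_tensor k (twisted_tensor k B C R2) A \<one>\<^bsub>twisted_tensor k B C R2\<^esub> a)
    = pure_tensor k A (twisted_tensor k B C R2) a \<one>\<^bsub>twisted_tensor k B C R2\<^esub>" by simp
next
  let ?T = "cross_left k A B C R1 R3"
  let ?BC = "B \<boxtimes> C" and ?bc = "pure_tensor k B C"
  have BC_mod: "module k ?BC" by (rule module_tensor[OF mods(2,3)])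
  fix s assume "s \<in> carrier (twisted_tensor k B C R2)"
  then have s: "s \<in> carrier ?BC" by simp
  have "?T (pure_tensor k ?BC A s \<one>\<^bsub>A\<^esub>) = pure_tensor k A ?BC \<one>\<^bsub>A\<^esub> s"
  proof (rule tensor_linear_cong[OF mods(2,3) module_tensor[OF mods(1) BC_mod] _ _ _ s,
        where f = "\<lambda>s. ?T (pure_tensor k ?BC A s \<one>\<^bsub>A\<^esub>)" and g = "\<lambda>s. pure_tensor k A ?BC \<one>\<^bsub>A\<^esub> s"])
    fix b c assume bc: "b \<in> carrier B" "c \<in> carrier C"
    have "?T (pure_tensor k ?BC A (?bc b c) \<one>\<^bsub>A\<^esub>) = tensor_lift (A \<boxtimes> ?BC) (\<lambda>a1 c1. tensor_lift (A \<boxtimes> ?BC)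
        (\<lambda>a2 b1. pure_tensor k A ?BC a2 (?bc b1 c1)) (R1 (pure_tensor k B A b a1))) (R3 (pure_tensor k C A c \<one>\<^bsub>A\<^esub>))"
      by (rule cross_left_pure hyps bc)+
    also have "\<dots> = tensor_lift (A \<boxtimes> ?BC) (\<lambda>a2 b1. pure_tensor k A ?BC a2 (?bc b1 c)) (R1 (pure_tensor k B A b \<one>\<^bsub>A\<^esub>))"
      unfolding AC.twist_one_right[OF bc(2)]
      by (assumption | rule tensor_lift_pure lin hyps bc linear_map_compose[OF AB.linear] linear_map_closed[OF AB.linear])+
    also have "\<dots> = pure_tensor k A ?BC \<one>\<^bsub>A\<^esub> (?bc b c)"
      unfolding AB.twist_one_right[OF bc(1)] by (assumption | rule tensor_lift_pure lin hyps bc)+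
    finally show "?T (pure_tensor k ?BC A (?bc b c) \<one>\<^bsub>A\<^esub>) = pure_tensor k A ?BC \<one>\<^bsub>A\<^esub> (?bc b c)" .
  qed (assumption | rule linear_map_compose[OF linear_T2] lin hyps)+
  then show "?T (pure_tensor k (twisted_tensor k B C R2) A s \<one>\<^bsub>A\<^esub>) = pure_tensor k A (twisted_tensor k B C R2) \<one>\<^bsub>A\<^esub> s"
    by simp
qed

end

theorem theorem2p11:
  fixes k :: "('k, 'r) ring_scheme" (structure)
    and A :: "('k, 'a) module" and B :: "('k, 'b) module" and C :: "('k, 'c) module"
    and M :: "('k, 'm) module" and N :: "('k, 'n) module" and P :: "('k, 'p) module"
    and R\<^sub>1 :: "('b, 'a) tensor \<Rightarrow> ('a, 'b) tensor"
    and R\<^sub>2 :: "('c, 'b) tensor \<Rightarrow> ('b, 'c) tensor"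
    and R\<^sub>3 :: "('c, 'a) tensor \<Rightarrow> ('a, 'c) tensor"
    and act\<^sub>M :: "('a, 'm) tensor \<Rightarrow> 'm"
    and act\<^sub>N :: "('b, 'n) tensor \<Rightarrow> 'n"
    and act\<^sub>P :: "('c, 'p) tensor \<Rightarrow> 'p"
    and \<tau>\<^sub>M\<^sub>B :: "('b, 'm) tensor \<Rightarrow> ('m, 'b) tensor"
    and \<tau>\<^sub>M\<^sub>C :: "('c, 'm) tensor \<Rightarrow> ('m, 'c) tensor"
    and \<tau>\<^sub>N\<^sub>C :: "('c, 'n) tensor \<Rightarrow> ('n, 'c) tensor"
  assumes "cring k"
    and "assoc_algebra k A" and "assoc_algebra k B" and "assoc_algebra k C"
    and "unital_twisting_map k A B R\<^sub>1"
    and "unital_twisting_map k B C R\<^sub>2"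
    and "unital_twisting_map k A C R\<^sub>3"
    and "hexagon k A B C R\<^sub>1 R\<^sub>2 R\<^sub>3"
    and "left_module k A M act\<^sub>M" and "left_module k B N act\<^sub>N" and "left_module k C P act\<^sub>P"
    and "module_twisting_map k A B R\<^sub>1 M act\<^sub>M \<tau>\<^sub>M\<^sub>B"
    and "module_twisting_map k A C R\<^sub>3 M act\<^sub>M \<tau>\<^sub>M\<^sub>C"
    and "module_twisting_map k B C R\<^sub>2 N act\<^sub>N \<tau>\<^sub>N\<^sub>C"
    and "hexagon k M B C \<tau>\<^sub>M\<^sub>B R\<^sub>2 \<tau>\<^sub>M\<^sub>C"
  defines "AB \<equiv> twisted_tensor k A B R\<^sub>1"
    and "BC \<equiv> twisted_tensor k B C R\<^sub>2"
    and "T\<^sub>1 \<equiv> cross_right k A B C R\<^sub>3 R\<^sub>2"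
    and "T\<^sub>2 \<equiv> cross_left k A B C R\<^sub>1 R\<^sub>3"
    and "\<sigma>\<^sub>C \<equiv> cross_right k M N C \<tau>\<^sub>M\<^sub>C \<tau>\<^sub>N\<^sub>C"
    and "\<sigma>\<^sub>B\<^sub>C \<equiv> cross_left k M B C \<tau>\<^sub>M\<^sub>B \<tau>\<^sub>M\<^sub>C"
    and "act\<^sub>M\<^sub>N \<equiv> induced_action k A B M N \<tau>\<^sub>M\<^sub>B act\<^sub>M act\<^sub>N"
    and "act\<^sub>N\<^sub>P \<equiv> induced_action k B C N P \<tau>\<^sub>N\<^sub>C act\<^sub>N act\<^sub>P"
  defines "act\<^sub>1 \<equiv> induced_action k AB C (M \<boxtimes> N) P \<sigma>\<^sub>C act\<^sub>M\<^sub>N act\<^sub>P"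
    and "act\<^sub>2 \<equiv> induced_action k A BC M (N \<boxtimes> P) \<sigma>\<^sub>B\<^sub>C act\<^sub>M act\<^sub>N\<^sub>P"
  shows
    "(module_twisting_map k AB C T\<^sub>1 (M \<boxtimes> N) act\<^sub>M\<^sub>N \<sigma>\<^sub>C \<and>
      left_action k (twisted_tensor k AB C T\<^sub>1) ((M \<boxtimes> N) \<boxtimes> P) act\<^sub>1) \<and>
     (module_twisting_map k A BC T\<^sub>2 M act\<^sub>M \<sigma>\<^sub>B\<^sub>C \<and>
      left_action k (twisted_tensor k A BC T\<^sub>2) (M \<boxtimes> (N \<boxtimes> P)) act\<^sub>2) \<and>
     (\<forall>t\<in>carrier (((A \<boxtimes> B) \<boxtimes> C) \<boxtimes> ((M \<boxtimes> N) \<boxtimes> P)).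
      assoc k M N P (act\<^sub>1 t) =
      act\<^sub>2 (tensor_map k (A \<boxtimes> (B \<boxtimes> C)) (M \<boxtimes> (N \<boxtimes> P)) (assoc k A B C) (assoc k M N P) t))"
proof -
  interpret twisting_hexagon k A B C R\<^sub>1 R\<^sub>2 R\<^sub>3
    by (intro twisting_hexagon.intro twisting_hexagon_axioms.intro assms)
  interpret MB: module_twisting_map k A B R\<^sub>1 M act\<^sub>M \<tau>\<^sub>M\<^sub>B by fact
  interpret MC: module_twisting_map k A C R\<^sub>3 M act\<^sub>M \<tau>\<^sub>M\<^sub>C by fact
  interpret NC: module_twisting_map k B C R\<^sub>2 N act\<^sub>N \<tau>\<^sub>N\<^sub>C by fact
  interpret P: left_module k C P act\<^sub>P by fact
  note mnp = MB.M.module_axioms NC.M.module_axioms P.M.module_axioms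
  note \<tau> = MB.module_twist_linear MC.module_twist_linear NC.module_twist_linear
  note acts = MB.action_linear NC.action_linear P.action_linear
  have MN: "left_action k AB (M \<boxtimes> N) act\<^sub>M\<^sub>N"
    unfolding AB_def act\<^sub>M\<^sub>N_def
    by (rule left_action_induced[OF assms(5) MB.module_twisting_map_axioms NC.left_action_axioms])
  have NP: "left_action k BC (N \<boxtimes> P) act\<^sub>N\<^sub>P"
    unfolding BC_def act\<^sub>N\<^sub>P_def
    by (rule left_action_induced[OF assms(6) NC.module_twisting_map_axioms P.left_action_axioms])
  \<comment> \<open>Unitality is carried along because \<open>left_action_induced\<close> is applied
    once more on top of \<open>T\<^sub>1\<close> and \<open>T\<^sub>2\<close>.\<close>
  have T1: "unital_twisting_map k AB C T\<^sub>1" and T2: "unital_twisting_map k A BC T\<^sub>2"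
    unfolding AB_def BC_def T\<^sub>1_def T\<^sub>2_def by (rule unital_twisting_map_T1 unital_twisting_map_T2)+
  have \<sigma>C: "module_twisting_map k AB C T\<^sub>1 (M \<boxtimes> N) act\<^sub>M\<^sub>N \<sigma>\<^sub>C"
  proof (rule module_twisting_mapI[OF unital_twisting_map.axioms(1)[OF T1] MN])
    show "linear_map k (C \<boxtimes> (M \<boxtimes> N)) ((M \<boxtimes> N) \<boxtimes> C) \<sigma>\<^sub>C"
      unfolding \<sigma>\<^sub>C_def by (rule linear_cross_right mnp mods \<tau>)+
    show "product_compatible k C (M \<boxtimes> N) \<sigma>\<^sub>C"
      unfolding \<sigma>\<^sub>C_def by (rule product_compatible_cross_right MC.module_product_compatible
          NC.module_product_compatible mnp algs \<tau>)+
    \<comment> \<open>For \<open>\<sigma>\<^sub>C\<close> the module hexagon,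
      \<open>assms(15)\<close>, enters in the action condition.\<close>
    have "action_compatible k (A \<boxtimes> B) C (M \<boxtimes> N) T\<^sub>1 act\<^sub>M\<^sub>N \<sigma>\<^sub>C"
      unfolding T\<^sub>1_def act\<^sub>M\<^sub>N_def \<sigma>\<^sub>C_def
      by (rule action_compatible_cross_right MC.module_action_compatible NC.module_action_compatible
          mnp mods algs \<tau> acts BC.linear AC.linear assms(15))+
    then show "action_compatible k AB C (M \<boxtimes> N) T\<^sub>1 act\<^sub>M\<^sub>N \<sigma>\<^sub>C"
      unfolding AB_def by simp
  qed
  have \<sigma>BC: "module_twisting_map k A BC T\<^sub>2 M act\<^sub>M \<sigma>\<^sub>B\<^sub>C"
  proof (rule module_twisting_mapI[OF unital_twisting_map.axioms(1)[OF T2] MB.left_action_axioms])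
    show "linear_map k (BC \<boxtimes> M) (M \<boxtimes> BC) \<sigma>\<^sub>B\<^sub>C"
      unfolding \<sigma>\<^sub>B\<^sub>C_def BC_def tensor_twisted by (rule linear_cross_left mnp mods \<tau>)+
    \<comment> \<open>For \<open>\<sigma>\<^sub>B\<^sub>C\<close> the module hexagon enters in the
      product condition instead.\<close>
    show "product_compatible k BC M \<sigma>\<^sub>B\<^sub>C"
      unfolding \<sigma>\<^sub>B\<^sub>C_def BC_def by (rule product_compatible_cross_left MB.module_product_compatible
          MC.module_product_compatible mnp algs \<tau> BC.linear assms(15))+
    have "action_compatible k A (B \<boxtimes> C) M T\<^sub>2 act\<^sub>M \<sigma>\<^sub>B\<^sub>C"
      unfolding T\<^sub>2_def \<sigma>\<^sub>B\<^sub>C_def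
      by (rule action_compatible_cross_left MB.module_action_compatible MC.module_action_compatible
          mnp mods algs \<tau> acts AB.linear AC.linear)+
    then show "action_compatible k A BC M T\<^sub>2 act\<^sub>M \<sigma>\<^sub>B\<^sub>C"
      unfolding BC_def by simp
  qed
  have "left_action k (twisted_tensor k AB C T\<^sub>1) ((M \<boxtimes> N) \<boxtimes> P) act\<^sub>1"
    unfolding act\<^sub>1_def by (rule left_action_induced[OF T1 \<sigma>C P.left_action_axioms])
  moreover have "left_action k (twisted_tensor k A BC T\<^sub>2) (M \<boxtimes> (N \<boxtimes> P)) act\<^sub>2"
    unfolding act\<^sub>2_def by (rule left_action_induced[OF T2 \<sigma>BC NP])
  \<comment> \<open>Both actions were built over twisted products, but an induced action depends
    only on the underlying modules, so the comparison takes place over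
    \<open>A \<boxtimes> B\<close> and \<open>B \<boxtimes> C\<close>.\<close>
  moreover have "assoc k M N P (act\<^sub>1 t) =
      act\<^sub>2 (tensor_map k (A \<boxtimes> (B \<boxtimes> C)) (M \<boxtimes> (N \<boxtimes> P)) (assoc k A B C) (assoc k M N P) t)"
    if "t \<in> carrier (((A \<boxtimes> B) \<boxtimes> C) \<boxtimes> ((M \<boxtimes> N) \<boxtimes> P))" for t
    unfolding act\<^sub>1_def act\<^sub>2_def AB_def BC_def induced_action_twisted \<sigma>\<^sub>C_def \<sigma>\<^sub>B\<^sub>C_def act\<^sub>M\<^sub>N_def act\<^sub>N\<^sub>P_def
    by (rule induced_actions_agree[OF mods mnp \<tau> acts that])
  ultimately show ?thesis using \<sigma>C \<sigma>BC by blast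
qed

end
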